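(* For $x\geq 2$, \begin{align*} \sum_{n\leq x}\Delta^2(1,1;n)=&\left(\tfrac12-\psi(x)\right)\Delta^2(1,1;x)+\int_1^x\Delta^2(1,1;t)\,dt+\tfrac16x\log^2x+\tfrac{8\gamma-1}{12}x\log x\\ &+\tfrac{8\gamma^2-2\gamma+1}{12}x+(\log x+2\gamma)G_{(1,1)}(x)+O(\sqrt{x}\log x). \end{align*}
   Context: Let $d(n)$ be the number of positive divisors of $n$, $\gamma$ Euler's constant, and $\Delta(1,1;x)=\sum_{n\leq x}d(n)-x\log x-(2\gamma-1)x$. For real $u$, $[u]$ is the integer part and $\psi(u)=u-[u]-\tfrac12$. Define $$G_{(1,1)}(x)=\frac{1}{2\sqrt2\pi^2}x^{3/4}\sum_{n=1}^\infty\frac{d(n)}{n^{5/4}}\sin\left(4\pi\sqrt{nx}-\frac\pi4\right).$$ *)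

theory Defs
  imports "HOL-Analysis.Analysis"
begin

(* Meaningful for n > 0 only: card of the infinite set of divisors of 0 is 0. *)
definition num_divisors :: "nat \<Rightarrow> nat" where
  "num_divisors n = card {k. k dvd n}"

definition Delta11 :: "real \<Rightarrow> real" where
  "Delta11 x = (\<Sum>n | 1 \<le> n \<and> real n \<le> x. real (num_divisors n))
     - x * ln x - (2 * euler_mascheroni - 1) * x"

definition psi :: "real \<Rightarrow> real" where
  "psi u = u - real_of_int \<lfloor>u\<rfloor> - 1 / 2"

(* suminf starts at 0, so the summation index is shifted by one. *)
definition G11 :: "real \<Rightarrow> real" where
  "G11 x = 1 / (2 * sqrt 2 * pi\<^sup>2) * x powr (3 / 4) *
     (\<Sum>n. real (num_divisors (Suc n)) / real (Suc n) powr (5 / 4) *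
        sin (4 * pi * sqrt (real (Suc n) * x) - pi / 4))"

end

theory Submission
  imports Defs
begin

text \<open>
  Write \<open>M' t = ln t + 2 * \<gamma>\<close>. On every interval between consecutive integers \<open>Delta11\<close> is smooth with derivative
  \<open>- M'\<close>, and integrating by parts there gives exactly
  \[ \sum_{n \le x} \Delta(n)^2 = (1/2 - \psi(x)) \Delta(x)^2 + \int_1^x \Delta^2 + \int_1^x (1 - 2\psi) \Delta M'. \]
  Integration by parts, with Dirichlet's bound for \<open>Delta11\<close>, shows that \<open>- 2 \<integral> \<psi> \<Delta> M'\<close> is
  \<open>\<integral> M'^2 / 6\<close> up to an admissible error. For \<open>\<integral> \<Delta> M'\<close> one starts from the exact identity
  \[ \int_1^x \sum_{n \le t} d(n) \frac{dt}{t} = \int_1^x [a] [x/a] \frac{da}{a}, \]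
  in which inserting \<open>[u] = u - 1/2 - \<psi> u\<close> leaves, besides elementary terms, only
  \<open>I(x) = \<integral> \<psi>(a) \<psi>(x/a) da/a\<close>. Expanding both sawtooth functions into Fourier series and putting
  \<open>a = e^s\<close>, the frequencies \<open>k\<close> and \<open>m\<close> contribute integrals of \<open>cos (\<lambda> sinh t)\<close> and \<open>cos (\<lambda> cosh t)\<close> with
  \<open>\<lambda> = 4 \<pi> sqrt (k m x)\<close>; the latter has a stationary point at \<open>t = 0\<close>, and a Fresnel integral
  yields the general term of the series for \<open>G11 x / x\<close>. Hence \<open>I(x) = G11 x / x + O(1 / sqrt x)\<close>.
\<close>

text \<open>The sizes of the errors dictate the route. \<open>G11 x / x\<close>, and with it
  \<open>psi_conv x\<close>, is only bounded by a multiple of \<open>x powr (- (1/4))\<close>;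
  estimating the integral of \<open>psi_conv\<close> against a logarithmic weight by absolute values
  would thus cost \<open>x powr (3/4)\<close> times a logarithm, the size of the term to be
  isolated. Two things avoid this: the primitive of \<open>psi_conv\<close> is O(sqrt x), and the
  series is needed only at the single point x, where \<open>psi_conv\<close> occurs as a boundary
  term. For fixed x, mean square convergence controls a product of two such series, and the error
  for the frequencies k and m, coefficients included, is O((k m)^(-9/8) / sqrt x), which is summable
  before the truncation is removed. The elementary terms have two sources: the product 1/4 of the
  constants -1/2 in the two floors gives x M'(x) / 4 - x / 4, and the mean -1/12 of
  \<open>psi2\<close> gives one sixth of the integral of M'^2.\<close>

section \<open>Integration on compact intervals with finitely many exceptional points\<close>

lemma integrable_on_bounded_borel:
  fixes f :: "real \<Rightarrow> real"
  assumes "f \<in> borel_measurable borel" and "\<And>t. a \<le> t \<Longrightarrow> t \<le> b \<Longrightarrow> \<bar>f t\<bar> \<le> B"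
  shows "f integrable_on {a..b}"
proof -
  have "set_integrable lborel {a..b} f"
    unfolding set_integrable_def
  proof (rule integrableI_bounded_set[where A="{a..b}" and B=B])
    show "emeasure lborel {a..b} < \<infinity>" by (cases "a \<le> b") auto
  qed (use assms in \<open>simp_all add: indicator_def\<close>)
  then show ?thesis by (rule set_borel_integral_eq_integral)
qed

text \<open>Antiderivatives built from the sawtooth have corners at integers or at their preimages.
  Only continuity is asked for there, so no interval has to be cut at these points.\<close>

lemma FTC_piecewise:
  fixes F f :: "real \<Rightarrow> real"
  assumes "finite S" "a \<le> b" "continuous_on {a..b} F"
    and "\<And>t. a < t \<Longrightarrow> t < b \<Longrightarrow> t \<notin> S \<Longrightarrow> (F has_real_derivative f t) (at t)"
  shows "(f has_integral (F b - F a)) {a..b}"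
  by (rule fundamental_theorem_of_calculus_interior_strong[OF assms(1,2) _ assms(3)])
     (use assms(4) in \<open>auto simp: has_real_derivative_iff_has_vector_derivative[symmetric]\<close>)

lemma abs_integral_le_integral:
  fixes f g :: "real \<Rightarrow> real"
  assumes "f integrable_on {a..b}" "(g has_integral I) {a..b}"
    and "\<And>t. a \<le> t \<Longrightarrow> t \<le> b \<Longrightarrow> \<bar>f t\<bar> \<le> g t"
  shows "\<bar>integral {a..b} f\<bar> \<le> I"
  using integral_norm_bound_integral[OF assms(1), of g] assms(2,3)
  by (auto simp: has_integral_iff)

lemma finite_Ints_Icc: "finite ({a..b::real} \<inter> \<int>)"
proof -
  have "{a..b} \<inter> \<int> \<subseteq> real_of_int ` {\<lfloor>a\<rfloor>..\<lceil>b\<rceil>}"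
  proof
    fix t assume "t \<in> {a..b} \<inter> \<int>"
    then obtain n where "t = of_int n" "a \<le> of_int n" "of_int n \<le> b" by (auto elim: Ints_cases)
    moreover from this have "n \<in> {\<lfloor>a\<rfloor>..\<lceil>b\<rceil>}" by simp linarith
    ultimately show "t \<in> real_of_int ` {\<lfloor>a\<rfloor>..\<lceil>b\<rceil>}" by blast
  qed
  then show ?thesis by (rule finite_subset) simp
qed

lemma finite_vimage_Ints:
  fixes g :: "real \<Rightarrow> real"
  assumes "inj g" "\<And>t. a \<le> t \<Longrightarrow> t \<le> b \<Longrightarrow> c \<le> g t \<and> g t \<le> d"
  shows "finite {t\<in>{a..b}. g t \<in> \<int>}"
proof -
  have "{t\<in>{a..b}. g t \<in> \<int>} \<subseteq> g -` ({c..d} \<inter> \<int>)"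
    using assms(2) by auto
  then show ?thesis
    using finite_vimageI[OF finite_Ints_Icc assms(1)] finite_subset by blast
qed

section \<open>The sawtooth function and its antiderivatives\<close>

text \<open>In terms of the periodic Bernoulli polynomials B_2 and B_3, \<open>psi2\<close> is (B_2
  - 1/6) / 2 and \<open>psi3\<close> is B_3 / 6. Hence \<open>psi2\<close> has mean -1/12, and
  \<open>psi3\<close> is a periodic antiderivative of \<open>psi2 u + 1/12\<close>, not of
  \<open>psi2\<close>.\<close>

definition psi2 :: "real \<Rightarrow> real" where "psi2 u = ((psi u)\<^sup>2 - 1/4) / 2"
definition psi3 :: "real \<Rightarrow> real" where "psi3 u = ((psi u)^3 - psi u / 4) / 6"

lemma psi_bound: "\<bar>psi u\<bar> \<le> 1/2"
  unfolding psi_def by linarith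

lemma psi2_bound: "\<bar>psi2 u\<bar> \<le> 1/8"
proof -
  have "\<bar>psi u\<bar>\<^sup>2 \<le> (1/2)\<^sup>2" by (rule power_mono[OF psi_bound]) simp
  then have "(psi u)\<^sup>2 \<le> 1/4" by (simp add: power_divide)
  then show ?thesis unfolding psi2_def using zero_le_power2[of "psi u"]
    by (simp add: abs_le_iff field_simps)
qed

lemma psi3_bound: "\<bar>psi3 u\<bar> \<le> 1/24"
proof -
  have "psi3 u = psi u * psi2 u / 3"
    by (simp add: psi3_def psi2_def power2_eq_square power3_eq_cube field_simps)
  then have "\<bar>psi3 u\<bar> = \<bar>psi u\<bar> * \<bar>psi2 u\<bar> / 3" by (simp only: abs_mult abs_divide abs_numeral)
  also have "\<dots> \<le> (1/2) * (1/8) / 3"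
    by (intro divide_right_mono mult_mono psi_bound psi2_bound) auto
  finally show ?thesis by simp
qed

lemma psi_of_int [simp]: "psi (of_int n) = -1/2"
  by (simp add: psi_def)

lemma psi2_Ints: "u \<in> \<int> \<Longrightarrow> psi2 u = 0"
  by (auto simp: Ints_def psi2_def power2_eq_square)

lemma psi_measurable [measurable]: "psi \<in> borel_measurable borel"
proof -
  have "(\<lambda>u. u - real_of_int \<lfloor>u\<rfloor> - 1 / 2) \<in> borel_measurable borel"
    by (intro borel_measurable_diff borel_measurable_real_floor) auto
  then show ?thesis by (simp add: psi_def[abs_def])
qed

lemma psi2_measurable [measurable]: "psi2 \<in> borel_measurable borel"
  unfolding psi2_def[abs_def] by measurable

lemma psi_deriv: "u \<notin> \<int> \<Longrightarrow> (psi has_real_derivative 1) (at u)"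
  unfolding psi_def[abs_def]
  using floor_has_real_derivative[of u "\<lambda>z. z"] by (auto intro!: derivative_eq_intros)

lemma psi2_deriv: "u \<notin> \<int> \<Longrightarrow> (psi2 has_real_derivative psi u) (at u)"
proof -
  assume u: "u \<notin> \<int>"
  have "((\<lambda>u. ((psi u)^2 - 1/4) / 2) has_real_derivative (2 * psi u ^ 1 * 1 - 0) / 2) (at u)"
    by (rule derivative_eq_intros psi_deriv[OF u] refl | simp)+
  then show ?thesis by (simp add: psi2_def[abs_def])
qed

lemma psi3_deriv: "u \<notin> \<int> \<Longrightarrow> (psi3 has_real_derivative psi2 u + 1/12) (at u)"
proof -
  assume u: "u \<notin> \<int>"
  have "((\<lambda>u. (1/6) * (psi u)^3 - (1/24) * psi u) has_real_derivative
          (1/6) * (3 * psi u ^ 2 * 1) - (1/24) * 1) (at u)"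
    by (rule derivative_eq_intros psi_deriv[OF u] refl | simp)+
  moreover have "(\<lambda>u. (1/6) * (psi u)^3 - (1/24) * psi u) = psi3"
    by (auto simp: psi3_def)
  ultimately show ?thesis by (simp add: psi2_def field_simps)
qed

text \<open>Between consecutive integers \<open>psi2\<close> is half the product of the signed
  distances to them, and one of these distances is at most 1 in absolute value.\<close>

lemma psi2_near_int: "\<bar>u - of_int n\<bar> < 1 \<Longrightarrow> \<bar>psi2 u\<bar> \<le> \<bar>u - of_int n\<bar> / 2"
proof -
  assume "\<bar>u - of_int n\<bar> < 1"
  then consider "\<lfloor>u\<rfloor> = n" "of_int n \<le> u" | "\<lfloor>u\<rfloor> = n - 1" "u < of_int n" by linarith
  then show ?thesis
  proof cases
    case 1
    have "psi2 u = (u - n) * (u - n - 1) / 2" unfolding psi2_def psi_def 1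
      by (simp add: power2_eq_square field_simps)
    then have "\<bar>psi2 u\<bar> = \<bar>u - n\<bar> * \<bar>u - n - 1\<bar> / 2" by (simp only: abs_mult abs_divide abs_numeral)
    also have "\<dots> \<le> \<bar>u - n\<bar> * 1 / 2" using 1 by (intro divide_right_mono mult_left_mono) linarith+
    finally show ?thesis by simp
  next
    case 2
    have "psi2 u = (u - n) * (u - n + 1) / 2" unfolding psi2_def psi_def 2
      by (simp add: power2_eq_square field_simps)
    then have "\<bar>psi2 u\<bar> = \<bar>u - n\<bar> * \<bar>u - n + 1\<bar> / 2" by (simp only: abs_mult abs_divide abs_numeral)
    also have "\<dots> \<le> \<bar>u - n\<bar> * 1 / 2" using 2 by (intro divide_right_mono mult_left_mono) linarith+
    finally show ?thesis by simp
  qed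
qed

lemma psi2_tendsto_int: "(psi2 \<longlongrightarrow> 0) (at (of_int n))"
proof (rule Lim_null_comparison)
  have "\<forall>\<^sub>F u in at (of_int n). dist u (of_int n) < (1::real)"
    by (auto simp: eventually_at intro!: exI[of _ 1])
  then show "\<forall>\<^sub>F u in at (of_int n). norm (psi2 u) \<le> \<bar>u - of_int n\<bar> / 2"
    by eventually_elim (use psi2_near_int in \<open>auto simp: dist_real_def\<close>)
  show "((\<lambda>u::real. \<bar>u - of_int n\<bar> / 2) \<longlongrightarrow> 0) (at (of_int n))"
    by (auto intro!: tendsto_eq_intros)
qed

lemma psi2_isCont: "isCont psi2 u"
proof (cases "u \<in> \<int>")
  case False
  then show ?thesis using psi2_deriv DERIV_isCont by blast
next
  case True
  then obtain n where "u = of_int n" by (auto elim: Ints_cases)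
  then show ?thesis using psi2_tendsto_int[of n] psi2_Ints[OF True] by (simp add: isCont_def)
qed

lemma psi2_continuous_on: "continuous_on A psi2"
  by (simp add: continuous_at_imp_continuous_on psi2_isCont)

text \<open>\<open>psi\<close> jumps at the integers, but \<open>psi3 u = psi u * psi2 u / 3\<close>
  and the second factor vanishes there.\<close>

lemma psi3_isCont: "isCont psi3 u"
proof (cases "u \<in> \<int>")
  case False
  then show ?thesis using psi3_deriv DERIV_isCont by blast
next
  case True
  have *: "psi3 = (\<lambda>u. psi u * psi2 u / 3)"
    by (intro ext) (simp add: psi3_def psi2_def power2_eq_square power3_eq_cube field_simps)
  from True obtain n where n: "u = of_int n" by (auto elim: Ints_cases)
  have "((\<lambda>v. psi v * psi2 v / 3) \<longlongrightarrow> 0) (at (of_int n))"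
  proof (rule Lim_null_comparison)
    show "\<forall>\<^sub>F v in at (of_int n). norm (psi v * psi2 v / 3) \<le> \<bar>psi2 v\<bar>"
    proof (intro always_eventually allI)
      fix v
      have "norm (psi v * psi2 v / 3) = \<bar>psi v\<bar> / 3 * \<bar>psi2 v\<bar>" by (simp add: abs_mult)
      also have "\<dots> \<le> 1 * \<bar>psi2 v\<bar>" using psi_bound[of v] by (intro mult_right_mono) auto
      finally show "norm (psi v * psi2 v / 3) \<le> \<bar>psi2 v\<bar>" by simp
    qed
    show "((\<lambda>v. \<bar>psi2 v\<bar>) \<longlongrightarrow> 0) (at (of_int n))"
      using tendsto_rabs_zero[OF psi2_tendsto_int] .
  qed
  then show ?thesis using n psi2_Ints[OF True] by (simp add: isCont_def * )
qed

section \<open>The divisor problem\<close>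

definition divsum :: "real \<Rightarrow> real" where
  "divsum t = (\<Sum>n | 1 \<le> n \<and> real n \<le> t. real (num_divisors n))"

definition divmain :: "real \<Rightarrow> real" where
  "divmain t = t * ln t + (2 * euler_mascheroni - 1) * t"

definition divmain' :: "real \<Rightarrow> real" where
  "divmain' t = ln t + 2 * euler_mascheroni"

lemma Delta11_eq: "Delta11 t = divsum t - divmain t"
  by (simp add: Delta11_def divsum_def divmain_def)

lemma nat_le_real_set: "{n. 1 \<le> n \<and> real n \<le> t} = {1..nat \<lfloor>t\<rfloor>}"
proof -
  have "real n \<le> t \<longleftrightarrow> n \<le> nat \<lfloor>t\<rfloor>" if "1 \<le> n" for n
    using that by linarith
  then show ?thesis by auto
qed

lemma divsum_floor: "divsum t = (\<Sum>n=1..nat \<lfloor>t\<rfloor>. real (num_divisors n))"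
  unfolding divsum_def nat_le_real_set ..

lemma divsum_const:
  assumes "real N \<le> t" "t < real N + 1"
  shows "divsum t = divsum (real N)"
proof -
  have "\<lfloor>t\<rfloor> = int N" using assms by linarith
  then show ?thesis by (simp add: divsum_floor)
qed

lemma divsum_measurable [measurable]: "divsum \<in> borel_measurable borel"
proof -
  have "(\<lambda>i::int. \<Sum>n=1..nat i. real (num_divisors n)) \<in> measurable (count_space UNIV) borel"
    by simp
  from measurable_compose[OF measurable_real_floor this]
  show ?thesis by (simp add: divsum_floor[abs_def])
qed

lemma divmain_measurable [measurable]: "divmain \<in> borel_measurable borel"
  unfolding divmain_def[abs_def] by measurable

lemma divmain'_measurable [measurable]: "divmain' \<in> borel_measurable borel"
  unfolding divmain'_def[abs_def] by measurable

lemma Delta11_measurable [measurable]: "Delta11 \<in> borel_measurable borel"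
  unfolding Delta11_eq[abs_def] by measurable

lemma divmain_deriv: "t > 0 \<Longrightarrow> (divmain has_real_derivative divmain' t) (at t)"
  unfolding divmain_def[abs_def] divmain'_def
  by (rule derivative_eq_intros refl | assumption)+ (simp add: field_simps)

lemma divmain'_deriv: "t > 0 \<Longrightarrow> (divmain' has_real_derivative 1 / t) (at t)"
  unfolding divmain'_def[abs_def] by (auto intro!: derivative_eq_intros)

lemma divsum_deriv:
  assumes "t > 0" "t \<notin> \<int>"
  shows "(divsum has_real_derivative 0) (at t)"
proof -
  define N where "N = nat \<lfloor>t\<rfloor>"
  have "t \<noteq> of_int \<lfloor>t\<rfloor>" using assms(2) by (metis Ints_of_int)
  then have t: "real N < t" "t < real N + 1" unfolding N_def using assms(1) by linarith+
  have "((\<lambda>_. divsum (real N)) has_real_derivative 0) (at t)" by simp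
  then show ?thesis
  proof (rule has_field_derivative_transform_within_open)
    show "divsum (real N) = divsum u" if "u \<in> {real N<..<real N + 1}" for u
      using divsum_const[of N u] that by simp
  qed (use t in auto)
qed

lemma Delta11_deriv:
  assumes "t > 0" "t \<notin> \<int>"
  shows "(Delta11 has_real_derivative - divmain' t) (at t)"
  unfolding Delta11_eq[abs_def]
  using DERIV_diff[OF divsum_deriv[OF assms] divmain_deriv[OF assms(1)]] by simp

definition hyp :: "nat \<Rightarrow> (nat \<times> nat) set" where
  "hyp N = {(k, m). 1 \<le> k \<and> 1 \<le> m \<and> k * m \<le> N}"

lemma hyp_subset: "hyp N \<subseteq> {1..N} \<times> {1..N}"
proof
  fix p assume "p \<in> hyp N"
  then obtain k m where p: "p = (k, m)" "1 \<le> k" "1 \<le> m" "k * m \<le> N" by (auto simp: hyp_def)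
  have "k * 1 \<le> k * m" "1 * m \<le> k * m" using p by (intro mult_le_mono; simp)+
  then have "k \<le> N" "m \<le> N" using p(4) by linarith+
  with p show "p \<in> {1..N} \<times> {1..N}" by auto
qed

lemma finite_hyp: "finite (hyp N)"
  using hyp_subset by (rule finite_subset) simp

lemma num_divisors_conv_pairs:
  assumes "n \<ge> 1"
  shows "num_divisors n = card {(k, m). k * m = n}"
proof -
  have "bij_betw (\<lambda>k. (k, n div k)) {k. k dvd n} {(k, m). k * m = n}"
    by (rule bij_betwI[where g=fst]) (use assms in auto)
  then show ?thesis unfolding num_divisors_def by (rule bij_betw_same_card)
qed

lemma sum_num_divisors: "(\<Sum>n=1..N. num_divisors n) = card (hyp N)"
proof -
  have "(\<Sum>n=1..N. num_divisors n) = (\<Sum>n=1..N. card {(k, m). k * m = n})"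
    by (intro sum.cong refl num_divisors_conv_pairs) auto
  also have "\<dots> = card (\<Union>n\<in>{1..N}. {(k, m). k * m = n})"
  proof (rule card_UN_disjoint[symmetric])
    have "{(k, m). k * m = n} \<subseteq> hyp n" if "n \<in> {1..N}" for n
      using that by (auto simp: hyp_def intro: Suc_leI)
    then show "\<forall>n\<in>{1..N}. finite {(k, m). k * m = n}"
      using finite_hyp finite_subset by blast
  qed auto
  also have "(\<Union>n\<in>{1..N}. {(k, m). k * m = n}) = hyp N"
    by (auto simp: hyp_def)
  finally show ?thesis .
qed

lemma divsum_hyp: "divsum t = real (card (hyp (nat \<lfloor>t\<rfloor>)))"
  unfolding divsum_floor sum_num_divisors[symmetric] by simp

text \<open>Dirichlet's hyperbola method: a point under the hyperbola has a coordinate at most q,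
  the integer square root of N. The two regions obtained this way are mirror images and overlap in a
  full q by q square. The subtraction is the reason for counting in \<open>int\<close>.\<close>

lemma card_hyp:
  assumes "q * q \<le> N" "N < (q + 1) * (q + 1)"
  shows "int (card (hyp N)) = 2 * (\<Sum>k=1..q. int (N div k)) - int (q * q)"
proof -
  define A where "A = {(k, m) \<in> hyp N. k \<le> q}"
  define B where "B = {(k, m) \<in> hyp N. m \<le> q}"
  have fin: "finite A" "finite B" unfolding A_def B_def
    by (rule finite_subset[OF _ finite_hyp[of N]], auto)+
  have "A = (SIGMA k:{1..q}. {1..N div k})"
    by (auto simp: A_def hyp_def less_eq_div_iff_mult_less_eq mult.commute)
  then have "card A = (\<Sum>k=1..q. N div k)" by simp
  moreover have "bij_betw prod.swap A B"
    by (rule bij_betwI[where g=prod.swap]) (auto simp: A_def B_def hyp_def mult.commute)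
  then have "card A = card B" by (rule bij_betw_same_card)
  moreover have "A \<union> B = hyp N"
  proof -
    have "k \<le> q \<or> m \<le> q" if "k * m \<le> N" for k m
    proof (rule ccontr)
      assume "\<not> (k \<le> q \<or> m \<le> q)"
      then have "(q + 1) * (q + 1) \<le> k * m" by (intro mult_le_mono) auto
      with that assms(2) show False by simp
    qed
    then show ?thesis by (auto simp: A_def B_def hyp_def)
  qed
  moreover have "A \<inter> B = {1..q} \<times> {1..q}"
  proof -
    have "k * m \<le> N" if "k \<le> q" "m \<le> q" for k m
      using mult_le_mono[OF that] assms(1) by simp
    then show ?thesis by (auto simp: A_def B_def hyp_def)
  qed
  then have "card (A \<inter> B) = q * q" by simp
  ultimately show ?thesis using card_Un_Int[OF fin] by (simp flip: of_nat_sum of_nat_mult)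
qed

text \<open>The number \<open>harm q - euler_mascheroni\<close> lies between \<open>ln q\<close> and
  \<open>ln (q + 1)\<close>, and so does \<open>ln y\<close>; this window has length at most 1 /
  q.\<close>

lemma harm_approx:
  assumes "q \<ge> 1" "real q \<le> y" "y \<le> real q + 1"
  shows "\<bar>harm q - euler_mascheroni - ln y\<bar> \<le> 1 / real q"
proof -
  obtain n where n: "q = Suc n" using assms(1) by (cases q) auto
  have "harm q - euler_mascheroni \<le> ln (real q + 1)"
  proof -
    have "0 \<le> 1 / real (2 * (n + 2))" by simp
    then have "harm q - euler_mascheroni \<le> ln (real (n + 2))"
      using euler_mascheroni_lower[of n] unfolding n by linarith
    also have "real (n + 2) = real q + 1" using n by simp
    finally show ?thesis .
  qed
  moreover have "harm q - euler_mascheroni \<ge> ln (real q)"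
  proof -
    have "decseq (\<lambda>n. harm (Suc n) - ln (real (Suc n)) :: real)"
      using decseq_harm_diff_ln by simp
    moreover have "(\<lambda>n. harm (Suc n) - ln (real (Suc n)) :: real) \<longlonglongrightarrow> euler_mascheroni"
      using euler_mascheroni_LIMSEQ by (rule LIMSEQ_Suc)
    ultimately show ?thesis using decseq_ge[of _ _ n] n by fastforce
  qed
  moreover have "ln (real q) \<le> ln y" "ln y \<le> ln (real q + 1)" using assms by auto
  moreover have "ln (real q + 1) - ln (real q) \<le> 1 / real q"
  proof -
    have "ln (real q + 1) - ln (real q) = ln ((real q + 1) / real q)" using assms(1)
      by (simp add: ln_div)
    also have "\<dots> = ln (1 + 1 / real q)" using assms(1) by (simp add: add_divide_distrib add.commute)
    also have "\<dots> \<le> 1 / real q" using assms(1) by (intro ln_add_one_self_le_self) auto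
    finally show ?thesis .
  qed
  ultimately show ?thesis by linarith
qed

text \<open>The constant is 8 = 2 + 4 + 2: replacing the quotients \<open>N div k\<close> by x / k
  costs sqrt x and is counted twice, replacing the harmonic sum costs 2 sqrt x and is counted twice,
  and x differs from the square of q by at most 2 sqrt x.\<close>

lemma Delta11_bound:
  assumes x: "x \<ge> 1"
  shows "\<bar>Delta11 x\<bar> \<le> 8 * sqrt x"
proof -
  define y where "y = sqrt x"
  define N where "N = nat \<lfloor>x\<rfloor>"
  define q where "q = nat \<lfloor>y\<rfloor>"
  have y: "y \<ge> 1" "y * y = x" using x by (auto simp: y_def)
  have N: "real N \<le> x" "x < real N + 1" unfolding N_def using x by linarith+
  have q: "real q \<le> y" "y < real q + 1" "q \<ge> 1" unfolding q_def using y by linarith+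
  have "real q * real q \<le> y * y" using q by (intro mult_mono) auto
  then have "real (q * q) < real N + 1" using y N by simp
  then have q1: "q * q \<le> N" by linarith
  have "y * y < (real q + 1) * (real q + 1)" using q y by (intro mult_strict_mono) auto
  then have "real N < real ((q + 1) * (q + 1))" using y N by (simp only: of_nat_mult of_nat_add of_nat_1)
  then have q2: "N < (q + 1) * (q + 1)" by (simp only: of_nat_less_iff)
  have *: "\<bar>real (N div k) - x / real k\<bar> \<le> 1" if "k \<in> {1..q}" for k
  proof -
    have "k \<ge> 1" using that by simp
    have "real (N div k) * real k \<le> real N" by (metis div_times_less_eq_dividend of_nat_le_iff of_nat_mult)
    then have 1: "real (N div k) * real k \<le> x" using N by linarith
    have "N < (N div k + 1) * k" using \<open>k \<ge> 1\<close> by (simp add: dividend_less_div_times)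
    then have "N + 1 \<le> (N div k + 1) * k" by simp
    then have "real (N + 1) \<le> real ((N div k + 1) * k)" by (simp only: of_nat_le_iff)
    moreover have "real ((N div k + 1) * k) = (real (N div k) + 1) * real k" by (simp add: algebra_simps)
    ultimately have 2: "x \<le> (real (N div k) + 1) * real k" using N by linarith
    show ?thesis using 1 2 \<open>k \<ge> 1\<close> by (simp add: abs_le_iff field_simps)
  qed
  have h: "real (card (hyp N)) = 2 * (\<Sum>k=1..q. real (N div k)) - real q * real q"
    using arg_cong[OF card_hyp[OF q1 q2], of real_of_int] by simp
  have "\<bar>(\<Sum>k=1..q. real (N div k)) - x * harm q\<bar> = \<bar>\<Sum>k=1..q. real (N div k) - x / real k\<bar>"
    by (simp add: harm_def sum_subtractf sum_distrib_left divide_inverse)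
  also have "\<dots> \<le> (\<Sum>k=1..q. \<bar>real (N div k) - x / real k\<bar>)" by (rule sum_abs)
  also have "\<dots> \<le> (\<Sum>k=1..q. 1)" by (intro sum_mono *)
  also have "\<dots> \<le> y" using q by simp
  finally have A: "\<bar>(\<Sum>k=1..q. real (N div k)) - x * harm q\<bar> \<le> y" .
  have "\<bar>x * harm q - x * (euler_mascheroni + ln y)\<bar> = x * \<bar>harm q - euler_mascheroni - ln y\<bar>"
    using x by (simp add: abs_mult flip: right_diff_distrib)
  also have "\<dots> \<le> x * (1 / real q)" using q x by (intro mult_left_mono harm_approx) auto
  also have "\<dots> \<le> x * (2 / y)"
  proof (intro mult_left_mono)
    have y2: "y \<le> 2 * real q" using q by linarith
    have "1 / real q = 2 / (2 * real q)" using q by simp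
    also have "\<dots> \<le> 2 / y" using y2 y by (intro divide_left_mono) auto
    finally show "1 / real q \<le> 2 / y" .
  qed (use x in simp)
  also have "\<dots> = 2 * y" using y by (simp add: field_simps)
  finally have B: "\<bar>x * harm q - x * (euler_mascheroni + ln y)\<bar> \<le> 2 * y" .
  have "\<bar>y * y - real q * real q\<bar> = (y - real q) * (y + real q)"
    using \<open>real q * real q \<le> y * y\<close> by (simp add: algebra_simps)
  also have "\<dots> \<le> 1 * (2 * y)" using q by (intro mult_mono) auto
  finally have C: "\<bar>x - real q * real q\<bar> \<le> 2 * y" using y by simp
  have l: "ln y = ln x / 2" unfolding y_def using x by (simp add: ln_sqrt)
  have "Delta11 x = real (card (hyp N)) - (2 * (x * (euler_mascheroni + ln y)) - x)"
    unfolding Delta11_eq divsum_hyp N_def divmain_def l by (simp add: algebra_simps)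
  then show ?thesis using A B C h unfolding y_def[symmetric] by linarith
qed

section \<open>The sum over squares as an integral\<close>

text \<open>On this interval \<open>1 - 2 * psi t\<close> is \<open>- 2 * (t - real N - 1)\<close>,
  so the integrand is the derivative of \<open>(t - real N - 1) * (Delta11 t)^2\<close>. The linear
  factor vanishes at N + 1 and equals -1 at N: a full interval contributes exactly the square at its
  left end, and the left limit at the next jump drops out.\<close>

lemma sum_squares_step:
  fixes y :: real
  assumes "N \<ge> 1" "real N \<le> y" "y \<le> real N + 1"
  shows "((\<lambda>t. (Delta11 t)\<^sup>2 + (1 - 2 * psi t) * (Delta11 t * divmain' t)) has_integral
           (Delta11 (real N))\<^sup>2 + (y - real N - 1) * (divsum (real N) - divmain y)\<^sup>2) {real N..y}"
proof -
  define c where "c = divsum (real N)"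
  define F where "F t = (t - real N - 1) * (c - divmain t)\<^sup>2" for t
  have "((\<lambda>t. (c - divmain t)\<^sup>2 - 2 * (t - real N - 1) * ((c - divmain t) * divmain' t)) has_integral
          (F y - F (real N))) {real N..y}"
  proof (rule FTC_piecewise[where S="{}"])
    have F': "(F has_real_derivative (c - divmain t)\<^sup>2 - 2 * (t - real N - 1) * ((c - divmain t) * divmain' t)) (at t)"
      if "real N \<le> t" for t
      unfolding F_def[abs_def]
      by (rule derivative_eq_intros divmain_deriv refl | use that assms in simp)+
    then show "continuous_on {real N..y} F"
      by (intro continuous_at_imp_continuous_on ballI DERIV_isCont) auto
    show "(F has_real_derivative (c - divmain t)\<^sup>2 - 2 * (t - real N - 1) * ((c - divmain t) * divmain' t)) (at t)"
      if "real N < t" for t using F'[of t] that by simp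
  qed (use assms in auto)
  moreover have "F y - F (real N) = (Delta11 (real N))\<^sup>2 + (y - real N - 1) * (divsum (real N) - divmain y)\<^sup>2"
    by (simp add: F_def c_def Delta11_eq)
  ultimately have I: "((\<lambda>t. (c - divmain t)\<^sup>2 - 2 * (t - real N - 1) * ((c - divmain t) * divmain' t)) has_integral
          (Delta11 (real N))\<^sup>2 + (y - real N - 1) * (divsum (real N) - divmain y)\<^sup>2) {real N..y}"
    by simp
  show ?thesis
  \<comment> \<open>If y = N + 1, then \<open>psi\<close> and \<open>divsum\<close> have already
    jumped at y. For the same reason the claim speaks of \<open>divsum (real N) - divmain y\<close>
    instead of \<open>Delta11 y\<close>.\<close>
  proof (rule has_integral_spike_finite[OF _ _ I, of "{y}"])
    fix t assume "t \<in> {real N..y} - {y}"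
    then have t: "real N \<le> t" "t < real N + 1" using assms by auto
    then have "\<lfloor>t\<rfloor> = int N" by linarith
    then have p: "psi t = t - real N - 1/2" by (simp add: psi_def)
    have d: "Delta11 t = c - divmain t" using divsum_const[OF t] by (simp add: Delta11_eq c_def)
    show "(Delta11 t)\<^sup>2 + (1 - 2 * psi t) * (Delta11 t * divmain' t) =
      (c - divmain t)\<^sup>2 - 2 * (t - real N - 1) * ((c - divmain t) * divmain' t)"
      unfolding p d by (simp add: algebra_simps)
  qed simp
qed

lemma sum_squares_nat:
  "((\<lambda>t. (Delta11 t)\<^sup>2 + (1 - 2 * psi t) * (Delta11 t * divmain' t)) has_integral
      (\<Sum>n=1..N. (Delta11 (real n))\<^sup>2)) {1..real (Suc N)}"
proof (induction N)
  case (Suc N)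
  have "((\<lambda>t. (Delta11 t)\<^sup>2 + (1 - 2 * psi t) * (Delta11 t * divmain' t)) has_integral
           (Delta11 (real (Suc N)))\<^sup>2) {real (Suc N)..real (Suc (Suc N))}"
    using sum_squares_step[of "Suc N" "real (Suc (Suc N))"] by simp
  from has_integral_combine[OF _ _ Suc.IH this] show ?case by simp
qed (simp add: has_integral_refl)

lemma sum_squares_identity:
  assumes x: "x \<ge> 1"
  shows "((\<lambda>t. (Delta11 t)\<^sup>2 + (1 - 2 * psi t) * (Delta11 t * divmain' t)) has_integral
      (\<Sum>n | 1 \<le> n \<and> real n \<le> x. (Delta11 (real n))\<^sup>2) - (1/2 - psi x) * (Delta11 x)\<^sup>2) {1..x}"
proof -
  define N where "N = nat \<lfloor>x\<rfloor> - 1"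
  have S: "nat \<lfloor>x\<rfloor> = Suc N" using x unfolding N_def by linarith
  then have f: "\<lfloor>x\<rfloor> = int (Suc N)" by linarith
  then have N: "real (Suc N) \<le> x" "x < real (Suc N) + 1" by linarith+
  have "psi x = x - real (Suc N) - 1/2" by (simp add: psi_def f)
  moreover have "divsum (real (Suc N)) - divmain x = Delta11 x"
    using divsum_const[OF N] by (simp add: Delta11_eq)
  ultimately have "((\<lambda>t. (Delta11 t)\<^sup>2 + (1 - 2 * psi t) * (Delta11 t * divmain' t)) has_integral
           (Delta11 (real (Suc N)))\<^sup>2 + (psi x - 1/2) * (Delta11 x)\<^sup>2) {real (Suc N)..x}"
    using sum_squares_step[of "Suc N" x] N by simp
  from has_integral_combine[OF _ _ sum_squares_nat[of N] this]
  show ?thesis using N unfolding nat_le_real_set S by (simp add: algebra_simps)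
qed

section \<open>The integral of psi * Delta11 * divmain'\<close>

lemma divmain'_nonneg: "t \<ge> 1 \<Longrightarrow> divmain' t \<ge> 0"
  unfolding divmain'_def using euler_mascheroni_pos by simp

lemma divmain'_mono: "1 \<le> t \<Longrightarrow> t \<le> x \<Longrightarrow> divmain' t \<le> divmain' x"
  unfolding divmain'_def by simp

lemma divmain'_abs_le: "1 \<le> t \<Longrightarrow> t \<le> x \<Longrightarrow> \<bar>divmain' t\<bar> \<le> divmain' x"
  using divmain'_nonneg divmain'_mono by fastforce

lemma divmain'_sq_integral:
  assumes "x \<ge> 1"
  defines "P \<equiv> \<lambda>t. t * (ln t)\<^sup>2 - 2 * t * ln t + 2 * t + 4 * euler_mascheroni * (t * ln t - t)
     + 4 * euler_mascheroni\<^sup>2 * t"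
  shows "((\<lambda>t. (divmain' t)\<^sup>2) has_integral P x - P 1) {1..x}"
proof (rule FTC_piecewise[where S="{}"])
  have P: "(P has_real_derivative (divmain' t)\<^sup>2) (at t)" if "t \<ge> 1" for t
    unfolding P_def divmain'_def using that
    by (auto intro!: derivative_eq_intros simp: power2_eq_square algebra_simps)
  then show "continuous_on {1..x} P"
    by (intro continuous_at_imp_continuous_on ballI DERIV_isCont) auto
  show "(P has_real_derivative (divmain' t)\<^sup>2) (at t)" if "1 < t" for t
    using P[of t] that by simp
qed (use assms in auto)

text \<open>The jumps of \<open>Delta11\<close> at the integers are cancelled by the zeros of \<open>psi2\<close>.
  This is why \<open>psi2\<close>, and not the antiderivative of mean zero, is used in integrations by parts.\<close>

lemma psi2_Delta11_isCont:
  assumes "t > 0"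
  shows "isCont (\<lambda>t. psi2 t * Delta11 t) t"
proof (cases "t \<in> \<int>")
  case False
  then show ?thesis using assms psi2_isCont Delta11_deriv DERIV_isCont continuous_mult by blast
next
  case True
  have "((\<lambda>u. psi2 u * Delta11 u) \<longlongrightarrow> 0) (at t)"
  proof (rule Lim_null_comparison)
    have "\<forall>\<^sub>F u in at t. dist u t < t / 2"
      using assms by (auto simp: eventually_at intro!: exI[of _ "t/2"])
    then show "\<forall>\<^sub>F u in at t. norm (psi2 u * Delta11 u) \<le>
      \<bar>psi2 u\<bar> * (\<bar>divsum (2 * t)\<bar> + \<bar>divmain u\<bar>)"
    proof eventually_elim
      case (elim u)
      then have u: "u \<le> 2 * t" "0 < u" unfolding dist_real_def by linarith+
      have "divsum u \<le> divsum (2 * t)" unfolding divsum_floor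
        by (intro sum_mono2) (use u in \<open>auto intro!: nat_mono floor_mono\<close>)
      moreover have "divsum u \<ge> 0" unfolding divsum_def by (simp add: sum_nonneg)
      ultimately have "\<bar>Delta11 u\<bar> \<le> \<bar>divsum (2 * t)\<bar> + \<bar>divmain u\<bar>"
        unfolding Delta11_eq by linarith
      then show ?case by (simp add: abs_mult mult_left_mono)
    qed
    have c: "isCont psi2 t" "isCont divmain t"
      using psi2_isCont divmain_deriv[OF assms] DERIV_isCont by blast+
    then have "((\<lambda>u. \<bar>psi2 u\<bar> * (\<bar>divsum (2 * t)\<bar> + \<bar>divmain u\<bar>)) \<longlongrightarrow>
      \<bar>psi2 t\<bar> * (\<bar>divsum (2 * t)\<bar> + \<bar>divmain t\<bar>)) (at t)"
      by (auto intro!: tendsto_intros simp: isCont_def)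
    then show "((\<lambda>u. \<bar>psi2 u\<bar> * (\<bar>divsum (2 * t)\<bar> + \<bar>divmain u\<bar>)) \<longlongrightarrow> 0) (at t)"
      using psi2_Ints[OF True] by simp
  qed
  then show ?thesis using psi2_Ints[OF True] by (simp add: isCont_def)
qed

text \<open>After removal of its mean, \<open>psi2\<close> has the bounded antiderivative
  \<open>psi3\<close>, so only O(log^2 x) is left of the integral. The constant 1/8 is three times
  the bound 1/24 for \<open>psi3\<close>: two boundary terms and the remaining integral.\<close>

lemma divmain'_sq_psi_integral:
  assumes x: "x \<ge> 1"
  shows "\<bar>integral {1..x} (\<lambda>t. (psi2 t + 1/12) * (divmain' t)\<^sup>2)\<bar> \<le> (divmain' x)\<^sup>2 / 8"
proof -
  define K where "K t = psi3 t * (divmain' t)\<^sup>2" for t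
  have "((\<lambda>t. (psi2 t + 1/12) * (divmain' t)\<^sup>2 + psi3 t * (2 * divmain' t / t)) has_integral K x - K 1) {1..x}"
  proof (rule FTC_piecewise[OF finite_Ints_Icc[of 1 x]])
    show "continuous_on {1..x} K" unfolding K_def
      by (intro continuous_at_imp_continuous_on ballI continuous_intros psi3_isCont
           DERIV_isCont[OF divmain'_deriv]) auto
    fix t assume t: "1 < t" "t < x" "t \<notin> {1..x} \<inter> \<int>"
    then have nz: "t \<notin> \<int>" "t > 0" by auto
    show "(K has_real_derivative (psi2 t + 1/12) * (divmain' t)\<^sup>2 + psi3 t * (2 * divmain' t / t)) (at t)"
      unfolding K_def[abs_def]
      by (rule derivative_eq_intros psi3_deriv[OF nz(1)] divmain'_deriv[OF nz(2)] refl)+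
         (use nz in \<open>simp add: field_simps\<close>)
  qed (use x in auto)
  moreover have I2: "(\<lambda>t. psi3 t * (2 * divmain' t / t)) integrable_on {1..x}"
  proof (rule integrable_on_bounded_borel)
    show "(\<lambda>t. psi3 t * (2 * divmain' t / t)) \<in> borel_measurable borel"
      unfolding psi3_def by measurable
    fix t assume t: "1 \<le> t" "t \<le> x"
    have "\<bar>psi3 t * (2 * divmain' t / t)\<bar> = \<bar>psi3 t\<bar> * (2 * \<bar>divmain' t\<bar> / \<bar>t\<bar>)"
      by (simp add: abs_mult)
    also have "\<dots> \<le> 1/24 * (2 * divmain' x / 1)" using t divmain'_nonneg[OF x]
      by (intro mult_mono frac_le psi3_bound divmain'_abs_le) auto
    finally show "\<bar>psi3 t * (2 * divmain' t / t)\<bar> \<le> 1/24 * (2 * divmain' x / 1)" .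
  qed
  ultimately have "((\<lambda>t. (psi2 t + 1/12) * (divmain' t)\<^sup>2) has_integral
      K x - K 1 - integral {1..x} (\<lambda>t. psi3 t * (2 * divmain' t / t))) {1..x}"
    using has_integral_diff[OF _ integrable_integral[OF I2]] by fastforce
  then have "integral {1..x} (\<lambda>t. (psi2 t + 1/12) * (divmain' t)\<^sup>2) =
     K x - K 1 - integral {1..x} (\<lambda>t. psi3 t * (2 * divmain' t / t))"
    by (rule integral_unique)
  moreover have "\<bar>K t\<bar> \<le> 1/24 * (divmain' x)\<^sup>2" if "1 \<le> t" "t \<le> x" for t
  proof -
    have "(divmain' t)\<^sup>2 \<le> (divmain' x)\<^sup>2"
      using that by (intro power_mono divmain'_mono divmain'_nonneg)
    then show ?thesis unfolding K_def abs_mult by (intro mult_mono psi3_bound) auto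
  qed
  then have "\<bar>K x\<bar> \<le> 1/24 * (divmain' x)\<^sup>2" "\<bar>K 1\<bar> \<le> 1/24 * (divmain' x)\<^sup>2" using x by auto
  moreover have "\<bar>integral {1..x} (\<lambda>t. psi3 t * (2 * divmain' t / t))\<bar>
      \<le> 1/24 * (divmain' x)\<^sup>2 - 1/24 * (divmain' 1)\<^sup>2"
  proof (rule abs_integral_le_integral[OF I2])
    show "((\<lambda>t. 1/24 * (2 * divmain' t / t)) has_integral
        1/24 * (divmain' x)\<^sup>2 - 1/24 * (divmain' 1)\<^sup>2) {1..x}"
    proof (rule FTC_piecewise[where S="{}"])
      show "continuous_on {1..x} (\<lambda>t. 1/24 * (divmain' t)\<^sup>2)"
        by (intro continuous_at_imp_continuous_on ballI continuous_intros
           DERIV_isCont[OF divmain'_deriv]) auto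
      show "((\<lambda>t. 1/24 * (divmain' t)\<^sup>2) has_real_derivative 1/24 * (2 * divmain' t / t)) (at t)"
        if "1 < t" for t
        by (rule derivative_eq_intros divmain'_deriv refl | use that in simp)+
    qed (use x in auto)
    fix t assume t: "1 \<le> t" "t \<le> x"
    have "\<bar>psi3 t * (2 * divmain' t / t)\<bar> = \<bar>psi3 t\<bar> * (2 * divmain' t / t)"
      using t divmain'_nonneg[of t] by (simp add: abs_mult)
    also have "\<dots> \<le> 1/24 * (2 * divmain' t / t)"
      using t divmain'_nonneg[of t] by (intro mult_right_mono psi3_bound) auto
    finally show "\<bar>psi3 t * (2 * divmain' t / t)\<bar> \<le> 1/24 * (2 * divmain' t / t)" .
  qed
  ultimately show ?thesis using zero_le_power2[of "divmain' 1"] by linarith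
qed

lemma psi_Delta11_integrable:
  assumes "x \<ge> 1"
  shows "(\<lambda>t. psi t * (Delta11 t * divmain' t)) integrable_on {1..x}"
    and "(\<lambda>t. Delta11 t * divmain' t) integrable_on {1..x}"
    and "(\<lambda>t. (Delta11 t)\<^sup>2) integrable_on {1..x}"
proof -
  have D: "\<bar>Delta11 t\<bar> \<le> 8 * sqrt x" if "1 \<le> t" "t \<le> x" for t
    using Delta11_bound[of t] that real_sqrt_le_mono[of t x] by linarith
  have B: "\<bar>Delta11 t * divmain' t\<bar> \<le> 8 * sqrt x * divmain' x" if "1 \<le> t" "t \<le> x" for t
    unfolding abs_mult using D that by (intro mult_mono divmain'_abs_le) auto
  then show "(\<lambda>t. Delta11 t * divmain' t) integrable_on {1..x}"
    by (intro integrable_on_bounded_borel[where B="8 * sqrt x * divmain' x"]) measurable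
  have "\<bar>psi t * (Delta11 t * divmain' t)\<bar> \<le> 1/2 * (8 * sqrt x * divmain' x)" if "1 \<le> t" "t \<le> x" for t
    unfolding abs_mult[of "psi t"] using B that by (intro mult_mono psi_bound) auto
  then show "(\<lambda>t. psi t * (Delta11 t * divmain' t)) integrable_on {1..x}"
    by (intro integrable_on_bounded_borel[where B="1/2 * (8 * sqrt x * divmain' x)"]) measurable
  have "\<bar>(Delta11 t)\<^sup>2\<bar> \<le> (8 * sqrt x)\<^sup>2" if "1 \<le> t" "t \<le> x" for t
    using power_mono[OF D[OF that], of 2] by simp
  then show "(\<lambda>t. (Delta11 t)\<^sup>2) integrable_on {1..x}"
    by (intro integrable_on_bounded_borel[where B="(8 * sqrt x)\<^sup>2"]) measurable
qed

text \<open>Integrating \<open>psi\<close> to \<open>psi2\<close> and using that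
  \<open>Delta11\<close> has derivative \<open>- divmain'\<close> off the integers produces the
  integral of \<open>psi2\<close> times the square of \<open>divmain'\<close>, and the mean -1/12 of
  \<open>psi2\<close> gives the main term. The boundary term and the integral of
  \<open>psi2 t * Delta11 t / t\<close> are controlled by 1/8 * 8 sqrt t, the product of the bounds
  for the two factors.\<close>

lemma psi_Delta11_integral:
  assumes x: "x \<ge> 1"
  shows "\<bar>integral {1..x} (\<lambda>t. psi t * (Delta11 t * divmain' t))
      + 1/12 * integral {1..x} (\<lambda>t. (divmain' t)\<^sup>2)\<bar> \<le> sqrt x * (divmain' x + 2) + (divmain' x)\<^sup>2 / 8"
proof -
  define H where "H t = psi2 t * Delta11 t * divmain' t" for t
  define I1 where "I1 = integral {1..x} (\<lambda>t. psi t * (Delta11 t * divmain' t))"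
  define I2 where "I2 = integral {1..x} (\<lambda>t. (divmain' t)\<^sup>2)"
  define I3 where "I3 = integral {1..x} (\<lambda>t. psi2 t * Delta11 t / t)"
  define I4 where "I4 = integral {1..x} (\<lambda>t. (psi2 t + 1/12) * (divmain' t)\<^sup>2)"
  have d2: "(divmain' t)\<^sup>2 \<le> (divmain' x)\<^sup>2" if "1 \<le> t" "t \<le> x" for t
    using that by (intro power_mono divmain'_mono divmain'_nonneg)
  have H: "((\<lambda>t. psi t * (Delta11 t * divmain' t) - psi2 t * (divmain' t)\<^sup>2 + psi2 t * Delta11 t / t)
     has_integral H x - H 1) {1..x}"
  proof (rule FTC_piecewise[OF finite_Ints_Icc[of 1 x]])
    show "continuous_on {1..x} H" unfolding H_def
      by (intro continuous_at_imp_continuous_on ballI continuous_intros psi2_Delta11_isCont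
           DERIV_isCont[OF divmain'_deriv]) auto
    fix t assume t: "1 < t" "t < x" "t \<notin> {1..x} \<inter> \<int>"
    then have nz: "t \<notin> \<int>" "t > 0" by auto
    show "(H has_real_derivative psi t * (Delta11 t * divmain' t) - psi2 t * (divmain' t)\<^sup>2
        + psi2 t * Delta11 t / t) (at t)"
      unfolding H_def[abs_def]
      by (rule derivative_eq_intros psi2_deriv[OF nz(1)] Delta11_deriv[OF nz(2,1)] divmain'_deriv[OF nz(2)] refl)+
         (use nz in \<open>simp add: field_simps power2_eq_square\<close>)
  qed (use x in auto)
  have i1: "(\<lambda>t. psi t * (Delta11 t * divmain' t)) integrable_on {1..x}"
    using psi_Delta11_integrable[OF x] by blast
  have i2: "(\<lambda>t. (divmain' t)\<^sup>2) integrable_on {1..x}"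
    by (rule integrable_on_bounded_borel[OF _ ]) (use d2 in auto)
  have i3b: "\<bar>psi2 t * Delta11 t / t\<bar> \<le> 1 / sqrt t" if "1 \<le> t" for t
  proof -
    have "\<bar>psi2 t * Delta11 t / t\<bar> = \<bar>psi2 t\<bar> * \<bar>Delta11 t\<bar> / t" using that by (simp add: abs_mult)
    also have "\<dots> \<le> 1/8 * (8 * sqrt t) / t"
      using that by (intro divide_right_mono mult_mono psi2_bound Delta11_bound) auto
    also have "\<dots> = 1 / sqrt t" using that by (simp add: real_div_sqrt field_simps)
    finally show ?thesis .
  qed
  have i3: "(\<lambda>t. psi2 t * Delta11 t / t) integrable_on {1..x}"
  proof (rule integrable_on_bounded_borel)
    fix t assume t: "1 \<le> t" "t \<le> x"
    have "1 / sqrt t \<le> 1" using t by simp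
    then show "\<bar>psi2 t * Delta11 t / t\<bar> \<le> 1" using i3b[of t] t by linarith
  qed measurable
  have i4: "(\<lambda>t. (psi2 t + 1/12) * (divmain' t)\<^sup>2) integrable_on {1..x}"
  proof (rule integrable_on_bounded_borel)
    fix t assume t: "1 \<le> t" "t \<le> x"
    have "\<bar>psi2 t + 1/12\<bar> \<le> 1" using psi2_bound[of t] by linarith
    then have "\<bar>psi2 t + 1/12\<bar> * (divmain' t)\<^sup>2 \<le> 1 * (divmain' x)\<^sup>2"
      using d2[OF t] by (intro mult_mono) auto
    then show "\<bar>(psi2 t + 1/12) * (divmain' t)\<^sup>2\<bar> \<le> 1 * (divmain' x)\<^sup>2" by (simp add: abs_mult)
  qed measurable
  have "((\<lambda>t. psi t * (Delta11 t * divmain' t)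
      + (1/12 * (divmain' t)\<^sup>2 - (psi2 t + 1/12) * (divmain' t)\<^sup>2) + psi2 t * Delta11 t / t) has_integral
      I1 + (1/12 * I2 - I4) + I3) {1..x}"
    unfolding I1_def I2_def I3_def I4_def
    by (intro has_integral_add has_integral_diff has_integral_mult_right integrable_integral i1 i2 i3 i4)
  then have "((\<lambda>t. psi t * (Delta11 t * divmain' t) - psi2 t * (divmain' t)\<^sup>2 + psi2 t * Delta11 t / t) has_integral
      I1 + (1/12 * I2 - I4) + I3) {1..x}"
    by (rule has_integral_eq[rotated]) (simp add: algebra_simps)
  from has_integral_unique[OF H this] have E: "I1 + 1/12 * I2 = H x - H 1 + I4 - I3" by simp
  have "\<bar>H x\<bar> \<le> 1/8 * (8 * sqrt x) * divmain' x"
    unfolding H_def abs_mult using x divmain'_nonneg[OF x]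
    by (intro mult_mono psi2_bound Delta11_bound) auto
  moreover have "H 1 = 0" using psi2_Ints[of 1] by (simp add: H_def)
  moreover have "\<bar>I4\<bar> \<le> (divmain' x)\<^sup>2 / 8" unfolding I4_def by (rule divmain'_sq_psi_integral[OF x])
  moreover have "\<bar>I3\<bar> \<le> 2 * sqrt x - 2 * sqrt 1" unfolding I3_def
  proof (rule abs_integral_le_integral[OF i3])
    show "((\<lambda>t. 1 / sqrt t) has_integral 2 * sqrt x - 2 * sqrt 1) {1..x}"
    proof (rule FTC_piecewise[where S="{}"])
      show "((\<lambda>t. 2 * sqrt t) has_real_derivative 1 / sqrt t) (at t)" if "1 < t" for t
        using that by (auto intro!: derivative_eq_intros simp: field_simps)
    qed (use x in \<open>auto intro!: continuous_intros\<close>)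
  qed (use i3b in auto)
  ultimately show ?thesis using E unfolding I1_def[symmetric] I2_def[symmetric] by (simp add: algebra_simps)
qed

section \<open>The logarithmic mean of the divisor sum\<close>

text \<open>The reflection of s to ln x - s exchanges \<open>exp s\<close> and
  \<open>x * exp (- s)\<close>, the two arguments in the convolutions below.\<close>

lemma has_integral_reflect_sym:
  fixes f :: "real \<Rightarrow> real"
  assumes "(f has_integral I) {a..b}" "a + b = c"
  shows "((\<lambda>s. f (c - s)) has_integral I) {a..b}"
proof -
  have "((\<lambda>s. f ((-1) *\<^sub>R s + c)) has_integral (1 / \<bar>-1\<bar> ^ DIM(real)) *\<^sub>R I)
     ((\<lambda>s. (1 / (-1)) *\<^sub>R s + - ((1 / (-1)) *\<^sub>R c)) ` cbox a b)"
    by (rule has_integral_affinity) (use assms in auto)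
  moreover have "(\<lambda>s. c - s) ` {a..b} = {c - b..c - a}" by (cases "a \<le> b") auto
  moreover have "c - b = a" "c - a = b" using assms(2) by linarith+
  ultimately show ?thesis by simp
qed

definition psi_conv :: "real \<Rightarrow> real" where
  "psi_conv x = integral {0..ln x} (\<lambda>s. psi (exp s) * psi (x * exp (- s)))"

text \<open>With a = exp s, \<open>psi_log1\<close> and \<open>psi_log2\<close> are the integrals of
  psi(a) / a and psi(a) / a^2 over [1, x].\<close>

definition psi_log1 :: "real \<Rightarrow> real" where
  "psi_log1 x = integral {0..ln x} (\<lambda>s. psi (exp s))"

definition psi_log2 :: "real \<Rightarrow> real" where
  "psi_log2 x = integral {0..ln x} (\<lambda>s. psi (exp s) * exp (- s))"

lemma psi_conv_integrable:
  "(\<lambda>s. psi (exp s) * psi (x * exp (- s))) integrable_on {a..b}"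
proof (rule integrable_on_bounded_borel)
  show "\<bar>psi (exp s) * psi (x * exp (- s))\<bar> \<le> 1/2 * (1/2)" for s
    unfolding abs_mult by (intro mult_mono psi_bound) auto
qed measurable

lemma psi_log1_integrable: "(\<lambda>s. psi (exp s)) integrable_on {a..b}"
  by (rule integrable_on_bounded_borel[OF _ psi_bound]) measurable

lemma psi_log2_integrable: "(\<lambda>s. psi (exp s) * exp (- s)) integrable_on {a..b}"
proof (rule integrable_on_bounded_borel)
  show "\<bar>psi (exp s) * exp (- s)\<bar> \<le> 1/2 * exp (- a)" if "a \<le> s" for s
    unfolding abs_mult using that by (intro mult_mono psi_bound) auto
qed measurable

text \<open>The index set depends on x alone and t enters only through an indicator, so that
  integration over t commutes with the finite sum.\<close>

lemma divsum_hyp_indicator: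
  assumes "1 \<le> t" "t \<le> x"
  shows "divsum t = (\<Sum>(k, m)\<in>hyp (nat \<lfloor>x\<rfloor>). if real (k * m) \<le> t then 1 else 0)"
proof -
  have *: "k * m \<le> nat \<lfloor>t\<rfloor> \<longleftrightarrow> real (k * m) \<le> t" for k m
    using assms by linarith
  have "nat \<lfloor>t\<rfloor> \<le> nat \<lfloor>x\<rfloor>" using assms by (intro nat_mono floor_mono)
  then have "hyp (nat \<lfloor>t\<rfloor>) = hyp (nat \<lfloor>x\<rfloor>) \<inter> {(k, m). real (k * m) \<le> t}"
    unfolding hyp_def * [symmetric] by auto
  then have "divsum t = (\<Sum>p\<in>hyp (nat \<lfloor>x\<rfloor>) \<inter> {(k, m). real (k * m) \<le> t}. 1)"
    by (simp add: divsum_hyp)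
  also have "\<dots> = (\<Sum>p\<in>hyp (nat \<lfloor>x\<rfloor>). if p \<in> {(k, m). real (k * m) \<le> t} then 1 else 0)"
    by (rule sum.inter_restrict[OF finite_hyp])
  finally show ?thesis by (simp add: case_prod_unfold)
qed

text \<open>The floors count a rectangle of pairs whose far corner lies on or under the hyperbola k
  m = x. The rectangle is therefore contained in the index set used for \<open>divsum\<close>, and
  for each pair the admissible s form an interval.\<close>

lemma floor_product_hyp_indicator:
  assumes "x \<ge> 1" "0 \<le> s" "s \<le> ln x"
  shows "real_of_int \<lfloor>exp s\<rfloor> * real_of_int \<lfloor>x * exp (- s)\<rfloor> =
    (\<Sum>(k, m)\<in>hyp (nat \<lfloor>x\<rfloor>). if ln (real k) \<le> s \<and> s \<le> ln x - ln (real m) then 1 else 0)"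
proof -
  define a b where "a = exp s" and "b = x * exp (- s)"
  have ab: "a * b = x" "a \<ge> 1" "b > 0" using assms by (auto simp: a_def b_def exp_minus field_simps)
  have "hyp (nat \<lfloor>x\<rfloor>) \<inter> {(k, m). ln (real k) \<le> s \<and> s \<le> ln x - ln (real m)}
      = {1..nat \<lfloor>a\<rfloor>} \<times> {1..nat \<lfloor>b\<rfloor>}" (is "?L = ?R")
  proof -
    have k: "ln (real k) \<le> s \<longleftrightarrow> k \<le> nat \<lfloor>a\<rfloor>" if "k \<ge> 1" for k
    proof -
      have "ln (real k) \<le> s \<longleftrightarrow> exp (ln (real k)) \<le> exp s" by simp
      also have "exp (ln (real k)) = real k" using that by simp
      finally have "ln (real k) \<le> s \<longleftrightarrow> real k \<le> a" by (simp add: a_def)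
      also have "\<dots> \<longleftrightarrow> k \<le> nat \<lfloor>a\<rfloor>" using that by linarith
      finally show ?thesis .
    qed
    have m: "s \<le> ln x - ln (real m) \<longleftrightarrow> m \<le> nat \<lfloor>b\<rfloor>" if "m \<ge> 1" for m
    proof -
      have "s \<le> ln x - ln (real m) \<longleftrightarrow> ln (real m) \<le> ln x - s" by linarith
      also have "\<dots> \<longleftrightarrow> exp (ln (real m)) \<le> exp (ln x - s)" by simp
      also have "exp (ln (real m)) = real m" using that by simp
      also have "exp (ln x - s) = b" using assms by (simp add: b_def exp_diff exp_minus divide_inverse)
      also have "real m \<le> b \<longleftrightarrow> m \<le> nat \<lfloor>b\<rfloor>" using that by linarith
      finally show ?thesis .
    qed
    have km: "k * m \<le> nat \<lfloor>x\<rfloor>" if "k \<le> nat \<lfloor>a\<rfloor>" "m \<le> nat \<lfloor>b\<rfloor>" "k \<ge> 1" "m \<ge> 1" for k m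
    proof -
      have "real k \<le> a" "real m \<le> b" using that by linarith+
      then have "real k * real m \<le> a * b" using ab by (intro mult_mono) auto
      then have "real (k * m) \<le> x" using ab by simp
      then show ?thesis by linarith
    qed
    show ?thesis
    proof (intro equalityI subsetI; clarify)
      fix k' m' assume h: "(k', m') \<in> hyp (nat \<lfloor>x\<rfloor>)" "ln (real k') \<le> s" "s \<le> ln x - ln (real m')"
      then have "k' \<ge> 1" "m' \<ge> 1" by (auto simp: hyp_def)
      with h(2,3) k m show "k' \<in> {1..nat \<lfloor>a\<rfloor>} \<and> m' \<in> {1..nat \<lfloor>b\<rfloor>}" by simp
    next
      fix k' m' assume h: "k' \<in> {1..nat \<lfloor>a\<rfloor>}" "m' \<in> {1..nat \<lfloor>b\<rfloor>}"
      then show "(k', m') \<in> hyp (nat \<lfloor>x\<rfloor>) \<inter> {(k, m). ln (real k) \<le> s \<and> s \<le> ln x - ln (real m)}"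
        using k[of k'] m[of m'] km[of k' m'] by (simp add: hyp_def)
    qed
  qed
  then have "card ?L = nat \<lfloor>a\<rfloor> * nat \<lfloor>b\<rfloor>" by simp
  then have "real (nat \<lfloor>a\<rfloor>) * real (nat \<lfloor>b\<rfloor>) = (\<Sum>p\<in>?L. 1)" by simp
  also have "\<dots> = (\<Sum>p\<in>hyp (nat \<lfloor>x\<rfloor>). if p \<in> {(k, m). ln (real k) \<le> s \<and> s \<le> ln x - ln (real m)} then 1 else 0)"
    by (rule sum.inter_restrict[OF finite_hyp])
  finally show ?thesis using ab by (simp add: case_prod_unfold a_def b_def)
qed

text \<open>Both integrals count the pairs with product at most \<open>x\<close>, each with weight
  \<open>ln (x / (k * m))\<close>. The second one is a convolution in logarithmic coordinates, so that no hyperbola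
  method with its delicate truncation at \<open>sqrt x\<close> is needed.\<close>

lemma divsum_log_mean:
  assumes x: "x \<ge> 1"
  defines "S \<equiv> \<Sum>(k, m)\<in>hyp (nat \<lfloor>x\<rfloor>). ln x - ln (real k) - ln (real m)"
  shows "((\<lambda>t. divsum t / t) has_integral S) {1..x}"
    and "((\<lambda>s. real_of_int \<lfloor>exp s\<rfloor> * real_of_int \<lfloor>x * exp (- s)\<rfloor>) has_integral S) {0..ln x}"
proof -
  have km: "real k \<ge> 1" "real m \<ge> 1" "real k * real m \<le> x" "ln (real k) + ln (real m) \<le> ln x"
    if "(k, m) \<in> hyp (nat \<lfloor>x\<rfloor>)" for k m
  proof -
    show *: "real k \<ge> 1" "real m \<ge> 1" using that by (auto simp: hyp_def)
    have "k * m \<le> nat \<lfloor>x\<rfloor>" using that by (auto simp: hyp_def)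
    then have "real (k * m) \<le> x" using x by linarith
    then show **: "real k * real m \<le> x" by simp
    have "ln (real k * real m) \<le> ln x" using * ** x by (subst ln_le_cancel_iff) auto
    then show "ln (real k) + ln (real m) \<le> ln x" using * by (simp add: ln_mult)
  qed
  have "((\<lambda>t. \<Sum>p\<in>hyp (nat \<lfloor>x\<rfloor>). (case p of (k, m) \<Rightarrow> if real (k * m) \<le> t then 1 / t else 0)) has_integral
     (\<Sum>p\<in>hyp (nat \<lfloor>x\<rfloor>). case p of (k, m) \<Rightarrow> ln x - ln (real k) - ln (real m))) {1..x}"
  proof (rule has_integral_sum[OF finite_hyp], clarify)
    fix k m assume h: "(k, m) \<in> hyp (nat \<lfloor>x\<rfloor>)"
    note km = km[OF h]
    define c where "c = real k * real m"
    have c: "1 \<le> c" "c \<le> x" unfolding c_def using mult_mono[OF km(1,2)] km by auto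
    have "((\<lambda>t. 1 / t) has_integral ln x - ln c) {c..x}"
      by (rule FTC_piecewise[where S="{}"])
         (use c in \<open>auto intro!: derivative_eq_intros continuous_intros\<close>)
    then have "((\<lambda>t. if t \<in> {c..x} then 1 / t else 0) has_integral ln x - ln c) {1..x}"
      by (subst has_integral_restrict) (use c in auto)
    then have "((\<lambda>t. if real (k * m) \<le> t then 1 / t else 0) has_integral ln x - ln c) {1..x}"
      by (rule has_integral_eq[rotated]) (auto simp: c_def)
    moreover have "ln x - ln c = ln x - ln (real k) - ln (real m)"
      using km by (simp add: c_def ln_mult)
    ultimately show "((\<lambda>t. if real (k * m) \<le> t then 1 / t else 0) has_integral
      ln x - ln (real k) - ln (real m)) {1..x}" by simp
  qed
  then show "((\<lambda>t. divsum t / t) has_integral S) {1..x}" unfolding S_def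
  proof (rule has_integral_eq[rotated])
    fix t assume "t \<in> {1..x}"
    then show "(\<Sum>p\<in>hyp (nat \<lfloor>x\<rfloor>). case p of (k, m) \<Rightarrow> if real (k * m) \<le> t then 1 / t else 0) = divsum t / t"
      using divsum_hyp_indicator[of t x] by (auto simp: sum_divide_distrib intro!: sum.cong)
  qed
  have "((\<lambda>s. \<Sum>p\<in>hyp (nat \<lfloor>x\<rfloor>). (case p of (k, m) \<Rightarrow>
        if ln (real k) \<le> s \<and> s \<le> ln x - ln (real m) then 1 else 0)) has_integral
     (\<Sum>p\<in>hyp (nat \<lfloor>x\<rfloor>). case p of (k, m) \<Rightarrow> ln x - ln (real k) - ln (real m))) {0..ln x}"
  proof (rule has_integral_sum[OF finite_hyp], clarify)
    fix k m assume h: "(k, m) \<in> hyp (nat \<lfloor>x\<rfloor>)"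
    note km = km[OF h]
    have l: "0 \<le> ln (real k)" "0 \<le> ln (real m)" using km by auto
    have "((\<lambda>s. 1::real) has_integral (ln x - ln (real m) - ln (real k))) {ln (real k)..ln x - ln (real m)}"
      using has_integral_const_real[of "1::real" "ln (real k)" "ln x - ln (real m)"] km(4) by simp
    then have "((\<lambda>s. if s \<in> {ln (real k)..ln x - ln (real m)} then 1 else (0::real)) has_integral
       (ln x - ln (real m) - ln (real k))) {0..ln x}"
      by (subst has_integral_restrict) (use l in auto)
    then show "((\<lambda>s. if ln (real k) \<le> s \<and> s \<le> ln x - ln (real m) then 1 else 0) has_integral
      ln x - ln (real k) - ln (real m)) {0..ln x}" by (simp add: algebra_simps)
  qed
  then show "((\<lambda>s. real_of_int \<lfloor>exp s\<rfloor> * real_of_int \<lfloor>x * exp (- s)\<rfloor>) has_integral S) {0..ln x}"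
    unfolding S_def
    by (rule has_integral_eq[rotated]) (use floor_product_hyp_indicator[OF x] in auto)
qed

text \<open>Expand (a - 1/2 - psi a) (b - 1/2 - psi b) with a = exp s and a b = x. The terms linear
  in psi b are mirror images of those linear in psi a and have the same integral, which explains the
  factor 2 in front of \<open>psi_log2\<close> and the factor 1 = 2 * 1/2 in front of
  \<open>psi_log1\<close>.\<close>

lemma divsum_log_mean_eq:
  assumes x: "x \<ge> 1"
  shows "((\<lambda>t. divsum t / t) has_integral
     x * ln x - x + 1 + ln x / 4 - 2 * x * psi_log2 x + psi_log1 x + psi_conv x) {1..x}"
proof -
  let ?X = "ln x"
  have X: "?X \<ge> 0" "exp ?X = x" using x by auto
  have M: "((\<lambda>s. x - exp s / 2 - x * exp (- s) / 2 + 1/4) has_integral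
     (x * ?X - exp ?X / 2 + x * exp (- ?X) / 2 + ?X / 4) -
     (x * 0 - exp 0 / 2 + x * exp (- 0) / 2 + 0 / 4)) {0..?X}"
    by (rule FTC_piecewise[where S="{}"])
       (use X in \<open>auto intro!: derivative_eq_intros continuous_intros\<close>)
  have x1: "x * exp (- ?X) = 1" using X x by (simp add: exp_minus)
  from M have M: "((\<lambda>s. x - exp s / 2 - x * exp (- s) / 2 + 1/4) has_integral
     x * ln x - x + 1 + ln x / 4) {0..?X}"
    by (rule has_integral_eq_rhs) (simp only: X(2) x1, simp add: field_simps)
  have B: "((\<lambda>s. x * (psi (exp s) * exp (- s)) - 1/2 * psi (exp s)) has_integral
      x * psi_log2 x - 1/2 * psi_log1 x) {0..?X}"
    unfolding psi_log1_def psi_log2_def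
    by (intro has_integral_diff has_integral_mult_right integrable_integral psi_log1_integrable psi_log2_integrable)
  have A: "((\<lambda>s. x * (psi (exp (?X - s)) * exp (- (?X - s))) - 1/2 * psi (exp (?X - s))) has_integral
      x * psi_log2 x - 1/2 * psi_log1 x) {0..?X}"
    by (rule has_integral_reflect_sym[OF B]) simp
  have C: "((\<lambda>s. psi (exp s) * psi (x * exp (- s))) has_integral psi_conv x) {0..?X}"
    unfolding psi_conv_def by (intro integrable_integral psi_conv_integrable)
  have e: "exp (?X - s) = x * exp (- s)" "exp (- (?X - s)) * x = exp s" for s
  proof -
    show *: "exp (?X - s) = x * exp (- s)" using X by (simp add: exp_diff exp_minus divide_inverse)
    have "exp (- (?X - s)) * exp ?X = exp s" by (simp flip: exp_add)
    then show "exp (- (?X - s)) * x = exp s" using X by simp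
  qed
  have "((\<lambda>s. (x - exp s / 2 - x * exp (- s) / 2 + 1/4)
       - (x * (psi (exp s) * exp (- s)) - 1/2 * psi (exp s))
       - (x * (psi (exp (?X - s)) * exp (- (?X - s))) - 1/2 * psi (exp (?X - s)))
       + psi (exp s) * psi (x * exp (- s))) has_integral
       (x * ln x - x + 1 + ln x / 4) - (x * psi_log2 x - 1/2 * psi_log1 x)
         - (x * psi_log2 x - 1/2 * psi_log1 x) + psi_conv x) {0..?X}"
    by (intro has_integral_add has_integral_diff M A B C)
  then have "((\<lambda>s. real_of_int \<lfloor>exp s\<rfloor> * real_of_int \<lfloor>x * exp (- s)\<rfloor>) has_integral
       (x * ln x - x + 1 + ln x / 4) - (x * psi_log2 x - 1/2 * psi_log1 x)
         - (x * psi_log2 x - 1/2 * psi_log1 x) + psi_conv x) {0..?X}"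
  proof (rule has_integral_eq[rotated])
    fix s assume "s \<in> {0..?X}"
    define a b where "a = exp s" and "b = x * exp (- s)"
    have ab: "x = a * b" by (simp add: a_def b_def exp_minus)
    have f: "real_of_int \<lfloor>u\<rfloor> = u - 1/2 - psi u" for u by (simp add: psi_def)
    have 1: "x * (psi (exp s) * exp (- s)) = b * psi a" by (simp add: a_def b_def)
    have 2: "x * (psi (exp (?X - s)) * exp (- (?X - s))) = a * psi b"
      using e[of s] by (simp add: a_def b_def mult_ac)
    show "(x - exp s / 2 - x * exp (- s) / 2 + 1/4)
       - (x * (psi (exp s) * exp (- s)) - 1/2 * psi (exp s))
       - (x * (psi (exp (?X - s)) * exp (- (?X - s))) - 1/2 * psi (exp (?X - s)))
       + psi (exp s) * psi (x * exp (- s)) = real_of_int \<lfloor>exp s\<rfloor> * real_of_int \<lfloor>x * exp (- s)\<rfloor>"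
      unfolding 1 2 unfolding e(1) unfolding a_def[symmetric] b_def[symmetric] f
      by (simp add: ab algebra_simps)
  qed
  with divsum_log_mean(2)[OF x] have "(\<Sum>(k, m)\<in>hyp (nat \<lfloor>x\<rfloor>). ln x - ln (real k) - ln (real m)) =
       (x * ln x - x + 1 + ln x / 4) - (x * psi_log2 x - 1/2 * psi_log1 x)
         - (x * psi_log2 x - 1/2 * psi_log1 x) + psi_conv x"
    by (rule has_integral_unique)
  also have "\<dots> = x * ln x - x + 1 + ln x / 4 - 2 * x * psi_log2 x + psi_log1 x + psi_conv x"
    by (simp add: algebra_simps)
  finally show ?thesis using divsum_log_mean(1)[OF x] by (simp only:)
qed

section \<open>The value of the integral of psi(a) / a^2 over a >= 1\<close>

lemma finite_exp_Ints: "finite {s\<in>{a..b::real}. exp s \<in> \<int>}"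
  by (rule finite_vimage_Ints[where c="exp a" and d="exp b"]) (auto simp: inj_def)

lemma finite_exp_minus_Ints:
  assumes "x > 0"
  shows "finite {s\<in>{a..b::real}. x * exp (- s) \<in> \<int>}"
  by (rule finite_vimage_Ints[where c="x * exp (- b)" and d="x * exp (- a)"])
     (use assms in \<open>auto simp: inj_def\<close>)

lemma psi2_exp_deriv:
  "exp s \<notin> \<int> \<Longrightarrow> ((\<lambda>s. psi2 (exp s)) has_real_derivative psi (exp s) * exp s) (at s)"
  by (rule DERIV_chain2[OF psi2_deriv DERIV_exp])

lemma psi2_exp_minus_deriv:
  "x * exp (- s) \<notin> \<int> \<Longrightarrow>
    ((\<lambda>s. psi2 (x * exp (- s))) has_real_derivative psi (x * exp (- s)) * (- x * exp (- s))) (at s)"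
  by (rule DERIV_chain2[OF psi2_deriv]) (auto intro!: derivative_eq_intros)

text \<open>One integration by parts gains a factor exp(-a) over the trivial bound. The gain is
  essential because \<open>psi_log2\<close> is later multiplied by x.\<close>

lemma psi_log2_tail:
  assumes "a \<le> b"
  shows "\<bar>integral {a..b} (\<lambda>s. psi (exp s) * exp (- s))\<bar> \<le> exp (- 2 * a) / 2"
proof -
  define F where "F s = psi2 (exp s) * exp (- 2 * s)" for s
  have "((\<lambda>s. psi (exp s) * exp (- s) - 2 * psi2 (exp s) * exp (- 2 * s)) has_integral F b - F a) {a..b}"
  proof (rule FTC_piecewise[OF finite_exp_Ints[of a b] assms])
    show "continuous_on {a..b} F" unfolding F_def
      by (intro continuous_intros continuous_on_compose2[OF psi2_continuous_on[of UNIV]]) auto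
    fix s assume "a < s" "s < b" "s \<notin> {s \<in> {a..b}. exp s \<in> \<int>}"
    then have "exp s \<notin> \<int>" by auto
    then have d: "(F has_real_derivative psi (exp s) * exp s * exp (- 2 * s) + psi2 (exp s) * (exp (-2 * s) * (-2))) (at s)"
      unfolding F_def by (auto intro!: derivative_eq_intros psi2_exp_deriv)
    have e: "psi (exp s) * exp s * exp (- 2 * s) = psi (exp s) * exp (- s)"
      by (simp add: mult.assoc flip: exp_add)
    show "(F has_real_derivative psi (exp s) * exp (- s) - 2 * psi2 (exp s) * exp (- 2 * s)) (at s)"
      by (rule DERIV_cong[OF d], subst e, simp)
  qed
  moreover have i2: "(\<lambda>s. 2 * psi2 (exp s) * exp (- 2 * s)) integrable_on {a..b}"
    by (intro integrable_continuous_real continuous_intros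
        continuous_on_compose2[OF psi2_continuous_on[of UNIV]]) auto
  ultimately have "integral {a..b} (\<lambda>s. psi (exp s) * exp (- s)) =
     F b - F a + integral {a..b} (\<lambda>s. 2 * psi2 (exp s) * exp (- 2 * s))"
    using integral_diff[OF psi_log2_integrable i2] by (simp add: has_integral_iff)
  moreover have "\<bar>F s\<bar> \<le> 1/8 * exp (- 2 * a)" if "a \<le> s" for s
    unfolding F_def abs_mult using that by (intro mult_mono psi2_bound) auto
  then have "\<bar>F b\<bar> \<le> 1/8 * exp (- 2 * a)" "\<bar>F a\<bar> \<le> 1/8 * exp (- 2 * a)" using assms by auto
  moreover have "\<bar>integral {a..b} (\<lambda>s. 2 * psi2 (exp s) * exp (- 2 * s))\<bar> \<le>
      - 1/8 * exp (- 2 * b) - - 1/8 * exp (- 2 * a)"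
  proof (rule abs_integral_le_integral[OF i2])
    show "((\<lambda>s. 1/4 * exp (- 2 * s)) has_integral - 1/8 * exp (- 2 * b) - - 1/8 * exp (- 2 * a)) {a..b}"
      by (rule FTC_piecewise[where S="{}"]) (use assms in \<open>auto intro!: derivative_eq_intros continuous_intros\<close>)
    show "\<bar>2 * psi2 (exp s) * exp (- 2 * s)\<bar> \<le> 1/4 * exp (- 2 * s)" for s
      unfolding abs_mult using psi2_bound[of "exp s"] by (intro mult_mono) auto
  qed
  ultimately show ?thesis using exp_gt_zero[of "-2 * b"] by linarith
qed

text \<open>Between the logarithms of consecutive integers the integrand is elementary, and the
  pieces telescope into a harmonic number. As N grows, the value tends to 1/2 - gamma, which
  identifies the complete integral.\<close>

lemma psi_log2_nat:
  "((\<lambda>s. psi (exp s) * exp (- s)) has_integral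
     ln (real (Suc N)) - harm (Suc N) + 1/2 + 1 / (2 * real (Suc N))) {0..ln (real (Suc N))}"
proof (induction N)
  case 0
  show ?case by (simp add: harm_def has_integral_refl)
next
  case (Suc N)
  define M where "M = real (Suc N)"
  have M: "M \<ge> 1" "real (Suc (Suc N)) = M + 1" by (auto simp: M_def)
  define F where "F s = s + (M + 1/2) * exp (- s)" for s
  have I: "((\<lambda>s. (exp s - M - 1/2) * exp (- s)) has_integral F (ln (M + 1)) - F (ln M)) {ln M..ln (M + 1)}"
    unfolding F_def
    by (rule FTC_piecewise[where S="{}"])
       (use M in \<open>auto intro!: derivative_eq_intros continuous_intros simp: left_diff_distrib ring_distribs simp flip: exp_add\<close>)
  have I: "((\<lambda>s. psi (exp s) * exp (- s)) has_integral F (ln (M + 1)) - F (ln M)) {ln M..ln (M + 1)}"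
  proof (rule has_integral_spike_finite[OF _ _ I, of "{ln (M + 1)}"])
    fix s assume s: "s \<in> {ln M..ln (M + 1)} - {ln (M + 1)}"
    then have "ln M \<le> s" "s < ln (M + 1)" by auto
    then have "exp (ln M) \<le> exp s" "exp s < exp (ln (M + 1))" by simp_all
    then have "M \<le> exp s" "exp s < M + 1" using M by simp_all
    then have "\<lfloor>exp s\<rfloor> = int (Suc N)" unfolding M_def by linarith
    then show "psi (exp s) * exp (- s) = (exp s - M - 1/2) * exp (- s)"
      by (simp add: psi_def M_def)
  qed simp
  have "((\<lambda>s. psi (exp s) * exp (- s)) has_integral
     (ln M - harm (Suc N) + 1/2 + 1 / (2 * M)) + (F (ln (M + 1)) - F (ln M))) {0..ln (M + 1)}"
    by (rule has_integral_combine[OF _ _ Suc.IH[folded M_def] I]) (use M in auto)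
  moreover have "(ln M - harm (Suc N) + 1/2 + 1 / (2 * M)) + (F (ln (M + 1)) - F (ln M)) =
     ln (M + 1) - harm (Suc (Suc N)) + 1/2 + 1 / (2 * (M + 1))"
  proof -
    have "exp (- ln (M + 1)) = 1 / (M + 1)" "exp (- ln M) = 1 / M"
      using M by (auto simp: exp_minus divide_inverse)
    moreover have "harm (Suc (Suc N)) = harm (Suc N) + 1 / (M + 1)"
      by (simp add: harm_Suc[of "Suc N"] M_def divide_inverse)
    ultimately have "(ln M - harm (Suc N) + 1/2 + 1 / (2 * M)) + (F (ln (M + 1)) - F (ln M)) =
        ln M - harm (Suc N) + 1/2 + 1 / (2 * M) + (ln (M + 1) + (M + 1/2) * (1 / (M + 1)) - (ln M + (M + 1/2) * (1 / M)))"
      "harm (Suc (Suc N)) = harm (Suc N) + 1 / (M + 1)"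
      unfolding F_def by simp_all
    moreover have "1 / (2 * M) + (M + 1/2) * (1 / (M + 1)) - (M + 1/2) * (1 / M) = - 1 / (M + 1) + 1 / (2 * (M + 1))"
      using M(1) by (simp add: divide_simps) (simp add: algebra_simps)
    ultimately show ?thesis by linarith
  qed
  ultimately show ?case by (simp only: M(2))
qed

lemma psi_log2_approx:
  assumes x: "x \<ge> 1"
  shows "\<bar>psi_log2 x - (1/2 - euler_mascheroni)\<bar> \<le> 1 / (2 * x\<^sup>2)"
proof -
  have e: "exp (- 2 * ln x) / 2 = 1 / (2 * x\<^sup>2)"
  proof -
    have "exp (- 2 * ln x) = inverse (exp (ln x + ln x))" by (subst exp_minus[symmetric]) simp
    also have "\<dots> = inverse (x * x)" using x by (simp only: exp_add) simp
    finally show ?thesis by (simp add: power2_eq_square inverse_eq_divide)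
  qed
  have lim: "(\<lambda>N. ln (real (Suc N)) - harm (Suc N) + 1/2 + 1 / (2 * real (Suc N))) \<longlonglongrightarrow>
      - euler_mascheroni + 1/2 + 0"
  proof -
    have "(\<lambda>N. - (harm (Suc N) - ln (real (Suc N)))) \<longlonglongrightarrow> - euler_mascheroni"
      by (intro tendsto_minus LIMSEQ_Suc[OF euler_mascheroni_LIMSEQ])
    then have 1: "(\<lambda>N. ln (real (Suc N)) - harm (Suc N)) \<longlonglongrightarrow> - euler_mascheroni" by simp
    have "(\<lambda>N. 1/2 * inverse (real (Suc N))) \<longlonglongrightarrow> 1/2 * 0"
      by (rule tendsto_mult_left[OF LIMSEQ_inverse_real_of_nat])
    moreover have "1/2 * inverse (real (Suc N)) = 1 / (2 * real (Suc N))" for N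
      by (simp only: inverse_eq_divide times_divide_times_eq mult_1)
    ultimately have 2: "(\<lambda>N. 1 / (2 * real (Suc N))) \<longlonglongrightarrow> 0" by (simp only: mult_zero_right)
    show ?thesis by (rule tendsto_add[OF tendsto_add[OF 1 tendsto_const] 2])
  qed
  have "(\<lambda>N. \<bar>(ln (real (Suc N)) - harm (Suc N) + 1/2 + 1 / (2 * real (Suc N))) - psi_log2 x\<bar>) \<longlonglongrightarrow>
     \<bar>(- euler_mascheroni + 1/2 + 0) - psi_log2 x\<bar>"
    by (rule tendsto_rabs[OF tendsto_diff[OF lim tendsto_const]])
  moreover have "\<forall>\<^sub>F N in sequentially. \<bar>(ln (real (Suc N)) - harm (Suc N) + 1/2 + 1 / (2 * real (Suc N))) - psi_log2 x\<bar>
     \<le> 1 / (2 * x\<^sup>2)"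
  proof -
    have "\<forall>\<^sub>F N in sequentially. nat \<lceil>x\<rceil> \<le> N" by (rule eventually_ge_at_top)
    then show ?thesis
    proof eventually_elim
      case (elim N)
      then have "x \<le> real (Suc N)" by linarith
      then have l: "0 \<le> ln x" "ln x \<le> ln (real (Suc N))" using x by auto
      have "psi_log2 x + integral {ln x..ln (real (Suc N))} (\<lambda>s. psi (exp s) * exp (- s)) =
         integral {0..ln (real (Suc N))} (\<lambda>s. psi (exp s) * exp (- s))"
        unfolding psi_log2_def by (rule Henstock_Kurzweil_Integration.integral_combine[OF l psi_log2_integrable])
      also have "\<dots> = ln (real (Suc N)) - harm (Suc N) + 1/2 + 1 / (2 * real (Suc N))"
        by (rule integral_unique[OF psi_log2_nat])
      finally show ?case using psi_log2_tail[OF l(2)] e by linarith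
    qed
  qed
  ultimately have "\<bar>(- euler_mascheroni + 1/2 + 0) - psi_log2 x\<bar> \<le> 1 / (2 * x\<^sup>2)"
    by (rule tendsto_upperbound) simp
  then show ?thesis by linarith
qed

section \<open>Exchange of integrations and the primitive of psi_conv\<close>

lemma integral_deriv_at:
  fixes f :: "real \<Rightarrow> real"
  assumes "f integrable_on {a..b}" "a < t" "t < b" "isCont f t"
  shows "((\<lambda>u. integral {a..u} f) has_real_derivative f t) (at t)"
proof -
  have "((\<lambda>u. integral {a..u} f) has_vector_derivative f t) (at t within ({a..b} - {}))"
    by (rule integral_has_vector_derivative_continuous_at[OF assms(1)])
       (use assms in \<open>auto intro: continuous_at_imp_continuous_within\<close>)
  then show ?thesis
    using assms at_within_Icc_at[of a t b] by (simp add: has_real_derivative_iff_has_vector_derivative)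
qed

text \<open>The integrands jump along curves, so Fubini's theorem is applied to Lebesgue integrals,
  where boundedness and measurability on a rectangle suffice, and the result is carried
  back.\<close>

lemma integral_swap_bounded_borel:
  fixes f :: "real \<Rightarrow> real \<Rightarrow> real"
  assumes meas: "case_prod f \<in> borel_measurable (borel \<Otimes>\<^sub>M borel)"
    and B: "\<And>t s. \<bar>f t s\<bar> \<le> B"
  shows "integral {a..b} (\<lambda>t. integral {c..d} (f t)) = integral {c..d} (\<lambda>s. integral {a..b} (\<lambda>t. f t s))"
proof -
  interpret lborel_pair: pair_sigma_finite lborel lborel ..
  have meas': "case_prod f \<in> borel_measurable (lborel \<Otimes>\<^sub>M lborel)"
    using meas by (simp cong: measurable_cong_sets sets_pair_measure_cong)
  define g where "g t s = indicator {a..b} t * (indicator {c..d} s * f t s)" for t s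
  have g: "case_prod g \<in> borel_measurable (lborel \<Otimes>\<^sub>M lborel)"
    unfolding g_def[abs_def] using meas' by measurable
  have int: "integrable (lborel \<Otimes>\<^sub>M lborel) (case_prod g)"
  proof (rule integrableI_bounded_set[where A="{a..b} \<times> {c..d}" and B=B])
    show "emeasure (lborel \<Otimes>\<^sub>M lborel) ({a..b} \<times> {c..d}) < \<infinity>"
    proof -
      have "emeasure (lborel \<Otimes>\<^sub>M lborel) ({a..b} \<times> {c..d}) = emeasure lborel {a..b} * emeasure lborel {c..d}"
        by (rule lborel.emeasure_pair_measure_Times) auto
      moreover have "emeasure lborel {u..v::real} < \<infinity>" for u v by (cases "u \<le> v") auto
      ultimately show ?thesis by (simp add: ennreal_mult_less_top)
    qed
    have "\<bar>g t s\<bar> \<le> B" for t s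
      using B[of t s] B[of 0 0] by (auto simp: g_def indicator_def)
    then show "AE x in lborel \<Otimes>\<^sub>M lborel. x \<in> {a..b} \<times> {c..d} \<longrightarrow> norm (case_prod g x) \<le> B"
      by (intro AE_I2) auto
    show "AE x in lborel \<Otimes>\<^sub>M lborel. x \<notin> {a..b} \<times> {c..d} \<longrightarrow> case_prod g x = 0"
      by (intro AE_I2) (auto simp: g_def indicator_def split: if_splits)
  qed (use g in auto)
  have ft: "f t \<in> borel_measurable borel" for t
    using measurable_Pair2[OF meas, of t] by simp
  have fs: "(\<lambda>t. f t s) \<in> borel_measurable borel" for s
    using measurable_Pair1[OF meas, of s] by simp
  have conv: "integral {u..v} h = (LINT x|lborel. indicator {u..v} x * h x)"
    if "h \<in> borel_measurable borel" "\<And>x. \<bar>h x\<bar> \<le> K" for h :: "real \<Rightarrow> real" and u v K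
  proof -
    have "set_integrable lborel {u..v} h"
      unfolding set_integrable_def
    proof (rule integrableI_bounded_set[where A="{u..v}" and B=K])
      show "emeasure lborel {u..v} < \<infinity>" by (cases "u \<le> v") auto
    qed (use that in \<open>simp_all add: indicator_def\<close>)
    from set_borel_integral_eq_integral(2)[OF this] show ?thesis
      by (simp add: set_lebesgue_integral_def)
  qed
  have inner1: "integral {c..d} (f t) = (LINT s|lborel. indicator {c..d} s * f t s)" for t
    by (rule conv[OF ft B])
  have inner2: "integral {a..b} (\<lambda>t. f t s) = (LINT t|lborel. indicator {a..b} t * f t s)" for s
    by (rule conv[OF fs B])
  have i: "\<bar>integral {u..v} h\<bar> \<le> B * (max 0 (v - u))" if "\<And>x. \<bar>h x\<bar> \<le> B" "h \<in> borel_measurable borel" for h :: "real \<Rightarrow> real" and u v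
  proof (cases "u \<le> v")
    case True
    have "h integrable_on {u..v}" by (rule integrable_on_bounded_borel[OF that(2,1)])
    from abs_integral_le_integral[OF this has_integral_const_real[of B]] that True show ?thesis
      by (simp add: mult.commute)
  qed simp
  have m1: "(\<lambda>t. integral {c..d} (f t)) \<in> borel_measurable borel"
    unfolding inner1 using meas'
    by (intro lborel.borel_measurable_lebesgue_integral) (simp add: split_beta', measurable)
  have m2: "(\<lambda>s. integral {a..b} (\<lambda>t. f t s)) \<in> borel_measurable borel"
    unfolding inner2
  proof -
    have "(\<lambda>p. f (snd p) (fst p)) \<in> borel_measurable (borel \<Otimes>\<^sub>M lborel)"
      using measurable_compose[OF measurable_pair_swap' meas'] 
      by (simp add: split_beta' cong: measurable_cong_sets sets_pair_measure_cong)
    then show "(\<lambda>s. LINT t|lborel. indicator {a..b} t * f t s) \<in> borel_measurable borel"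
      by (intro lborel.borel_measurable_lebesgue_integral) (simp add: split_beta')
  qed
  have "integral {a..b} (\<lambda>t. integral {c..d} (f t)) = (LINT t|lborel. LINT s|lborel. g t s)"
    using conv[OF m1 i[OF B ft]] by (simp add: inner1 g_def)
  also have "\<dots> = (LINT s|lborel. LINT t|lborel. g t s)"
    by (rule lborel_pair.Fubini_integral[OF int, symmetric])
  also have "\<dots> = (LINT s|lborel. LINT t|lborel. indicator {c..d} s * (indicator {a..b} t * f t s))"
    by (simp add: g_def mult_ac)
  also have "\<dots> = integral {c..d} (\<lambda>s. integral {a..b} (\<lambda>t. f t s))"
    using conv[OF m2 i[OF B fs]] by (simp add: inner2)
  finally show ?thesis .
qed

text \<open>Integrating first in \<open>t\<close> produces the bounded factor \<open>psi2\<close>; the second half of the range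
  is then integrated by parts, and the square root cancellation in \<open>psi_conv_integral_bound\<close> follows
  without using the Voronoi formula.\<close>

lemma psi_conv_integral_eq:
  assumes x: "x \<ge> 1"
  shows "integral {1..x} psi_conv = integral {0..ln x} (\<lambda>s. psi (exp s) * exp s * psi2 (x * exp (- s)))"
proof -
  \<comment> \<open>The domain 0 <= s <= ln t depends on t. Extension by zero makes it a
    rectangle.\<close>
  define f where "f t s = (if s \<le> ln t then psi (exp s) * psi (t * exp (- s)) else 0)" for t s
  have meas: "case_prod f \<in> borel_measurable (borel \<Otimes>\<^sub>M borel)"
    unfolding f_def[abs_def] by measurable
  have B: "\<bar>f t s\<bar> \<le> 1/2 * (1/2)" for t s
  proof (cases "s \<le> ln t")
    case True
    have "\<bar>psi (exp s) * psi (t * exp (- s))\<bar> \<le> 1/2 * (1/2)"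
      unfolding abs_mult by (intro mult_mono psi_bound) auto
    then show ?thesis using True by (simp add: f_def)
  qed (simp add: f_def)
  have "integral {1..x} psi_conv = integral {1..x} (\<lambda>t. integral {0..ln x} (f t))"
  proof (rule integral_cong)
    fix t assume t: "t \<in> {1..x}"
    have "integral {0..ln x} (\<lambda>s. if s \<in> {0..ln t} then psi (exp s) * psi (t * exp (- s)) else 0) = psi_conv t"
      unfolding psi_conv_def
      by (rule integral_unique, subst has_integral_restrict)
         (use t in \<open>auto intro!: integrable_integral psi_conv_integrable\<close>)
    moreover have "integral {0..ln x} (f t) =
      integral {0..ln x} (\<lambda>s. if s \<in> {0..ln t} then psi (exp s) * psi (t * exp (- s)) else 0)"
      by (rule integral_cong) (auto simp: f_def)
    ultimately show "psi_conv t = integral {0..ln x} (f t)" by simp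
  qed
  also have "\<dots> = integral {0..ln x} (\<lambda>s. integral {1..x} (\<lambda>t. f t s))"
    by (rule integral_swap_bounded_borel[OF meas B])
  also have "\<dots> = integral {0..ln x} (\<lambda>s. psi (exp s) * exp s * psi2 (x * exp (- s)))"
  proof (rule integral_cong)
    fix s assume s: "s \<in> {0..ln x}"
    have "exp s \<le> exp (ln x)" using s by simp
    then have s': "1 \<le> exp s" "exp s \<le> x" using s x by auto
    define P where "P t = psi (exp s) * (exp s * psi2 (t * exp (- s)))" for t
    have "((\<lambda>t. psi (exp s) * psi (t * exp (- s))) has_integral P x - P (exp s)) {exp s..x}"
    proof (rule FTC_piecewise)
      show "finite {t\<in>{exp s..x}. t * exp (- s) \<in> \<int>}"
        by (rule finite_vimage_Ints[where c="exp s * exp (- s)" and d="x * exp (- s)"]) (auto simp: inj_def)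
      show "continuous_on {exp s..x} P" unfolding P_def
        by (intro continuous_intros continuous_on_compose2[OF psi2_continuous_on[of UNIV]]) auto
      fix t assume "exp s < t" "t < x" "t \<notin> {t\<in>{exp s..x}. t * exp (- s) \<in> \<int>}"
      then have "t * exp (- s) \<notin> \<int>" by auto
      then have "((\<lambda>t. psi2 (t * exp (- s))) has_real_derivative psi (t * exp (- s)) * exp (- s)) (at t)"
        by (rule DERIV_chain2[OF psi2_deriv]) (auto intro!: derivative_eq_intros)
      from DERIV_cmult[OF DERIV_cmult[OF this, of "exp s"], of "psi (exp s)"]
      have "(P has_real_derivative psi (exp s) * (exp s * (psi (t * exp (- s)) * exp (- s)))) (at t)"
        unfolding P_def .
      moreover have "exp s * (psi (t * exp (- s)) * exp (- s)) = psi (t * exp (- s)) * (exp s * exp (- s))"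
        by (simp add: mult_ac)
      ultimately show "(P has_real_derivative psi (exp s) * psi (t * exp (- s))) (at t)"
        by (simp flip: exp_add)
    qed (use s' in simp)
    \<comment> \<open>At the lower end t = exp s the argument of \<open>psi2\<close> is 1, an
      integer, where \<open>psi2\<close> vanishes. Only the upper end contributes.\<close>
    moreover have "P (exp s) = 0"
      using psi2_Ints[of 1] by (simp add: P_def flip: exp_add)
    ultimately have "((\<lambda>t. if t \<in> {exp s..x} then psi (exp s) * psi (t * exp (- s)) else 0) has_integral P x) {1..x}"
      by (subst has_integral_restrict) (use s' in auto)
    then have "((\<lambda>t. f t s) has_integral P x) {1..x}"
    proof (rule has_integral_eq[rotated])
      fix t assume t: "t \<in> {1..x}"
      then have "s \<le> ln t \<longleftrightarrow> exp s \<le> t" by (simp add: ln_ge_iff)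
      then show "(if t \<in> {exp s..x} then psi (exp s) * psi (t * exp (- s)) else 0) = f t s"
        using t by (simp add: f_def)
    qed
    then show "integral {1..x} (\<lambda>t. f t s) = psi (exp s) * exp s * psi2 (x * exp (- s))"
      by (simp add: integral_unique P_def)
  qed
  finally show ?thesis .
qed


lemma psi_conv_integral_bound:
  assumes x: "x \<ge> 1"
  shows "\<bar>integral {1..x} psi_conv\<bar> \<le> sqrt x"
proof -
  define X where "X = ln x"
  have X: "X \<ge> 0" using x by (simp add: X_def)
  have eX: "exp X = x" "exp (X / 2) = sqrt x" "x * exp (- (X / 2)) = sqrt x"
  proof -
    show 1: "exp X = x" using x by (simp add: X_def)
    have "exp (X / 2) * exp (X / 2) = x" by (simp add: 1 flip: exp_add)
    then show 2: "exp (X / 2) = sqrt x" by (metis abs_exp_cancel real_sqrt_abs2)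
    have "exp X * exp (- (X / 2)) = exp (X / 2)" by (simp flip: exp_add)
    then show "x * exp (- (X / 2)) = sqrt x" using 1 2 by simp
  qed
  have sx: "sqrt x \<ge> 1" using x by simp
  define h where "h s = psi (exp s) * exp s * psi2 (x * exp (- s))" for s
  define k where "k s = psi2 (exp s) * (psi (x * exp (- s)) * (x * exp (- s)))" for s
  have hb: "\<bar>h s\<bar> \<le> 1/16 * exp s" for s
  proof -
    have "\<bar>h s\<bar> \<le> 1/2 * exp s * (1/8)" unfolding h_def abs_mult
      by (intro mult_mono psi_bound psi2_bound) auto
    then show ?thesis by simp
  qed
  have kb: "\<bar>k s\<bar> \<le> 1/16 * (x * exp (- s))" for s
  proof -
    have "\<bar>k s\<bar> \<le> 1/8 * (1/2 * (x * exp (- s)))" unfolding k_def abs_mult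
      using x by (intro mult_mono psi_bound psi2_bound) auto
    then show ?thesis by simp
  qed
  have hi: "h integrable_on {a..b}" for a b
  proof (rule integrable_on_bounded_borel)
    show "h \<in> borel_measurable borel" unfolding h_def[abs_def] by measurable
    fix s assume "a \<le> s" "s \<le> b"
    then have "exp s \<le> exp b" by simp
    then show "\<bar>h s\<bar> \<le> 1/16 * exp b" using hb[of s] by linarith
  qed
  have ki: "k integrable_on {a..b}" for a b
  proof (rule integrable_on_bounded_borel)
    show "k \<in> borel_measurable borel" unfolding k_def[abs_def] by measurable
    fix s assume "a \<le> s" "s \<le> b"
    then have "x * exp (- s) \<le> x * exp (- a)" using x by (intro mult_left_mono) auto
    then show "\<bar>k s\<bar> \<le> 1/16 * (x * exp (- a))" using kb[of s] by linarith
  qed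
  \<comment> \<open>The cut is at X / 2, where \<open>exp s\<close> and \<open>x * exp (- s)\<close>
    both equal sqrt x: \<open>h\<close> is at most a constant times the former, and integration by
    parts trades it for \<open>k\<close>, which is at most a constant times the latter.\<close>
  have "integral {1..x} psi_conv = integral {0..X/2} h + integral {X/2..X} h"
    unfolding psi_conv_integral_eq[OF x] h_def[symmetric] X_def[symmetric]
    by (rule Henstock_Kurzweil_Integration.integral_combine[symmetric, OF _ _ hi]) (use X in auto)
  moreover have "\<bar>integral {0..X/2} h\<bar> \<le> 1/16 * exp (X/2) - 1/16 * exp 0"
  proof (rule abs_integral_le_integral[OF hi _ hb])
    show "((\<lambda>s. 1/16 * exp s) has_integral 1/16 * exp (X/2) - 1/16 * exp 0) {0..X/2}"
      by (rule FTC_piecewise[where S="{}"]) (use X in \<open>auto intro!: derivative_eq_intros continuous_intros\<close>)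
  qed
  moreover have "\<bar>integral {X/2..X} h\<bar> \<le> 1/32 + (1/16 * sqrt x)"
  proof -
    define F where "F s = psi2 (exp s) * psi2 (x * exp (- s))" for s
    have "((\<lambda>s. h s - k s) has_integral F X - F (X/2)) {X/2..X}"
    proof (rule FTC_piecewise)
      show "finite ({s\<in>{X/2..X}. exp s \<in> \<int>} \<union> {s\<in>{X/2..X}. x * exp (- s) \<in> \<int>})"
        by (intro finite_UnI finite_exp_Ints finite_exp_minus_Ints) (use x in simp)
      show "continuous_on {X/2..X} F" unfolding F_def
        by (intro continuous_intros continuous_on_compose2[OF psi2_continuous_on[of UNIV]]) auto
      fix s assume "X/2 < s" "s < X"
        "s \<notin> {s\<in>{X/2..X}. exp s \<in> \<int>} \<union> {s\<in>{X/2..X}. x * exp (- s) \<in> \<int>}"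
      then have nz: "exp s \<notin> \<int>" "x * exp (- s) \<notin> \<int>" by auto
      from DERIV_mult[OF psi2_exp_deriv[OF nz(1)] psi2_exp_minus_deriv[OF nz(2)]]
      show "(F has_real_derivative h s - k s) (at s)"
        unfolding F_def h_def k_def by (rule DERIV_cong) (simp add: algebra_simps)
    qed (use X in simp)
    then have "integral {X/2..X} h = F X - F (X/2) + integral {X/2..X} k"
      using integral_diff[OF hi ki] by (simp add: has_integral_iff)
    moreover have "\<bar>F s\<bar> \<le> 1/8 * (1/8)" for s unfolding F_def abs_mult
      by (intro mult_mono psi2_bound) auto
    then have "\<bar>F X\<bar> \<le> 1/64" "\<bar>F (X/2)\<bar> \<le> 1/64" by auto
    moreover have "\<bar>integral {X/2..X} k\<bar> \<le> - (1/16) * (x * exp (- X)) - - (1/16) * (x * exp (- (X/2)))"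
    proof (rule abs_integral_le_integral[OF ki _ kb])
      show "((\<lambda>s. 1/16 * (x * exp (- s))) has_integral
         - (1/16) * (x * exp (- X)) - - (1/16) * (x * exp (- (X/2)))) {X/2..X}"
        by (rule FTC_piecewise[where S="{}"]) (use X in \<open>auto intro!: derivative_eq_intros continuous_intros\<close>)
    qed
    moreover have "x * exp (- X) \<ge> 0" using x by simp
    ultimately show ?thesis using eX(3) by linarith
  qed
  ultimately show ?thesis using eX(2) sx by simp
qed

section \<open>The integral of Delta11 * divmain'\<close>

definition log_mean :: "real \<Rightarrow> real" where
  "log_mean x = integral {1..x} (\<lambda>t. Delta11 t / t)"

text \<open>The bracket tends to 0, since \<open>psi_log2\<close> tends to 1/2 - gamma. It does so
  like 1 / x^2, which leaves O(1 / x) after multiplication by x.\<close>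

definition log_rem :: "real \<Rightarrow> real" where
  "log_rem x = - x * (2 * psi_log2 x + 2 * euler_mascheroni - 1)"

text \<open>The oscillating part of \<open>log_mean\<close>. It is written through integrals with a
  variable endpoint, from which continuity and the derivative off the integers can be read off; in
  \<open>psi_conv\<close> the variable x also occurs inside the discontinuous integrand.\<close>

definition log_osc :: "real \<Rightarrow> real" where
  "log_osc x = log_mean x - ln x / 4 - psi_log1 x - (2 * euler_mascheroni - 1)"

lemma Delta11_div_integrable: "(\<lambda>t. Delta11 t / t) integrable_on {1..x}"
proof (rule integrable_on_bounded_borel)
  fix t assume t: "1 \<le> t" "t \<le> x"
  have "\<bar>Delta11 t / t\<bar> = \<bar>Delta11 t\<bar> / t" using t by simp
  also have "\<dots> \<le> 8 * sqrt x / 1"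
    using Delta11_bound[of t] t real_sqrt_le_mono[of t x] by (intro frac_le) linarith+
  finally show "\<bar>Delta11 t / t\<bar> \<le> 8 * sqrt x / 1" .
qed measurable

lemma log_osc_eq:
  assumes x: "x \<ge> 1"
  shows "log_osc x = psi_conv x + log_rem x"
proof -
  have "((\<lambda>t. ln t + (2 * euler_mascheroni - 1)) has_integral
     (x * ln x - x + (2 * euler_mascheroni - 1) * x) - (1 * ln 1 - 1 + (2 * euler_mascheroni - 1) * 1)) {1..x}"
  proof (rule FTC_piecewise[where S="{}"])
    show "((\<lambda>t. t * ln t - t + (2 * euler_mascheroni - 1) * t) has_real_derivative
       ln t + (2 * euler_mascheroni - 1)) (at t)" if "1 < t" for t
      using that by (auto intro!: derivative_eq_intros)
  qed (use x in \<open>auto intro!: continuous_intros\<close>)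
  from has_integral_diff[OF divsum_log_mean_eq[OF x] this]
  have "((\<lambda>t. Delta11 t / t) has_integral
     (x * ln x - x + 1 + ln x / 4 - 2 * x * psi_log2 x + psi_log1 x + psi_conv x) -
     ((x * ln x - x + (2 * euler_mascheroni - 1) * x) - (1 * ln 1 - 1 + (2 * euler_mascheroni - 1) * 1))) {1..x}"
    by (rule has_integral_eq[rotated]) (auto simp: Delta11_eq divmain_def field_simps)
  then show ?thesis unfolding log_osc_def log_rem_def log_mean_def
    by (simp add: integral_unique algebra_simps)
qed

lemma log_rem_bound:
  assumes x: "x \<ge> 1"
  shows "\<bar>log_rem x\<bar> \<le> 1 / x"
proof -
  have "log_rem x = - 2 * x * (psi_log2 x - (1/2 - euler_mascheroni))"
    by (simp add: log_rem_def algebra_simps)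
  then have "\<bar>log_rem x\<bar> = 2 * x * \<bar>psi_log2 x - (1/2 - euler_mascheroni)\<bar>"
    using x by (simp add: abs_mult)
  also have "\<dots> \<le> 2 * x * (1 / (2 * x\<^sup>2))"
    using x by (intro mult_left_mono psi_log2_approx) auto
  also have "\<dots> = 1 / x" using x by (simp add: power2_eq_square)
  finally show ?thesis .
qed

lemma continuous_on_integral_ln:
  fixes f :: "real \<Rightarrow> real"
  assumes "\<And>a b. f integrable_on {a..b}"
  shows "continuous_on {1..x} (\<lambda>t. integral {0..ln t} f)"
proof -
  have "continuous_on {0..ln x} (\<lambda>u. integral {0..u} f)"
    by (rule indefinite_integral_continuous_1[OF assms])
  then show ?thesis
    by (rule continuous_on_compose2[where f=ln]) (auto intro!: continuous_intros)
qed

lemma psi_log1_continuous: "continuous_on {1..x} psi_log1"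
  unfolding psi_log1_def[abs_def] by (rule continuous_on_integral_ln[OF psi_log1_integrable])

lemma log_rem_continuous: "continuous_on {1..x} log_rem"
  unfolding log_rem_def[abs_def] psi_log2_def
  by (intro continuous_intros continuous_on_integral_ln psi_log2_integrable)

lemma log_osc_continuous: "continuous_on {1..x} log_osc"
  unfolding log_osc_def[abs_def] log_mean_def
  by (intro continuous_intros psi_log1_continuous indefinite_integral_continuous_1 Delta11_div_integrable) auto

text \<open>Continuity is inherited from \<open>log_osc\<close> and \<open>log_rem\<close> through
  the identity \<open>log_osc_eq\<close>.\<close>

lemma psi_conv_continuous: "continuous_on {1..x} psi_conv"
proof -
  have "continuous_on {1..x} (\<lambda>t. log_osc t - log_rem t)"
    by (intro continuous_intros log_osc_continuous log_rem_continuous)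
  then show ?thesis
    by (rule continuous_on_eq) (use log_osc_eq in auto)
qed

lemma log_osc_deriv:
  assumes t: "t > 1" "t \<notin> \<int>"
  shows "(log_osc has_real_derivative (Delta11 t - 1/4 - psi t) / t) (at t)"
proof -
  have c: "isCont Delta11 t" "isCont psi t"
    using Delta11_deriv[of t] psi_deriv[of t] t DERIV_isCont by auto
  have 1: "(log_mean has_real_derivative Delta11 t / t) (at t)"
    unfolding log_mean_def[abs_def]
    by (rule integral_deriv_at[OF Delta11_div_integrable, where b="t + 1"])
       (use t c in \<open>auto intro!: continuous_intros\<close>)
  have "isCont (\<lambda>s. psi (exp s)) (ln t)"
    by (rule isCont_o2[OF isCont_exp]) (use t c in simp)
  then have "((\<lambda>u. integral {0..u} (\<lambda>s. psi (exp s))) has_real_derivative psi (exp (ln t))) (at (ln t))"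
    by (intro integral_deriv_at[OF psi_log1_integrable, where b="ln t + 1"]) (use t in auto)
  from DERIV_chain2[where g=ln and x=t, OF this DERIV_ln_divide]
  have 2: "(psi_log1 has_real_derivative psi t / t) (at t)"
    using t by (simp add: psi_log1_def[abs_def])
  have "((\<lambda>x. log_mean x - ln x / 4 - psi_log1 x - (2 * euler_mascheroni - 1)) has_real_derivative
     Delta11 t / t - (1 / t) / 4 - psi t / t - 0) (at t)"
    by (intro derivative_intros 1 2 DERIV_cdivide DERIV_ln_divide) (use t in auto)
  then show ?thesis unfolding log_osc_def[abs_def]
    by (rule DERIV_cong) (use t in \<open>simp add: field_simps\<close>)
qed

lemma psi_divmain'_integral:
  assumes x: "x \<ge> 1"
  shows "(\<lambda>t. psi t * divmain' t) integrable_on {1..x}"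
    and "\<bar>integral {1..x} (\<lambda>t. psi t * divmain' t)\<bar> \<le> divmain' x / 4"
proof -
  show i1: "(\<lambda>t. psi t * divmain' t) integrable_on {1..x}"
  proof (rule integrable_on_bounded_borel)
    show "\<bar>psi t * divmain' t\<bar> \<le> 1/2 * divmain' x" if "1 \<le> t" "t \<le> x" for t
      unfolding abs_mult using that by (intro mult_mono psi_bound divmain'_abs_le) auto
  qed measurable
  define F where "F t = psi2 t * divmain' t" for t
  have F: "((\<lambda>t. psi t * divmain' t + psi2 t / t) has_integral F x - F 1) {1..x}"
  proof (rule FTC_piecewise[OF finite_Ints_Icc[of 1 x]])
    show "continuous_on {1..x} F" unfolding F_def
      by (intro continuous_at_imp_continuous_on ballI continuous_intros psi2_isCont
           DERIV_isCont[OF divmain'_deriv]) auto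
    fix t assume "1 < t" "t < x" "t \<notin> {1..x} \<inter> \<int>"
    then have nz: "t \<notin> \<int>" "t > 0" by auto
    from DERIV_mult[OF psi2_deriv[OF nz(1)] divmain'_deriv[OF nz(2)]]
    show "(F has_real_derivative psi t * divmain' t + psi2 t / t) (at t)"
      unfolding F_def by (rule DERIV_cong) simp
  qed (use x in auto)
  have b: "\<bar>psi2 t / t\<bar> \<le> 1/8 * (1 / t)" if "1 \<le> t" for t
    using psi2_bound[of t] that by (simp add: field_simps)
  have i2: "(\<lambda>t. psi2 t / t) integrable_on {1..x}"
    by (intro integrable_continuous_real continuous_intros psi2_continuous_on) auto
  have "integral {1..x} (\<lambda>t. psi t * divmain' t) = F x - F 1 - integral {1..x} (\<lambda>t. psi2 t / t)"
    using integral_add[OF i1 i2] F by (simp add: has_integral_iff)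
  moreover have "\<bar>F x\<bar> \<le> 1/8 * divmain' x" unfolding F_def abs_mult
    using x by (intro mult_mono psi2_bound divmain'_abs_le) auto
  moreover have "F 1 = 0" using psi2_Ints[of 1] by (simp add: F_def)
  moreover have i2b: "\<bar>integral {1..x} (\<lambda>t. psi2 t / t)\<bar> \<le> 1/8 * ln x - 1/8 * ln 1"
  proof (rule abs_integral_le_integral[OF i2 _ b])
    show "((\<lambda>t. 1/8 * (1 / t)) has_integral 1/8 * ln x - 1/8 * ln 1) {1..x}"
      by (rule FTC_piecewise[where S="{}"]) (use x in \<open>auto intro!: derivative_eq_intros continuous_intros\<close>)
  qed
  moreover have "\<bar>integral {1..x} (\<lambda>t. psi2 t / t)\<bar> \<le> 1/8 * divmain' x"
    using i2b euler_mascheroni_pos unfolding divmain'_def by simp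
  ultimately show "\<bar>integral {1..x} (\<lambda>t. psi t * divmain' t)\<bar> \<le> divmain' x / 4"
    by linarith
qed

lemma divmain'_continuous: "continuous_on {1..x} divmain'"
  by (intro continuous_at_imp_continuous_on ballI DERIV_isCont[OF divmain'_deriv]) auto

text \<open>Integration by parts moves the weight onto the primitive P of \<open>psi_conv\<close>.
  As P is O(sqrt t), \<open>P t / t\<close> integrates to O(sqrt x), and the weight costs a
  logarithm only in the boundary term.\<close>

lemma psi_conv_weighted_integral:
  assumes x: "x \<ge> 1"
  shows "\<bar>integral {1..x} (\<lambda>t. (divmain' t + 1) * psi_conv t)\<bar> \<le> (divmain' x + 3) * sqrt x"
proof -
  define P where "P t = integral {1..t} psi_conv" for t
  have pi: "psi_conv integrable_on {1..x}" for x
    by (rule integrable_continuous_real[OF psi_conv_continuous])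
  have Pc: "continuous_on {1..x} P" unfolding P_def
    by (rule indefinite_integral_continuous_1[OF pi])
  have "((\<lambda>t. (divmain' t + 1) * psi_conv t + P t / t) has_integral
      (divmain' x + 1) * P x - (divmain' 1 + 1) * P 1) {1..x}"
  proof (rule FTC_piecewise[where S="{}"])
    show "continuous_on {1..x} (\<lambda>t. (divmain' t + 1) * P t)"
      by (intro continuous_intros Pc divmain'_continuous)
    fix t assume t: "1 < t" "t < x"
    have "isCont psi_conv t"
      using psi_conv_continuous[of x] t by (simp add: continuous_on_interior)
    then have "(P has_real_derivative psi_conv t) (at t)" unfolding P_def[abs_def]
      using t by (intro integral_deriv_at[OF pi, where b=x]) auto
    moreover have "((\<lambda>t. divmain' t + 1) has_real_derivative 1 / t) (at t)"
      using divmain'_deriv[of t] t by (auto intro!: derivative_eq_intros)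
    ultimately show "((\<lambda>t. (divmain' t + 1) * P t) has_real_derivative (divmain' t + 1) * psi_conv t + P t / t) (at t)"
      using DERIV_mult[of "\<lambda>t. divmain' t + 1" "1 / t" t UNIV P "psi_conv t"]
      by (simp add: algebra_simps)
  qed (use x in auto)
  moreover have i1: "(\<lambda>t. (divmain' t + 1) * psi_conv t) integrable_on {1..x}"
    by (intro integrable_continuous_real continuous_intros psi_conv_continuous divmain'_continuous)
  moreover have i2: "(\<lambda>t. P t / t) integrable_on {1..x}"
    by (intro integrable_continuous_real continuous_intros Pc) auto
  ultimately have "integral {1..x} (\<lambda>t. (divmain' t + 1) * psi_conv t) =
     (divmain' x + 1) * P x - integral {1..x} (\<lambda>t. P t / t)"
    using integral_add[OF i1 i2] by (simp add: has_integral_iff P_def)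
  moreover have "\<bar>(divmain' x + 1) * P x\<bar> \<le> (divmain' x + 1) * sqrt x"
    using psi_conv_integral_bound[OF x] divmain'_nonneg[OF x]
    by (simp add: abs_mult P_def mult_left_mono)
  moreover have "\<bar>integral {1..x} (\<lambda>t. P t / t)\<bar> \<le> 2 * sqrt x - 2 * sqrt 1"
  proof (rule abs_integral_le_integral[OF i2])
    show "((\<lambda>t. 1 / sqrt t) has_integral 2 * sqrt x - 2 * sqrt 1) {1..x}"
    proof (rule FTC_piecewise[where S="{}"])
      show "((\<lambda>t. 2 * sqrt t) has_real_derivative 1 / sqrt t) (at t)" if "1 < t" for t
        using that by (auto intro!: derivative_eq_intros simp: field_simps)
    qed (use x in \<open>auto intro!: continuous_intros\<close>)
    fix t assume t: "1 \<le> t" "t \<le> x"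
    have "\<bar>P t / t\<bar> \<le> sqrt t / t"
      using psi_conv_integral_bound[of t] t by (simp add: P_def divide_right_mono)
    also have "\<dots> = 1 / sqrt t" using t by (simp add: real_div_sqrt field_simps)
    finally show "\<bar>P t / t\<bar> \<le> 1 / sqrt t" .
  qed
  ultimately show ?thesis by (simp add: algebra_simps)
qed

text \<open>Off the integers \<open>Delta11 t\<close> is t times the derivative of
  \<open>log_osc\<close>, plus 1/4 + psi t. Integration by parts with the weight
  \<open>t * divmain' t\<close>, whose derivative is \<open>divmain' t + 1\<close>, leaves
  \<open>psi_conv\<close> at x as a boundary term, the integral of \<open>divmain' / 4\<close> as
  elementary main term, and integrals with enough cancellation.\<close>

lemma Delta11_divmain'_integral:
  assumes x: "x \<ge> 1"
  shows "\<bar>integral {1..x} (\<lambda>t. Delta11 t * divmain' t)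
     - (x * divmain' x / 4 - x / 4 + x * divmain' x * psi_conv x)\<bar> \<le> 20 * (sqrt x * (divmain' x + 1))"
proof -
  define H where "H t = t * divmain' t * log_osc t" for t
  have i1: "(\<lambda>t. Delta11 t * divmain' t) integrable_on {1..x}"
    using psi_Delta11_integrable[OF x] by blast
  have i2: "(\<lambda>t. 1/4 * divmain' t) integrable_on {1..x}"
    by (intro integrable_continuous_real continuous_intros divmain'_continuous)
  note i3 = psi_divmain'_integral(1)[OF x]
  have i4: "(\<lambda>t. (divmain' t + 1) * psi_conv t) integrable_on {1..x}"
    by (intro integrable_continuous_real continuous_intros psi_conv_continuous divmain'_continuous)
  have i5: "(\<lambda>t. (divmain' t + 1) * log_rem t) integrable_on {1..x}"
    by (intro integrable_continuous_real continuous_intros log_rem_continuous divmain'_continuous)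
  have H: "((\<lambda>t. (Delta11 t - 1/4 - psi t) * divmain' t + (divmain' t + 1) * log_osc t) has_integral H x - H 1) {1..x}"
  proof (rule FTC_piecewise[OF finite_Ints_Icc[of 1 x]])
    show "continuous_on {1..x} H" unfolding H_def
      by (intro continuous_intros divmain'_continuous log_osc_continuous)
    fix t assume "1 < t" "t < x" "t \<notin> {1..x} \<inter> \<int>"
    then have nz: "t \<notin> \<int>" "t > 1" "t > 0" by auto
    from DERIV_mult[OF DERIV_mult[OF DERIV_ident divmain'_deriv[OF nz(3)]] log_osc_deriv[OF nz(2,1)]]
    show "(H has_real_derivative (Delta11 t - 1/4 - psi t) * divmain' t + (divmain' t + 1) * log_osc t) (at t)"
      unfolding H_def by (rule DERIV_cong) (use nz in \<open>simp add: field_simps\<close>)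
  qed (use x in auto)
  have "((\<lambda>t. Delta11 t * divmain' t - 1/4 * divmain' t - psi t * divmain' t
      + ((divmain' t + 1) * psi_conv t + (divmain' t + 1) * log_rem t)) has_integral
     integral {1..x} (\<lambda>t. Delta11 t * divmain' t) - integral {1..x} (\<lambda>t. 1/4 * divmain' t)
     - integral {1..x} (\<lambda>t. psi t * divmain' t)
     + (integral {1..x} (\<lambda>t. (divmain' t + 1) * psi_conv t) + integral {1..x} (\<lambda>t. (divmain' t + 1) * log_rem t))) {1..x}"
    by (intro has_integral_add has_integral_diff integrable_integral i1 i2 i3 i4 i5)
  then have "((\<lambda>t. (Delta11 t - 1/4 - psi t) * divmain' t + (divmain' t + 1) * log_osc t) has_integral
     integral {1..x} (\<lambda>t. Delta11 t * divmain' t) - integral {1..x} (\<lambda>t. 1/4 * divmain' t)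
     - integral {1..x} (\<lambda>t. psi t * divmain' t)
     + (integral {1..x} (\<lambda>t. (divmain' t + 1) * psi_conv t) + integral {1..x} (\<lambda>t. (divmain' t + 1) * log_rem t))) {1..x}"
    by (rule has_integral_eq[rotated]) (auto simp: log_osc_eq algebra_simps)
  from has_integral_unique[OF H this]
  have E: "integral {1..x} (\<lambda>t. Delta11 t * divmain' t) = H x - H 1 + integral {1..x} (\<lambda>t. 1/4 * divmain' t)
     + integral {1..x} (\<lambda>t. psi t * divmain' t)
     - integral {1..x} (\<lambda>t. (divmain' t + 1) * psi_conv t) - integral {1..x} (\<lambda>t. (divmain' t + 1) * log_rem t)"
    by simp
  have dx: "divmain' x \<ge> 0" "sqrt x \<ge> 1" using x divmain'_nonneg by auto
  have g: "0 < (euler_mascheroni::real)" "(euler_mascheroni::real) < 1"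
    using euler_mascheroni_pos euler_mascheroni_less_13_over_22 by linarith+
  have "((\<lambda>t. 1/4 * divmain' t) has_integral
     1/4 * (x * divmain' x - x) - 1/4 * (1 * divmain' 1 - 1)) {1..x}"
  proof (rule FTC_piecewise[where S="{}"])
    show "continuous_on {1..x} (\<lambda>t. 1/4 * (t * divmain' t - t))"
      by (intro continuous_intros divmain'_continuous)
    show "((\<lambda>t. 1/4 * (t * divmain' t - t)) has_real_derivative 1/4 * divmain' t) (at t)" if "1 < t" for t
      using that by (auto intro!: derivative_eq_intros divmain'_deriv)
  qed (use x in auto)
  then have J: "integral {1..x} (\<lambda>t. 1/4 * divmain' t) = x * divmain' x / 4 - x / 4 - (2 * euler_mascheroni - 1) / 4"
    by (subst integral_unique) (auto simp: divmain'_def[of 1] field_simps)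
  have Hx: "\<bar>H x - x * divmain' x * psi_conv x\<bar> \<le> divmain' x"
  proof -
    have "H x - x * divmain' x * psi_conv x = divmain' x * (x * log_rem x)"
      using x by (simp add: H_def log_osc_eq algebra_simps)
    also have "\<bar>\<dots>\<bar> = divmain' x * (x * \<bar>log_rem x\<bar>)" using dx x by (simp add: abs_mult)
    also have "\<dots> \<le> divmain' x * (x * (1 / x))" using log_rem_bound[OF x] dx x by (intro mult_left_mono) auto
    finally show ?thesis using x by simp
  qed
  have H1: "\<bar>H 1\<bar> \<le> 2"
  proof -
    have "H 1 = - (2 * euler_mascheroni * (2 * euler_mascheroni - 1))"
      by (simp add: H_def divmain'_def log_osc_def log_mean_def psi_log1_def algebra_simps)
    then have "\<bar>H 1\<bar> = (2 * euler_mascheroni) * \<bar>2 * euler_mascheroni - 1\<bar>" using g by (simp add: abs_mult)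
    also have "\<dots> \<le> 2 * 1" using g by (intro mult_mono) auto
    finally show ?thesis by simp
  qed
  have lx: "ln x \<le> 2 * sqrt x"
    using ln_le_minus_one[of "sqrt x"] x dx by (simp add: ln_sqrt)
  have R: "\<bar>integral {1..x} (\<lambda>t. (divmain' t + 1) * log_rem t)\<bar> \<le> (divmain' x + 1) * ln x - (divmain' x + 1) * ln 1"
  proof (rule abs_integral_le_integral[OF i5])
    show "((\<lambda>t. (divmain' x + 1) * (1 / t)) has_integral (divmain' x + 1) * ln x - (divmain' x + 1) * ln 1) {1..x}"
      by (rule FTC_piecewise[where S="{}"]) (use x in \<open>auto intro!: derivative_eq_intros continuous_intros\<close>)
    fix t assume t: "1 \<le> t" "t \<le> x"
    then show "\<bar>(divmain' t + 1) * log_rem t\<bar> \<le> (divmain' x + 1) * (1 / t)"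
      unfolding abs_mult using divmain'_mono[OF t] divmain'_nonneg[of t]
      by (intro mult_mono log_rem_bound) auto
  qed
  have R': "(divmain' x + 1) * ln x \<le> 2 * (sqrt x * (divmain' x + 1))"
    using mult_left_mono[OF lx, of "divmain' x + 1"] dx by (simp add: algebra_simps)
  have "1 * (divmain' x + 1) \<le> sqrt x * (divmain' x + 1)" using dx by (intro mult_right_mono) auto
  then have S: "divmain' x + 1 \<le> sqrt x * (divmain' x + 1)" "1 \<le> sqrt x * (divmain' x + 1)"
    "sqrt x \<le> sqrt x * (divmain' x + 1)"
    using dx by (auto simp: algebra_simps)
  have R'': "\<bar>integral {1..x} (\<lambda>t. (divmain' t + 1) * log_rem t)\<bar> \<le> 2 * (sqrt x * (divmain' x + 1))"
    using R R' by simp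
  have W: "(divmain' x + 3) * sqrt x = sqrt x * (divmain' x + 1) + 2 * sqrt x" by (simp add: algebra_simps)
  \<comment> \<open>All errors are compared with K = sqrt x (M' + 1), where M' =
    \<open>divmain' x\<close>; the factor 20 leaves ample room.\<close>
  have lin: "\<bar>T - (a - b + c)\<bar> \<le> 20 * K"
    if "T = h - h1 + j + p - w - r" "j = a - b - (2 * g - 1) / 4" "\<bar>h - c\<bar> \<le> m" "\<bar>h1\<bar> \<le> 2"
      "\<bar>r\<bar> \<le> 2 * K" "m + 1 \<le> K" "1 \<le> K" "q \<le> K" "0 < g" "g < 1" "0 \<le> m"
      "\<bar>w\<bar> \<le> K + 2 * q" "\<bar>p\<bar> \<le> m / 4"
    for T a b c h h1 j p w r g m q K :: real
    using that unfolding abs_le_iff by (auto simp: field_simps)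
  show ?thesis
    by (rule lin[OF E J Hx H1 R'' S g dx(1) psi_conv_weighted_integral[OF x, unfolded W]
          psi_divmain'_integral(2)[OF x]])
qed

text \<open>The explicit terms are x M' / 4 - x / 4 plus one sixth of the integral of M'^2, with M'
  = ln x + 2 gamma, expanded in powers of ln x. The contribution of the lower limit 1 is a constant
  and goes into the error.\<close>

lemma sum_Delta11_squares_psi_conv:
  fixes x :: real
  assumes x: "x \<ge> 1"
  shows "\<bar>(\<Sum>n | 1 \<le> n \<and> real n \<le> x. (Delta11 (real n))\<^sup>2)
      - ((1 / 2 - psi x) * (Delta11 x)\<^sup>2
         + integral {1..x} (\<lambda>t. (Delta11 t)\<^sup>2)
         + 1 / 6 * x * (ln x)\<^sup>2
         + (8 * euler_mascheroni - 1) / 12 * x * ln x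
         + (8 * euler_mascheroni\<^sup>2 - 2 * euler_mascheroni + 1) / 12 * x
         + x * divmain' x * psi_conv x)\<bar>
    \<le> 20 * (sqrt x * (divmain' x + 1)) + 2 * (sqrt x * (divmain' x + 2) + (divmain' x)\<^sup>2 / 8) + 2"
proof -
  define g where "g = (euler_mascheroni :: real)"
  define m where "m = divmain' x"
  define r where "r = sqrt x"
  define L where "L = ln x"
  define q where "q = x * m * psi_conv x"
  define S where "S = (\<Sum>n | 1 \<le> n \<and> real n \<le> x. (Delta11 (real n))\<^sup>2)"
  define D where "D = (1 / 2 - psi x) * (Delta11 x)\<^sup>2"
  define I0 where "I0 = integral {1..x} (\<lambda>t. (Delta11 t)\<^sup>2)"
  define I1 where "I1 = integral {1..x} (\<lambda>t. Delta11 t * divmain' t)"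
  define I2 where "I2 = integral {1..x} (\<lambda>t. psi t * (Delta11 t * divmain' t))"
  define I3 where "I3 = integral {1..x} (\<lambda>t. (divmain' t)\<^sup>2)"
  have g: "0 < g" "g < 1" unfolding g_def
    using euler_mascheroni_pos euler_mascheroni_less_13_over_22 by linarith+
  have m: "m = L + 2 * g" by (simp add: m_def divmain'_def L_def g_def)
  note ints = psi_Delta11_integrable[OF x]
  have "((\<lambda>t. (Delta11 t)\<^sup>2 + (Delta11 t * divmain' t - 2 * (psi t * (Delta11 t * divmain' t))))
     has_integral I0 + (I1 - 2 * I2)) {1..x}"
    unfolding I0_def I1_def I2_def
    by (intro has_integral_add has_integral_diff has_integral_mult_right integrable_integral ints)
  then have "((\<lambda>t. (Delta11 t)\<^sup>2 + (1 - 2 * psi t) * (Delta11 t * divmain' t))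
     has_integral I0 + (I1 - 2 * I2)) {1..x}"
    by (rule has_integral_eq[rotated]) (simp add: algebra_simps)
  from has_integral_unique[OF sum_squares_identity[OF x] this]
  have S: "S = D + I0 + I1 - 2 * I2" by (simp add: S_def D_def)
  have B1: "\<bar>I1 - (x * m / 4 - x / 4 + q)\<bar> \<le> 20 * (r * (m + 1))"
    unfolding I1_def m_def r_def q_def by (rule Delta11_divmain'_integral[OF x])
  have B2: "\<bar>I2 + 1/12 * I3\<bar> \<le> r * (m + 2) + m\<^sup>2 / 8"
    unfolding I2_def I3_def m_def r_def by (rule psi_Delta11_integral[OF x])
  have I3: "I3 = (x * L\<^sup>2 - 2 * x * L + 2 * x + 4 * g * (x * L - x) + 4 * g\<^sup>2 * x) - (2 - 4 * g + 4 * g\<^sup>2)"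
    using integral_unique[OF divmain'_sq_integral[OF x]] by (simp add: I3_def L_def g_def)
  define T where "T = 1 / 6 * x * L\<^sup>2 + (8 * g - 1) / 12 * x * L + (8 * g\<^sup>2 - 2 * g + 1) / 12 * x + q"
  have id: "S - (D + I0 + T) = (I1 - (x * m / 4 - x / 4 + q)) - 2 * (I2 + 1/12 * I3) - (2 - 4 * g + 4 * g\<^sup>2) / 6"
    unfolding S T_def I3 m by (simp add: field_simps power2_eq_square)
  have g2: "g\<^sup>2 \<le> 1" "0 \<le> g\<^sup>2" using g by (auto simp: power_le_one)
  have "2 - 4 * g + 4 * g\<^sup>2 \<le> 12" "- (2 - 4 * g + 4 * g\<^sup>2) \<le> 12" using g g2 by linarith+
  then have c: "\<bar>(2 - 4 * g + 4 * g\<^sup>2) / 6\<bar> \<le> 2" by (simp add: abs_le_iff)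
  have "\<bar>a - 2 * b - d\<bar> \<le> A + 2 * B + 2" if "\<bar>a\<bar> \<le> A" "\<bar>b\<bar> \<le> B" "\<bar>d\<bar> \<le> 2" for a b d A B :: real
    using that by linarith
  from this[OF B1 B2 c] have "\<bar>S - (D + I0 + T)\<bar> \<le> 20 * (r * (m + 1)) + 2 * (r * (m + 2) + m\<^sup>2 / 8) + 2"
    unfolding id .
  moreover have "D + I0 + T = D + I0 + 1 / 6 * x * L\<^sup>2 + (8 * g - 1) / 12 * x * L
      + (8 * g\<^sup>2 - 2 * g + 1) / 12 * x + q"
    by (simp add: T_def)
  ultimately show ?thesis
    unfolding S_def D_def I0_def L_def g_def q_def r_def m_def by simp
qed

section \<open>Oscillatory integrals\<close>

lemma cis_has_vector_derivative:
  assumes "(\<phi> has_real_derivative d) (at t)"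
  shows "((\<lambda>t. cis (\<phi> t)) has_vector_derivative d *\<^sub>R (\<i> * cis (\<phi> t))) (at t)"
proof -
  have "(\<phi> has_derivative (\<lambda>h. d * h)) (at t)"
    using assms by (simp add: has_field_derivative_def)
  from has_derivative_cis[OF this] show ?thesis
    by (simp add: has_vector_derivative_def mult_ac)
qed

text \<open>To estimate the integral of an amplitude f times \<open>cis\<close> of the phase, take q
  to be f divided by the derivative of the phase. The variation of q is bounded through an
  integrable majorant v of its derivative, so q need not be monotone, and zeros of the phase
  derivative are harmless when f vanishes there too.\<close>

lemma oscillatory_by_parts:
  fixes \<phi> \<phi>' q q' :: "real \<Rightarrow> real"
  assumes ab: "a \<le> b"
    and d\<phi>: "\<And>t. a \<le> t \<Longrightarrow> t \<le> b \<Longrightarrow> (\<phi> has_real_derivative \<phi>' t) (at t)"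
    and dq: "\<And>t. a \<le> t \<Longrightarrow> t \<le> b \<Longrightarrow> (q has_real_derivative q' t) (at t)"
    and q'c: "continuous_on {a..b} q'"
    and V: "(v has_integral V) {a..b}" "\<And>t. a \<le> t \<Longrightarrow> t \<le> b \<Longrightarrow> \<bar>q' t\<bar> \<le> v t"
  shows "norm (integral {a..b} (\<lambda>t. (\<phi>' t * q t) *\<^sub>R cis (\<phi> t))) \<le> \<bar>q a\<bar> + \<bar>q b\<bar> + V"
proof -
  define K where "K t = q t *\<^sub>R (- \<i> * cis (\<phi> t))" for t
  have \<phi>c: "continuous_on {a..b} \<phi>"
    using d\<phi> by (intro continuous_at_imp_continuous_on ballI) (auto intro: DERIV_isCont)
  have cc: "continuous_on {a..b} (\<lambda>t. cis (\<phi> t))"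
    by (intro continuous_on_compose2[OF continuous_on_cis[OF continuous_on_id, of UNIV] \<phi>c]) auto
  have K: "(K has_vector_derivative (\<phi>' t * q t) *\<^sub>R cis (\<phi> t) + q' t *\<^sub>R (- \<i> * cis (\<phi> t))) (at t)"
    if t: "a \<le> t" "t \<le> b" for t
  proof -
    have "((\<lambda>t. - \<i> * cis (\<phi> t)) has_vector_derivative - \<i> * (\<phi>' t *\<^sub>R (\<i> * cis (\<phi> t)))) (at t)"
      by (intro has_vector_derivative_mult_right cis_has_vector_derivative d\<phi> t)
    from has_vector_derivative_scaleR[OF dq[OF t] this] show ?thesis
      unfolding K_def by (rule back_subst[where P="\<lambda>x. (_ has_vector_derivative x) _"])
        (simp add: scaleR_conv_of_real algebra_simps)
  qed
  have "((\<lambda>t. (\<phi>' t * q t) *\<^sub>R cis (\<phi> t) + q' t *\<^sub>R (- \<i> * cis (\<phi> t))) has_integral K b - K a) {a..b}"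
    by (rule fundamental_theorem_of_calculus[OF ab]) (use K in \<open>auto intro: has_vector_derivative_at_within\<close>)
  moreover have i2: "(\<lambda>t. q' t *\<^sub>R (- \<i> * cis (\<phi> t))) integrable_on {a..b}"
    by (intro integrable_continuous_real continuous_intros q'c cc)
  ultimately have "((\<lambda>t. (\<phi>' t * q t) *\<^sub>R cis (\<phi> t)) has_integral
      K b - K a - integral {a..b} (\<lambda>t. q' t *\<^sub>R (- \<i> * cis (\<phi> t)))) {a..b}"
    using has_integral_diff[OF _ integrable_integral[OF i2]] by fastforce
  then have "integral {a..b} (\<lambda>t. (\<phi>' t * q t) *\<^sub>R cis (\<phi> t)) =
      K b - K a - integral {a..b} (\<lambda>t. q' t *\<^sub>R (- \<i> * cis (\<phi> t)))"
    by (rule integral_unique)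
  also have "norm \<dots> \<le> norm (K b) + norm (K a) + norm (integral {a..b} (\<lambda>t. q' t *\<^sub>R (- \<i> * cis (\<phi> t))))"
    by (meson add_mono norm_triangle_ineq4 order_refl order_trans)
  also have "norm (integral {a..b} (\<lambda>t. q' t *\<^sub>R (- \<i> * cis (\<phi> t)))) \<le> V"
    using integral_norm_bound_integral[OF i2 has_integral_integrable[OF V(1)]] V
    by (auto simp: norm_mult has_integral_iff)
  finally show ?thesis by (simp add: K_def norm_mult)
qed

section \<open>The Fresnel integral and its limit\<close>

definition fresnel :: "real \<Rightarrow> complex" where
  "fresnel y = integral {0..y} (\<lambda>u. cis (u\<^sup>2))"

lemma cis_sq_continuous: "continuous_on A (\<lambda>u::real. cis (u\<^sup>2))"
  by (intro continuous_intros)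

lemma cis_sq_integrable: "(\<lambda>u::real. cis (u\<^sup>2)) integrable_on {a..b}"
  by (intro integrable_continuous_real cis_sq_continuous)

text \<open>With q = 1 / (2 u) the boundary term at z cancels against the variation of q, leaving
  twice 1 / (2 y).\<close>

lemma fresnel_tail:
  assumes "0 < y" "y \<le> z"
  shows "norm (integral {y..z} (\<lambda>u. cis (u\<^sup>2))) \<le> 1 / y"
proof -
  have "norm (integral {y..z} (\<lambda>u. ((2 * u) * (1 / (2 * u))) *\<^sub>R cis (u\<^sup>2)))
     \<le> \<bar>1 / (2 * y)\<bar> + \<bar>1 / (2 * z)\<bar> + (- (1 / (2 * z)) - - (1 / (2 * y)))"
  proof (rule oscillatory_by_parts[OF assms(2), where q'="\<lambda>u. - 1 / (2 * u\<^sup>2)" and v="\<lambda>u. 1 / (2 * u\<^sup>2)"])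
    show "((\<lambda>u. 1 / (2 * u\<^sup>2)) has_integral - (1 / (2 * z)) - - (1 / (2 * y))) {y..z}"
      by (rule FTC_piecewise[where S="{}"])
         (use assms in \<open>auto intro!: derivative_eq_intros continuous_intros simp: power2_eq_square\<close>)
    fix t assume "y \<le> t"
    then show "((\<lambda>u. 1 / (2 * u)) has_real_derivative - 1 / (2 * t\<^sup>2)) (at t)"
      using assms by (auto intro!: derivative_eq_intros simp: power2_eq_square)
  qed (use assms in \<open>auto intro!: derivative_eq_intros continuous_intros\<close>)
  also have "\<dots> = 1 / y" using assms by simp
  also have "integral {y..z} (\<lambda>u. ((2 * u) * (1 / (2 * u))) *\<^sub>R cis (u\<^sup>2)) = integral {y..z} (\<lambda>u. cis (u\<^sup>2))"
    by (rule integral_cong) (use assms in auto)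
  finally show ?thesis .
qed

lemma fresnel_diff:
  assumes "0 \<le> y" "y \<le> z"
  shows "fresnel z - fresnel y = integral {y..z} (\<lambda>u. cis (u\<^sup>2))"
  using Henstock_Kurzweil_Integration.integral_combine[OF assms cis_sq_integrable]
  by (simp add: fresnel_def algebra_simps)

lemma fresnel_diff_bound: "0 < y \<Longrightarrow> y \<le> z \<Longrightarrow> norm (fresnel z - fresnel y) \<le> 1 / y"
  using fresnel_tail[of y z] fresnel_diff[of y z] by simp

lemma fresnel_small: "0 \<le> y \<Longrightarrow> y \<le> 1 \<Longrightarrow> norm (fresnel y) \<le> 1"
  using integral_norm_bound_integral[OF cis_sq_integrable integrable_const_ivl, of 0 y 1]
  unfolding fresnel_def by simp

lemma fresnel_bound: "0 \<le> y \<Longrightarrow> norm (fresnel y) \<le> 2"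
proof (cases "y \<le> 1")
  case False
  have "norm (fresnel y) \<le> norm (fresnel 1) + norm (fresnel y - fresnel 1)"
    by (metis add.commute diff_add_cancel norm_triangle_ineq)
  then show ?thesis using fresnel_diff_bound[of 1 y] fresnel_small[of 1] False by simp
qed (use fresnel_small[of y] in simp)

lemma fresnel_deriv_within:
  assumes "0 \<le> y" "y \<le> b"
  shows "(fresnel has_vector_derivative cis (y\<^sup>2)) (at y within {0..b})"
  unfolding fresnel_def[abs_def]
  by (rule integral_has_vector_derivative[OF cis_sq_continuous]) (use assms in auto)

lemma fresnel_deriv: "0 < y \<Longrightarrow> (fresnel has_vector_derivative cis (y\<^sup>2)) (at y)"
  using fresnel_deriv_within[of y "y + 1"] by (simp add: at_within_Icc_at)

lemma fresnel_continuous: "continuous_on {0..b} fresnel"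
  unfolding fresnel_def[abs_def] by (rule indefinite_integral_continuous_1[OF cis_sq_integrable])

lemma one_plus_square_pos: "1 + t\<^sup>2 > 0" for t :: real
  by (rule add_pos_nonneg) auto

definition fresnel_aux :: "real \<Rightarrow> complex" where
  "fresnel_aux x = integral {0..1} (\<lambda>t. (1 / (1 + t\<^sup>2)) *\<^sub>R cis (x\<^sup>2 * (1 + t\<^sup>2)))"

lemma fresnel_scale:
  assumes "x \<ge> 0" "c \<ge> 0"
  shows "((\<lambda>t. x *\<^sub>R cis ((x * t)\<^sup>2)) has_integral fresnel (x * c)) {0..c}"
proof (cases "x = 0")
  case False
  then have x: "x > 0" using assms by simp
  have "((\<lambda>t. x *\<^sub>R cis ((x * t)\<^sup>2)) has_integral (fresnel \<circ> (\<lambda>t. x * t)) c - (fresnel \<circ> (\<lambda>t. x * t)) 0) {0..c}"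
  proof (rule fundamental_theorem_of_calculus_interior)
    show "continuous_on {0..c} (fresnel \<circ> (\<lambda>t. x * t))" unfolding o_def
      by (rule continuous_on_compose2[OF fresnel_continuous[of "x * c"]])
         (use x in \<open>auto intro!: continuous_intros mult_left_mono\<close>)
    fix t assume "t \<in> {0<..<c}"
    then have t: "0 < t" "0 < x * t" using x by auto
    have "((\<lambda>t. x * t) has_vector_derivative x) (at t)"
      by (auto intro!: derivative_eq_intros simp: has_real_derivative_iff_has_vector_derivative[symmetric])
    from vector_diff_chain_at[OF this fresnel_deriv[OF t(2)]]
    show "(fresnel \<circ> (\<lambda>t. x * t) has_vector_derivative x *\<^sub>R cis ((x * t)\<^sup>2)) (at t)" .
  qed (use assms in auto)
  then show ?thesis by (simp add: fresnel_def)
qed (simp add: fresnel_def)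

text \<open>The derivatives of both terms of \<open>fresnel x ^ 2 + \<i> * fresnel_aux x\<close> cancel; this is the classical
  trick for the Gaussian integral, carried over to the imaginary axis.\<close>

lemma fresnel_sq:
  assumes "b \<ge> 0"
  shows "(fresnel b)\<^sup>2 = \<i> * (of_real (pi / 4) - fresnel_aux b)"
proof -
  define G where "G x = (fresnel x)\<^sup>2 + \<i> * fresnel_aux x" for x
  have G: "(G has_vector_derivative 0) (at x within {0..b})" if x: "x \<in> {0..b}" for x
  proof -
    have "((\<lambda>x. integral (cbox 0 1) (\<lambda>t. (1 / (1 + t\<^sup>2)) *\<^sub>R cis (x\<^sup>2 * (1 + t\<^sup>2)))) has_vector_derivative
       integral (cbox 0 1) (\<lambda>t. (2 * x) *\<^sub>R (\<i> * cis (x\<^sup>2 * (1 + t\<^sup>2))))) (at x within {0..b})"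
    proof (rule leibniz_rule_vector_derivative[where fx="\<lambda>x t. (2 * x) *\<^sub>R (\<i> * cis (x\<^sup>2 * (1 + t\<^sup>2)))"])
      fix x t :: real
      note nz = one_plus_square_pos[of t, THEN less_imp_neq, symmetric]
      have "((\<lambda>x. x\<^sup>2 * (1 + t\<^sup>2)) has_real_derivative 2 * x * (1 + t\<^sup>2)) (at x)"
        by (auto intro!: derivative_eq_intros)
      from has_vector_derivative_scaleR[OF DERIV_const[of "1 / (1 + t\<^sup>2)"] cis_has_vector_derivative[OF this]]
      have "((\<lambda>x. (1 / (1 + t\<^sup>2)) *\<^sub>R cis (x\<^sup>2 * (1 + t\<^sup>2))) has_vector_derivative
        (2 * x) *\<^sub>R (\<i> * cis (x\<^sup>2 * (1 + t\<^sup>2)))) (at x)"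
        using nz by simp
      then show "((\<lambda>x. (1 / (1 + t\<^sup>2)) *\<^sub>R cis (x\<^sup>2 * (1 + t\<^sup>2))) has_vector_derivative
        (2 * x) *\<^sub>R (\<i> * cis (x\<^sup>2 * (1 + t\<^sup>2)))) (at x within {0..b})"
        by (rule has_vector_derivative_at_within)
      have "continuous_on {0..1} (\<lambda>t. (1 / (1 + t\<^sup>2)) *\<^sub>R cis (x\<^sup>2 * (1 + t\<^sup>2)))"
        by (intro continuous_intros) (use one_plus_square_pos in \<open>metis less_irrefl\<close>)
      then show "(\<lambda>t. (1 / (1 + t\<^sup>2)) *\<^sub>R cis (x\<^sup>2 * (1 + t\<^sup>2))) integrable_on cbox 0 1"
        by (simp add: integrable_continuous_real)
    next
      show "continuous_on ({0..b} \<times> cbox 0 1) (\<lambda>(x, t). (2 * x) *\<^sub>R (\<i> * cis (x\<^sup>2 * (1 + t\<^sup>2))))"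
        unfolding split_beta by (intro continuous_intros)
    qed (use x in auto)
    \<comment> \<open>Differentiation in x produces a factor 1 + t^2, which cancels the denominator;
      what remains is cis(x^2) times a rescaled Fresnel integral.\<close>
    moreover have "((\<lambda>t. (2 * (\<i> * cis (x\<^sup>2))) * (x *\<^sub>R cis ((x * t)\<^sup>2))) has_integral
        (2 * (\<i> * cis (x\<^sup>2))) * fresnel (x * 1)) {0..1}"
      by (rule has_integral_mult_right[OF fresnel_scale]) (use x in auto)
    then have "((\<lambda>t. (2 * x) *\<^sub>R (\<i> * cis (x\<^sup>2 * (1 + t\<^sup>2)))) has_integral
        2 * (\<i> * cis (x\<^sup>2)) * fresnel x) {0..1}"
      by (rule has_integral_eq[rotated, THEN back_subst[where P="\<lambda>c. (_ has_integral c) _"]])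
         (simp_all add: scaleR_conv_of_real ring_distribs power_mult_distrib flip: cis_mult)
    then have "integral {0..1} (\<lambda>t. (2 * x) *\<^sub>R (\<i> * cis (x\<^sup>2 * (1 + t\<^sup>2)))) = 2 * (\<i> * cis (x\<^sup>2)) * fresnel x"
      by (rule integral_unique)
    ultimately have "(fresnel_aux has_vector_derivative 2 * (\<i> * cis (x\<^sup>2)) * fresnel x) (at x within {0..b})"
      unfolding fresnel_aux_def[abs_def] box_real by metis
    then have 1: "((\<lambda>x. \<i> * fresnel_aux x) has_vector_derivative \<i> * (2 * (\<i> * cis (x\<^sup>2)) * fresnel x)) (at x within {0..b})"
      by (rule has_vector_derivative_mult_right)
    have F: "(fresnel has_vector_derivative cis (x\<^sup>2)) (at x within {0..b})"
      by (rule fresnel_deriv_within) (use x in auto)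
    from has_vector_derivative_add[OF has_vector_derivative_mult[OF F F] 1]
    show ?thesis unfolding G_def power2_eq_square[of "fresnel _"]
      by (rule back_subst[where P="\<lambda>x. (_ has_vector_derivative x) _"]) (simp add: algebra_simps)
  qed
  from has_vector_derivative_zero_constant[OF convex_closed_interval(1)[of 0 b] G]
  have "G b = G 0" using assms by (metis (no_types, lifting) atLeastAtMost_iff order_refl)
  moreover have "((\<lambda>t. 1 / (1 + t\<^sup>2)) has_integral arctan 1 - arctan 0) {0..1::real}"
    by (rule FTC_piecewise[where S="{}"])
       (auto intro!: derivative_eq_intros continuous_intros simp: field_simps)
  then have "((\<lambda>t. (1 / (1 + t\<^sup>2)) *\<^sub>R (1::complex)) has_integral (pi / 4) *\<^sub>R 1) {0..1::real}"
    by (intro has_integral_scaleR_left) (simp add: arctan_one)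
  then have "fresnel_aux 0 = of_real (pi / 4)"
    by (simp add: fresnel_aux_def integral_unique scaleR_conv_of_real)
  ultimately show ?thesis by (simp add: G_def fresnel_def algebra_simps)
qed

text \<open>The phase is stationary at t = 0, so its derivative cannot be divided out. Instead
  \<open>fresnel (y * t) / y\<close>, bounded by 2 / y, serves as antiderivative of the oscillating
  factor, once the constant phase cis(y^2) is split off. The bound is 5 = 1 + 4: the boundary term
  and the variation of 1 / (1 + t^2).\<close>

lemma fresnel_aux_bound:
  assumes y: "y > 0"
  shows "norm (fresnel_aux y) \<le> 5 / y"
proof -
  define h h' where "h t = 1 / (1 + t\<^sup>2)" and "h' t = - (2 * t) / (1 + t\<^sup>2)\<^sup>2" for t :: real
  note nz = one_plus_square_pos
  define K where "K t = (h t / y) *\<^sub>R fresnel (y * t)" for t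
  have Ec: "continuous_on {0..1} (\<lambda>t. fresnel (y * t))"
    by (rule continuous_on_compose2[OF fresnel_continuous[of y]])
       (use y in \<open>auto intro!: continuous_intros mult_left_le\<close>)
  have hc: "continuous_on {0..1} h" "continuous_on {0..1} h'" unfolding h_def h'_def
    by (intro continuous_intros; use nz in \<open>auto simp: less_imp_neq[symmetric]\<close>)+
  have "((\<lambda>t. h t *\<^sub>R cis ((y * t)\<^sup>2) + (h' t / y) *\<^sub>R fresnel (y * t)) has_integral K 1 - K 0) {0..1}"
  proof (rule fundamental_theorem_of_calculus_interior)
    show "continuous_on {0..1} K" unfolding K_def
      by (intro continuous_intros Ec hc) (use y in auto)
    fix t :: real assume "t \<in> {0<..<1}"
    then have t: "0 < y * t" using y by auto
    have "((\<lambda>t. y * t) has_vector_derivative y) (at t)"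
      by (auto intro!: derivative_eq_intros simp: has_real_derivative_iff_has_vector_derivative[symmetric])
    from vector_diff_chain_at[OF this fresnel_deriv[OF t]]
    have 1: "((\<lambda>t. fresnel (y * t)) has_vector_derivative y *\<^sub>R cis ((y * t)\<^sup>2)) (at t)"
      by (simp add: o_def)
    have nzt: "1 + t\<^sup>2 \<noteq> 0" using nz[of t] by simp
    have "((\<lambda>t. 1 + t\<^sup>2) has_real_derivative 2 * t) (at t)" by (auto intro!: derivative_eq_intros)
    from DERIV_divide[OF DERIV_const[of 1] this nzt]
    have "(h has_real_derivative h' t) (at t)" unfolding h_def h'_def
      by (rule DERIV_cong) (simp add: power2_eq_square)
    from DERIV_cdivide[OF this, of y]
    have 2: "((\<lambda>t. h t / y) has_real_derivative h' t / y) (at t)" .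
    from has_vector_derivative_scaleR[OF 2 1]
    show "(K has_vector_derivative h t *\<^sub>R cis ((y * t)\<^sup>2) + (h' t / y) *\<^sub>R fresnel (y * t)) (at t)"
      unfolding K_def using y by simp
  qed auto
  moreover have i2: "(\<lambda>t. (h' t / y) *\<^sub>R fresnel (y * t)) integrable_on {0..1}"
    by (intro integrable_continuous_real continuous_intros Ec hc) (use y in auto)
  ultimately have "((\<lambda>t. h t *\<^sub>R cis ((y * t)\<^sup>2)) has_integral
      K 1 - K 0 - integral {0..1} (\<lambda>t. (h' t / y) *\<^sub>R fresnel (y * t))) {0..1}"
    using has_integral_diff[OF _ integrable_integral[OF i2]] by fastforce
  then have "((\<lambda>t. cis (y\<^sup>2) * (h t *\<^sub>R cis ((y * t)\<^sup>2))) has_integral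
      cis (y\<^sup>2) * (K 1 - K 0 - integral {0..1} (\<lambda>t. (h' t / y) *\<^sub>R fresnel (y * t)))) {0..1}"
    by (rule has_integral_mult_right)
  then have "((\<lambda>t. (1 / (1 + t\<^sup>2)) *\<^sub>R cis (y\<^sup>2 * (1 + t\<^sup>2))) has_integral
      cis (y\<^sup>2) * (K 1 - K 0 - integral {0..1} (\<lambda>t. (h' t / y) *\<^sub>R fresnel (y * t)))) {0..1}"
    by (rule has_integral_eq[rotated]) (simp add: h_def ring_distribs power_mult_distrib flip: cis_mult)
  then have "fresnel_aux y = cis (y\<^sup>2) * (K 1 - K 0 - integral {0..1} (\<lambda>t. (h' t / y) *\<^sub>R fresnel (y * t)))"
    unfolding fresnel_aux_def by (rule integral_unique)
  then have "norm (fresnel_aux y) = norm (K 1 - K 0 - integral {0..1} (\<lambda>t. (h' t / y) *\<^sub>R fresnel (y * t)))"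
    by (simp add: norm_mult)
  also have "\<dots> \<le> norm (K 1) + norm (K 0) + norm (integral {0..1} (\<lambda>t. (h' t / y) *\<^sub>R fresnel (y * t)))"
    by (meson add_mono norm_triangle_ineq4 order_refl order_trans)
  also have "norm (K 1) \<le> 1 / y"
    using fresnel_bound[of y] y by (simp add: K_def h_def field_simps)
  also have "norm (K 0) = 0" by (simp add: K_def fresnel_def)
  also have "norm (integral {0..1} (\<lambda>t. (h' t / y) *\<^sub>R fresnel (y * t))) \<le> integral {0..1} (\<lambda>t::real. 4 / y)"
  proof (rule integral_norm_bound_integral[OF i2])
    fix t :: real assume t: "t \<in> {0..1}"
    have "\<bar>h' t\<bar> \<le> 2"
    proof -
      have "\<bar>h' t\<bar> = 2 * t / (1 + t\<^sup>2)\<^sup>2" using t nz[of t] by (simp add: h'_def)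
      also have "\<dots> \<le> 2 / 1" by (rule frac_le) (use t in \<open>auto intro: one_le_power\<close>)
      finally show ?thesis by simp
    qed
    then have "(\<bar>h' t\<bar> / y) * norm (fresnel (y * t)) \<le> (2 / y) * 2"
      using y t fresnel_bound[of "y * t"] by (intro mult_mono divide_right_mono) auto
    then show "norm ((h' t / y) *\<^sub>R fresnel (y * t)) \<le> 4 / y" using y by simp
  qed auto
  finally show ?thesis using y by simp
qed

definition fresnel_lim :: complex where
  "fresnel_lim = of_real (sqrt (pi / 8)) * (1 + \<i>)"

text \<open>\<open>fresnel_sq\<close> determines the limit only up to sign. The sign is decided by a
  numerical lower bound for the real part at one suitable point.\<close>

lemma fresnel_tendsto: "(\<lambda>n. fresnel (real n)) \<longlonglongrightarrow> fresnel_lim"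
proof -
  have "Cauchy (\<lambda>n. fresnel (real n))"
  proof (rule CauchyI)
    fix e :: real assume e: "e > 0"
    define N where "N = nat \<lceil>1 / e\<rceil> + 1"
    have "1 / e < real N" "0 < real N" unfolding N_def by linarith+
    then have N: "real N > 1 / e" "real N > 0" by auto
    have *: "norm (fresnel (real n) - fresnel (real m)) < e" if "N \<le> m" "m \<le> n" for m n
    proof -
      have "norm (fresnel (real n) - fresnel (real m)) \<le> 1 / real m"
        using that N by (intro fresnel_diff_bound) auto
      also have "\<dots> \<le> 1 / real N" using that N by (intro divide_left_mono) auto
      also have "\<dots> < e" using N e by (simp add: field_simps)
      finally show ?thesis .
    qed
    have "norm (fresnel (real m) - fresnel (real n)) < e" if "N \<le> m" "N \<le> n" for m n
      using *[of m n] *[of n m] that by (metis nle_le norm_minus_commute)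
    then show "\<exists>M. \<forall>m\<ge>M. \<forall>n\<ge>M. norm (fresnel (real m) - fresnel (real n)) < e" by blast
  qed
  then obtain L where L: "(\<lambda>n. fresnel (real n)) \<longlonglongrightarrow> L"
    using Cauchy_convergent_iff convergent_def by blast
  have "(\<lambda>n. 5 / real n) \<longlonglongrightarrow> 0" by (rule lim_const_over_n)
  then have "(\<lambda>n. fresnel_aux (real n)) \<longlonglongrightarrow> 0"
    by (rule Lim_null_comparison[rotated])
       (use fresnel_aux_bound in \<open>auto simp: eventually_sequentially intro!: exI[of _ 1]\<close>)
  then have "(\<lambda>n. \<i> * (of_real (pi / 4) - fresnel_aux (real n))) \<longlonglongrightarrow> \<i> * (of_real (pi / 4) - 0)"
    by (intro tendsto_intros)
  moreover have "(\<lambda>n. (fresnel (real n))\<^sup>2) \<longlonglongrightarrow> L\<^sup>2" by (intro tendsto_intros L)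
  ultimately have "L\<^sup>2 = \<i> * of_real (pi / 4)"
    using LIMSEQ_unique by (fastforce simp: fresnel_sq)
  moreover have "fresnel_lim\<^sup>2 = \<i> * of_real (pi / 4)"
  proof -
    have "(complex_of_real (sqrt (pi / 8)))\<^sup>2 = of_real (pi / 8)"
      by (simp flip: of_real_power)
    then show ?thesis by (simp add: fresnel_lim_def power_mult_distrib) (simp add: power2_eq_square algebra_simps)
  qed
  ultimately have "L\<^sup>2 = fresnel_lim\<^sup>2" by (simp only:)
  then have "L = fresnel_lim \<or> L = - fresnel_lim" by (simp only: power2_eq_iff)
  moreover have "Re L > 0"
  proof -
    \<comment> \<open>At this point the cosine integral already exceeds its possible later variation \<open>1 / y\<close>.\<close>
    define y where "y = sqrt (3/2)"
    have y: "y\<^sup>2 = 3/2" "y > 0" by (auto simp: y_def)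
    have y1: "1 \<le> y" unfolding y_def by simp
    have y2: "1 / y < 9/10"
    proof -
      have "(10/9)\<^sup>2 < (3/2::real)" by (simp add: power2_eq_square)
      then have "(10/9)\<^sup>2 < y\<^sup>2" by (simp only: y)
      then have "10/9 < y" by (rule power2_less_imp_less) (use y in simp)
      then have "1 / y < 1 / (10/9)" by (intro divide_strict_left_mono) auto
      then show ?thesis by simp
    qed
    have Re: "Re (integral {a..b} (\<lambda>u. cis (u\<^sup>2))) = integral {a..b} (\<lambda>u::real. cos (u\<^sup>2))" for a b
      using integral_linear[OF cis_sq_integrable bounded_linear_Re, of a b] by (simp add: o_def)
    have ci: "(\<lambda>u::real. cos (u\<^sup>2)) integrable_on {a..b}" for a b
      by (intro integrable_continuous_real continuous_intros)
    \<comment> \<open>The minorant 1 - u^4 / 2 of cos(u^2) has integral 9/10 over [0, 1], which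
      exceeds 1 / y. Between 1 and y the cosine is nonnegative, since y^2 = 3/2 is below pi /
      2.\<close>
    have "((\<lambda>u::real. 1 - u^4 / 2) has_integral (1 - 1^5 / 10) - (0 - 0^5 / 10)) {0..1}"
      by (rule FTC_piecewise[where S="{}"]) (auto intro!: derivative_eq_intros continuous_intros)
    then have p: "((\<lambda>u::real. 1 - u^4 / 2) has_integral 9/10) {0..1}" by simp
    have "9/10 \<le> integral {0..1} (\<lambda>u::real. cos (u\<^sup>2))"
    proof (rule has_integral_le[OF p integrable_integral[OF ci]])
      fix u :: real
      have "cos (u\<^sup>2) = 1 - 2 * (sin (u\<^sup>2 / 2))\<^sup>2" using cos_double_sin[of "u\<^sup>2 / 2"] by simp
      moreover have "(sin (u\<^sup>2 / 2))\<^sup>2 \<le> (u\<^sup>2 / 2)\<^sup>2"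
        by (simp only: abs_sin_x_le_abs_x flip: abs_le_square_iff)
      moreover have "(u\<^sup>2 / 2)\<^sup>2 = u^4 / 4" by (simp add: power_divide flip: power_mult)
      ultimately show "1 - u^4 / 2 \<le> cos (u\<^sup>2)" by simp
    qed
    moreover have "0 \<le> integral {1..y} (\<lambda>u::real. cos (u\<^sup>2))"
    proof (rule integral_nonneg[OF ci])
      fix u assume u: "u \<in> {1..y}"
      then have "u\<^sup>2 \<le> y\<^sup>2" by (intro power_mono) auto
      then have "u\<^sup>2 \<le> pi / 2" using y pi_gt3 by simp
      then show "0 \<le> cos (u\<^sup>2)" by (intro cos_ge_zero) (use zero_le_power2[of u] pi_gt3 in linarith)+
    qed
    ultimately have "9/10 \<le> Re (fresnel y)"
      using Henstock_Kurzweil_Integration.integral_combine[OF _ y1 ci, of 0] by (simp add: fresnel_def Re)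
    moreover have "norm (L - fresnel y) \<le> 1 / y"
    proof (rule tendsto_upperbound)
      show "(\<lambda>n. norm (fresnel (real n) - fresnel y)) \<longlonglongrightarrow> norm (L - fresnel y)"
        by (intro tendsto_intros L)
      have "\<forall>\<^sub>F n in sequentially. nat \<lceil>y\<rceil> \<le> n" by (rule eventually_ge_at_top)
      then show "\<forall>\<^sub>F n in sequentially. norm (fresnel (real n) - fresnel y) \<le> 1 / y"
        by eventually_elim (use y in \<open>auto intro!: fresnel_diff_bound simp: nat_le_iff ceiling_le_iff\<close>)
    qed simp
    then have "\<bar>Re (L - fresnel y)\<bar> \<le> 1 / y" using abs_Re_le_cmod order_trans by blast
    ultimately show ?thesis using y2 by simp
  qed
  moreover have "Re (- fresnel_lim) \<le> 0" by (simp add: fresnel_lim_def)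
  ultimately have "L = fresnel_lim" by auto
  with L show ?thesis by simp
qed

lemma fresnel_asymptotic:
  assumes y: "y > 0"
  shows "norm (fresnel y - fresnel_lim) \<le> 1 / y"
proof -
  have "norm (fresnel_lim - fresnel y) \<le> 1 / y"
  proof (rule tendsto_upperbound)
    show "(\<lambda>n. norm (fresnel (real n) - fresnel y)) \<longlonglongrightarrow> norm (fresnel_lim - fresnel y)"
      by (intro tendsto_intros fresnel_tendsto)
    have "\<forall>\<^sub>F n in sequentially. nat \<lceil>y\<rceil> \<le> n" by (rule eventually_ge_at_top)
    then show "\<forall>\<^sub>F n in sequentially. norm (fresnel (real n) - fresnel y) \<le> 1 / y"
      by eventually_elim (use y in \<open>auto intro!: fresnel_diff_bound simp: nat_le_iff ceiling_le_iff\<close>)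
  qed simp
  then show ?thesis by (simp add: norm_minus_commute)
qed

section \<open>Integrals with phases l sinh t and l cosh t\<close>

lemma cosh_double_sinh: "cosh (2 * x) = 1 + 2 * (sinh x)\<^sup>2" for x :: real
  by (simp add: cosh_double cosh_square_eq)

lemma arctan_diff_le_pi: "arctan u - arctan v \<le> pi"
  using arctan_bounded[of u] arctan_bounded[of v] by linarith

text \<open>The phase has no stationary point, as its derivative \<open>l * cosh t\<close> is at
  least l. The variation of 1 / (l cosh t) is dominated by the integral of 1 / (l cosh t), and the
  antiderivative arctan(sinh t) makes this at most pi / l on any interval, however long. The
  constant is 1 + 1 + 4.\<close>

lemma sinh_oscillatory:
  assumes ab: "a \<le> b" and l: "l > 0"
  shows "norm (integral {a..b} (\<lambda>t. cis (l * sinh t))) \<le> 6 / l"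
proof -
  have c: "cosh t > 0" "cosh t \<noteq> 0" "cosh t \<ge> 1" for t :: real
    using cosh_real_pos[of t] cosh_real_ge_1[of t] by auto
  have "norm (integral {a..b} (\<lambda>t. ((l * cosh t) * (1 / (l * cosh t))) *\<^sub>R cis (l * sinh t)))
     \<le> \<bar>1 / (l * cosh a)\<bar> + \<bar>1 / (l * cosh b)\<bar> + (1 / l * arctan (sinh b) - 1 / l * arctan (sinh a))"
  proof (rule oscillatory_by_parts[OF ab, where q'="\<lambda>t. - (sinh t / (l * (cosh t)\<^sup>2))" and v="\<lambda>t. 1 / l * (1 / cosh t)"])
    fix t :: real
    show "((\<lambda>t. l * sinh t) has_real_derivative l * cosh t) (at t)"
      by (auto intro!: derivative_eq_intros)
    have "((\<lambda>t. inverse (l * cosh t)) has_real_derivative - ((l * sinh t) * inverse ((l * cosh t)\<^sup>2))) (at t)"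
      using l c by (intro DERIV_inverse_fun[THEN DERIV_cong]) (auto intro!: derivative_eq_intros simp: power2_eq_square)
    then show "((\<lambda>t. 1 / (l * cosh t)) has_real_derivative - (sinh t / (l * (cosh t)\<^sup>2))) (at t)"
      using l c by (simp add: inverse_eq_divide power_mult_distrib power2_eq_square mult_ac)
    have "\<bar>sinh t\<bar> \<le> cosh t" by (rule sinh_le_cosh_real[THEN abs_leI]) (use sinh_le_cosh_real[of "-t"] in auto)
    then have "\<bar>sinh t\<bar> / (l * (cosh t)\<^sup>2) \<le> cosh t / (l * (cosh t)\<^sup>2)"
      using l c by (intro divide_right_mono) auto
    also have "\<dots> = 1 / l * (1 / cosh t)" using c by (simp add: power2_eq_square)
    finally show "\<bar>- (sinh t / (l * (cosh t)\<^sup>2))\<bar> \<le> 1 / l * (1 / cosh t)" using l by (simp add: abs_mult)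
  next
    show "((\<lambda>t. 1 / l * (1 / cosh t)) has_integral 1 / l * arctan (sinh b) - 1 / l * arctan (sinh a)) {a..b}"
    proof (rule FTC_piecewise[where S="{}"])
      fix t :: real
      have "((\<lambda>t. arctan (sinh t)) has_real_derivative inverse (1 + (sinh t)\<^sup>2) * cosh t) (at t)"
        by (rule DERIV_chain2[OF DERIV_arctan]) (auto intro!: derivative_eq_intros)
      moreover have "1 + (sinh t)\<^sup>2 = (cosh t)\<^sup>2" by (simp add: sinh_square_eq)
      ultimately have "((\<lambda>t. arctan (sinh t)) has_real_derivative 1 / cosh t) (at t)"
        using c by (simp add: power2_eq_square inverse_eq_divide)
      then show "((\<lambda>t. 1 / l * arctan (sinh t)) has_real_derivative 1 / l * (1 / cosh t)) (at t)"
        by (rule DERIV_cmult)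
    qed (use ab l in \<open>auto intro!: continuous_intros\<close>)
  next
    show "continuous_on {a..b} (\<lambda>t. - (sinh t / (l * (cosh t)\<^sup>2)))"
      by (intro continuous_intros) (use l c in auto)
  qed
  also have "integral {a..b} (\<lambda>t. ((l * cosh t) * (1 / (l * cosh t))) *\<^sub>R cis (l * sinh t)) =
     integral {a..b} (\<lambda>t. cis (l * sinh t))"
    by (rule integral_cong) (use l c in simp)
  also have "\<bar>1 / (l * cosh a)\<bar> \<le> 1 / (l * 1)"
    using l c by (auto simp: abs_mult intro!: divide_left_mono mult_left_mono)
  also have "\<bar>1 / (l * cosh b)\<bar> \<le> 1 / (l * 1)"
    using l c by (auto simp: abs_mult intro!: divide_left_mono mult_left_mono)
  also have "1 / l * arctan (sinh b) - 1 / l * arctan (sinh a) \<le> 1 / l * 4"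
    unfolding right_diff_distrib[symmetric]
    using l arctan_diff_le_pi[of "sinh b" "sinh a"] pi_less_4 by (intro mult_left_mono) auto
  finally show ?thesis by simp
qed

text \<open>Replacing the amplitude \<open>1\<close> by \<open>cosh (t / 2)\<close> turns the substitution
  \<open>w = sqrt (2 * l) * sinh (t / 2)\<close> into an exact reduction to the Fresnel integral; the difference
  vanishes at the stationary point \<open>t = 0\<close>.\<close>

lemma cosh_oscillatory_diff:
  assumes b: "0 \<le> b" and l: "l > 0"
  shows "norm (integral {0..b} (\<lambda>t. (1 - cosh (t / 2)) *\<^sub>R cis (l * cosh t))) \<le> 5 / l"
proof -
  have c: "cosh t > 0" "cosh t \<noteq> 0" "cosh t \<ge> 1" for t :: real
    using cosh_real_pos[of t] cosh_real_ge_1[of t] by auto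
  \<comment> \<open>For t different from 0 this is (1 - cosh(t/2)) / (l sinh t): the double argument
    formulas remove the common zero at t = 0.\<close>
  define q where "q t = - tanh (t / 4) / (2 * l * cosh (t / 2))" for t
  define q' where "q' t = - ((1 - (tanh (t / 4))\<^sup>2) / 4 * cosh (t / 2) - tanh (t / 4) * (sinh (t / 2) / 2))
     / (2 * l * (cosh (t / 2))\<^sup>2)" for t
  have q0: "\<bar>q t\<bar> \<le> 1 / (2 * l)" for t
  proof -
    have "\<bar>q t\<bar> = \<bar>tanh (t / 4)\<bar> / (2 * l * cosh (t / 2))" using l c[of "t / 2"] by (simp add: q_def abs_mult)
    also have "\<dots> \<le> 1 / (2 * l * 1)"
      using l c[of "t/2"] tanh_real_bounds[of "t / 4"] by (intro frac_le mult_left_mono) auto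
    finally show ?thesis by simp
  qed
  have "norm (integral {0..b} (\<lambda>t. ((l * sinh t) * q t) *\<^sub>R cis (l * cosh t)))
     \<le> \<bar>q 0\<bar> + \<bar>q b\<bar> + (2 / l * arctan (sinh (b / 2)) - 2 / l * arctan (sinh (0 / 2)))"
  proof (rule oscillatory_by_parts[OF b, where q'=q' and v="\<lambda>t. 1 / l * (1 / cosh (t / 2))"])
    fix t :: real
    show "((\<lambda>t. l * cosh t) has_real_derivative l * sinh t) (at t)"
      by (auto intro!: derivative_eq_intros)
    have 1: "((\<lambda>t. tanh (t / 4)) has_real_derivative (1 - (tanh (t / 4))\<^sup>2) * (1 / 4)) (at t)"
      using c by (auto intro!: derivative_eq_intros)
    have 2: "((\<lambda>t. cosh (t / 2)) has_real_derivative sinh (t / 2) * (1 / 2)) (at t)"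
      by (auto intro!: derivative_eq_intros)
    have "((\<lambda>t. - (1 / (2 * l)) * (tanh (t / 4) / cosh (t / 2))) has_real_derivative - (1 / (2 * l)) *
       (((1 - (tanh (t / 4))\<^sup>2) * (1 / 4) * cosh (t / 2) - tanh (t / 4) * (sinh (t / 2) * (1 / 2))) /
         (cosh (t / 2) * cosh (t / 2)))) (at t)"
      by (intro DERIV_cmult DERIV_divide 1 2 c)
    moreover have "(\<lambda>t. - (1 / (2 * l)) * (tanh (t / 4) / cosh (t / 2))) = q" by (auto simp: q_def)
    moreover have "- (1 / (2 * l)) *
       (((1 - (tanh (t / 4))\<^sup>2) * (1 / 4) * cosh (t / 2) - tanh (t / 4) * (sinh (t / 2) * (1 / 2))) /
         (cosh (t / 2) * cosh (t / 2))) = q' t"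
    proof -
      have "- (1 / (2 * l)) * (n / (c * c)) = - n / (2 * l * c\<^sup>2)" for n c :: real
        by (simp add: power2_eq_square)
      then show ?thesis by (simp only: q'_def times_divide_eq_right mult_1_right)
    qed
    ultimately show "(q has_real_derivative q' t) (at t)" by simp
    have s: "\<bar>sinh (t / 2)\<bar> \<le> cosh (t / 2)"
      by (rule sinh_le_cosh_real[THEN abs_leI]) (use sinh_le_cosh_real[of "-(t/2)"] in auto)
    have th: "\<bar>tanh (t / 4)\<bar> \<le> 1" using tanh_real_bounds[of "t / 4"] by auto
    then have th2: "0 \<le> (tanh (t / 4))\<^sup>2" "(tanh (t / 4))\<^sup>2 \<le> 1" by (auto simp: abs_square_le_1)
    have "\<bar>(1 - (tanh (t / 4))\<^sup>2) / 4 * cosh (t / 2)\<bar> \<le> 1 / 4 * cosh (t / 2)"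
      unfolding abs_mult using th2 c[of "t/2"] by (intro mult_mono) auto
    moreover have "\<bar>tanh (t / 4) * (sinh (t / 2) / 2)\<bar> \<le> 1 * (cosh (t / 2) / 2)"
      unfolding abs_mult using th s by (intro mult_mono) auto
    ultimately have "\<bar>- ((1 - (tanh (t / 4))\<^sup>2) / 4 * cosh (t / 2) - tanh (t / 4) * (sinh (t / 2) / 2))\<bar> \<le> 2 * cosh (t / 2)"
      using c(1)[of "t/2"] by linarith
    moreover have "\<bar>2 * l * (cosh (t / 2))\<^sup>2\<bar> = 2 * l * (cosh (t / 2))\<^sup>2" using l by simp
    ultimately have "\<bar>q' t\<bar> \<le> 2 * cosh (t / 2) / (2 * l * (cosh (t / 2))\<^sup>2)"
      unfolding q'_def abs_divide using l by (simp only:) (rule divide_right_mono; simp)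
    also have "\<dots> = 1 / l * (1 / cosh (t / 2))" using c[of "t / 2"] by (simp add: power2_eq_square)
    finally show "\<bar>q' t\<bar> \<le> 1 / l * (1 / cosh (t / 2))" .
  next
    show "continuous_on {0..b} q'" unfolding q'_def
      by (intro continuous_intros) (use l c in auto)
    show "((\<lambda>t. 1 / l * (1 / cosh (t / 2))) has_integral 2 / l * arctan (sinh (b / 2)) - 2 / l * arctan (sinh (0 / 2))) {0..b}"
    proof (rule FTC_piecewise[where S="{}"])
      fix t :: real
      have "((\<lambda>t. arctan (sinh (t / 2))) has_real_derivative inverse (1 + (sinh (t / 2))\<^sup>2) * (cosh (t / 2) * (1 / 2))) (at t)"
        by (rule DERIV_chain2[OF DERIV_arctan]) (auto intro!: derivative_eq_intros)
      moreover have "1 + (sinh (t / 2))\<^sup>2 = (cosh (t / 2))\<^sup>2" by (simp add: sinh_square_eq)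
      ultimately have "((\<lambda>t. arctan (sinh (t / 2))) has_real_derivative (1 / 2) * (1 / cosh (t / 2))) (at t)"
        using c[of "t / 2"] by (simp only:) (simp add: power2_eq_square inverse_eq_divide mult_ac)
      from DERIV_cmult[OF this, of "2 / l"]
      show "((\<lambda>t. 2 / l * arctan (sinh (t / 2))) has_real_derivative 1 / l * (1 / cosh (t / 2))) (at t)" by simp
    qed (use b l in \<open>auto intro!: continuous_intros\<close>)
  qed
  also have "integral {0..b} (\<lambda>t. ((l * sinh t) * q t) *\<^sub>R cis (l * cosh t)) =
     integral {0..b} (\<lambda>t. (1 - cosh (t / 2)) *\<^sub>R cis (l * cosh t))"
  proof (rule integral_cong)
    fix t :: real
    have "sinh t = 2 * sinh (t / 2) * cosh (t / 2)" using sinh_double[of "t / 2"] by simp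
    then have "(l * sinh t) * q t = - (tanh (t / 4) * sinh (t / 2))"
      using l c[of "t / 2"] by (simp add: q_def)
    also have "sinh (t / 2) = 2 * sinh (t / 4) * cosh (t / 4)" using sinh_double[of "t / 4"] by simp
    also have "- (tanh (t / 4) * (2 * sinh (t / 4) * cosh (t / 4))) = - 2 * (sinh (t / 4))\<^sup>2"
      using c[of "t / 4"] by (simp add: tanh_def power2_eq_square)
    also have "\<dots> = 1 - cosh (t / 2)" using cosh_double_sinh[of "t / 4"] by simp
    finally show "((l * sinh t) * q t) *\<^sub>R cis (l * cosh t) = (1 - cosh (t / 2)) *\<^sub>R cis (l * cosh t)" by simp
  qed
  also have "\<bar>q 0\<bar> = 0" by (simp add: q_def)
  also have "2 / l * arctan (sinh (b / 2)) - 2 / l * arctan (sinh (0 / 2)) \<le> 2 / l * 2"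
    unfolding right_diff_distrib[symmetric]
    using l arctan_bounded[of "sinh (b / 2)"] pi_less_4 by (intro mult_left_mono) auto
  also note q0[of b]
  finally show ?thesis using l by (simp add: field_simps)
qed

lemma cosh_oscillatory_fresnel:
  assumes b: "0 \<le> b" and l: "l > 0"
  shows "((\<lambda>t. cosh (t / 2) *\<^sub>R cis (l * cosh t)) has_integral
     (2 / sqrt (2 * l)) *\<^sub>R (cis l * fresnel (sqrt (2 * l) * sinh (b / 2)))) {0..b}"
proof -
  define w where "w t = sqrt (2 * l) * sinh (t / 2)" for t
  define K where "K t = (2 / sqrt (2 * l)) *\<^sub>R (cis l * fresnel (w t))" for t
  have s: "sqrt (2 * l) > 0" using l by simp
  have w2: "(w t)\<^sup>2 = l * cosh t - l" for t
  proof -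
    have "(w t)\<^sup>2 = 2 * l * (sinh (t / 2))\<^sup>2" using l by (simp add: w_def power_mult_distrib)
    also have "\<dots> = l * cosh t - l" using cosh_double_sinh[of "t / 2"] by (simp add: algebra_simps)
    finally show ?thesis .
  qed
  have "((\<lambda>t. cosh (t / 2) *\<^sub>R cis (l * cosh t)) has_integral K b - K 0) {0..b}"
  proof (rule fundamental_theorem_of_calculus_interior[OF b])
    show "continuous_on {0..b} K" unfolding K_def w_def
      by (intro continuous_intros continuous_on_compose2[OF fresnel_continuous[of "sqrt (2 * l) * sinh (b / 2)"]])
         (use s in \<open>auto intro!: mult_left_mono\<close>)
    fix t assume "t \<in> {0<..<b}"
    then have t: "w t > 0" using s by (simp add: w_def)
    have "(w has_real_derivative sqrt (2 * l) * (cosh (t / 2) * (1 / 2))) (at t)"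
      unfolding w_def by (auto intro!: derivative_eq_intros)
    then have "(w has_vector_derivative sqrt (2 * l) * (cosh (t / 2) * (1 / 2))) (at t)"
      by (simp add: has_real_derivative_iff_has_vector_derivative)
    from vector_diff_chain_at[OF this fresnel_deriv[OF t]]
    have "((\<lambda>t. fresnel (w t)) has_vector_derivative (sqrt (2 * l) * (cosh (t / 2) * (1 / 2))) *\<^sub>R cis ((w t)\<^sup>2)) (at t)"
      by (simp add: o_def)
    from has_vector_derivative_mult_right[OF this, of "cis l"]
    have "((\<lambda>t. cis l * fresnel (w t)) has_vector_derivative
        cis l * ((sqrt (2 * l) * (cosh (t / 2) * (1 / 2))) *\<^sub>R cis ((w t)\<^sup>2))) (at t)" .
    from has_vector_derivative_scaleR[OF DERIV_const[of "2 / sqrt (2 * l)"] this]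
    have "(K has_vector_derivative (2 / sqrt (2 * l)) *\<^sub>R
        (cis l * ((sqrt (2 * l) * (cosh (t / 2) * (1 / 2))) *\<^sub>R cis ((w t)\<^sup>2)))) (at t)"
      unfolding K_def by simp
    moreover have "(2 / sqrt (2 * l)) *\<^sub>R
        (cis l * ((sqrt (2 * l) * (cosh (t / 2) * (1 / 2))) *\<^sub>R cis ((w t)\<^sup>2))) =
        cosh (t / 2) *\<^sub>R (cis l * cis ((w t)\<^sup>2))"
      using s by (simp add: mult_scaleR_right)
    moreover have "cis l * cis ((w t)\<^sup>2) = cis (l * cosh t)" by (simp add: w2 cis_mult)
    ultimately show "(K has_vector_derivative cosh (t / 2) *\<^sub>R cis (l * cosh t)) (at t)" by simp
  qed
  moreover have "K 0 = 0" by (simp add: K_def w_def fresnel_def)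
  ultimately show ?thesis by (simp only: K_def w_def diff_zero)
qed

text \<open>The value in \<open>cosh_oscillatory_fresnel\<close> with the Fresnel integral replaced
  by its limit: the stationary phase contribution of one side of t = 0.\<close>

definition cosh_lim :: "real \<Rightarrow> complex" where
  "cosh_lim l = (2 / sqrt (2 * l)) *\<^sub>R (cis l * fresnel_lim)"

lemma cis_cosh_integrable: "(\<lambda>t. cis (l * cosh t)) integrable_on {a..b}"
  by (intro integrable_continuous_real continuous_intros)

lemma cosh_oscillatory_split:
  assumes b: "0 \<le> b" and l: "l > 0"
  shows "norm (integral {0..b} (\<lambda>t. cis (l * cosh t))
     - (2 / sqrt (2 * l)) *\<^sub>R (cis l * fresnel (sqrt (2 * l) * sinh (b / 2)))) \<le> 5 / l"
proof -
  have "(\<lambda>t. (1 - cosh (t / 2)) *\<^sub>R cis (l * cosh t)) integrable_on {0..b}"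
    by (intro integrable_continuous_real continuous_intros) auto
  from has_integral_add[OF integrable_integral[OF this] cosh_oscillatory_fresnel[OF b l]]
  have "((\<lambda>t. cis (l * cosh t)) has_integral integral {0..b} (\<lambda>t. (1 - cosh (t / 2)) *\<^sub>R cis (l * cosh t))
     + (2 / sqrt (2 * l)) *\<^sub>R (cis l * fresnel (sqrt (2 * l) * sinh (b / 2)))) {0..b}"
    by (simp flip: scaleR_left_distrib)
  then show ?thesis using cosh_oscillatory_diff[OF b l] by (simp add: integral_unique)
qed

text \<open>The hypothesis keeps the endpoint a fixed distance away from the stationary point, so
  the argument of the Fresnel integral is at least sqrt(2 l) / 8 and its tail gains another factor
  of order 1 / sqrt l. The constant is 13 = 5 + 8, the first part coming from the change of
  amplitude.\<close>

lemma cosh_oscillatory_lim: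
  assumes b: "ln 2 \<le> b" and l: "l > 0"
  shows "norm (integral {0..b} (\<lambda>t. cis (l * cosh t)) - cosh_lim l) \<le> 13 / l"
proof -
  have b0: "b \<ge> 0" using b ln_gt_zero[of "2::real"] by linarith
  have s: "sqrt (2 * l) > 0" using l by simp
  define y where "y = sqrt (2 * l) * sinh (b / 2)"
  have "ln (2::real) \<ge> 1/2" using ln2_ge_two_thirds by simp
  then have u: "b / 2 \<ge> 1/4" using b by linarith
  have "1/8 \<le> sinh u" if "u \<ge> 1/4" for u :: real
  proof -
    have "exp (- u) \<le> 1" using that by simp
    moreover have "2 * sinh u = exp u - exp (- u)" by (simp add: sinh_field_def)
    ultimately show ?thesis using exp_ge_add_one_self[of u] that by linarith
  qed
  then have "sinh (b / 2) \<ge> 1/8" using u by blast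
  then have y: "y \<ge> sqrt (2 * l) * (1/8)" unfolding y_def using s by (intro mult_left_mono) auto
  have y0: "y > 0" by (rule less_le_trans[OF _ y]) (use s in simp)
  have "norm ((2 / sqrt (2 * l)) *\<^sub>R (cis l * fresnel y) - cosh_lim l)
     = 2 / sqrt (2 * l) * norm (fresnel y - fresnel_lim)"
    using s unfolding cosh_lim_def scaleR_diff_right[symmetric] right_diff_distrib[symmetric]
    by (simp add: norm_mult)
  also have "\<dots> \<le> 2 / sqrt (2 * l) * (1 / y)"
    using s by (intro mult_left_mono fresnel_asymptotic y0) auto
  also have "\<dots> \<le> 2 / sqrt (2 * l) * (1 / (sqrt (2 * l) * (1/8)))"
    using s y y0 by (intro mult_left_mono divide_left_mono) auto
  also have "\<dots> = 16 / (sqrt (2 * l) * sqrt (2 * l))" by simp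
  also have "sqrt (2 * l) * sqrt (2 * l) = 2 * l" using l by (subst real_sqrt_mult_self) simp
  finally have A: "norm ((2 / sqrt (2 * l)) *\<^sub>R (cis l * fresnel y) - cosh_lim l) \<le> 16 / (2 * l)" .
  have B: "norm (integral {0..b} (\<lambda>t. cis (l * cosh t)) - (2 / sqrt (2 * l)) *\<^sub>R (cis l * fresnel y)) \<le> 5 / l"
    unfolding y_def by (rule cosh_oscillatory_split[OF b0 l])
  have "norm (integral {0..b} (\<lambda>t. cis (l * cosh t)) - cosh_lim l) \<le> 5 / l + 16 / (2 * l)"
    using norm_triangle_le[OF add_mono[OF B A]] by simp
  then show ?thesis by simp
qed

text \<open>Here the endpoint may lie arbitrarily close to the stationary point. Boundedness of the
  Fresnel integral still gives 1 / sqrt l, uniformly in b.\<close>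

lemma cosh_oscillatory_bound0:
  assumes b: "0 \<le> b" and l: "l \<ge> 1"
  shows "norm (integral {0..b} (\<lambda>t. cis (l * cosh t))) \<le> 9 / sqrt l"
proof -
  have l0: "l > 0" using l by simp
  have s: "sqrt l > 0" "sqrt l \<le> sqrt (2 * l)" using l by auto
  define y where "y = sqrt (2 * l) * sinh (b / 2)"
  have "norm ((2 / sqrt (2 * l)) *\<^sub>R (cis l * fresnel y)) = 2 / sqrt (2 * l) * norm (fresnel y)"
    using l by (simp add: norm_mult)
  also have "\<dots> \<le> 2 / sqrt l * 2"
    using s b l by (intro mult_mono divide_left_mono fresnel_bound) (auto simp: y_def)
  finally have A: "norm ((2 / sqrt (2 * l)) *\<^sub>R (cis l * fresnel y)) \<le> 4 / sqrt l" by simp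
  have "sqrt l \<le> l" using l by (simp add: real_le_lsqrt power2_eq_square)
  then have "5 / l \<le> 5 / sqrt l" using s l by (intro divide_left_mono) auto
  then have B: "norm (integral {0..b} (\<lambda>t. cis (l * cosh t)) - (2 / sqrt (2 * l)) *\<^sub>R (cis l * fresnel y)) \<le> 5 / sqrt l"
    unfolding y_def using cosh_oscillatory_split[OF b l0] by linarith
  have "norm (integral {0..b} (\<lambda>t. cis (l * cosh t))) \<le> 5 / sqrt l + 4 / sqrt l"
    using norm_triangle_le[OF add_mono[OF B A]] by simp
  then show ?thesis by simp
qed

lemma cosh_integral_reflect:
  "integral {a..b} (\<lambda>t. cis (l * cosh t)) = integral {-b..-a} (\<lambda>t. cis (l * cosh t))"
  using Henstock_Kurzweil_Integration.integral_reflect_real[of b a "\<lambda>t. cis (l * cosh t)"] by simp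

lemma cosh_oscillatory_bound:
  assumes ab: "a \<le> b" and l: "l \<ge> 1"
  shows "norm (integral {a..b} (\<lambda>t. cis (l * cosh t))) \<le> 18 / sqrt l"
proof -
  let ?I = "\<lambda>a b. integral {a..b} (\<lambda>t. cis (l * cosh t))"
  have pos: "norm (?I u v) \<le> 18 / sqrt l" if "0 \<le> u" "u \<le> v" for u v
  proof -
    have "?I 0 u + ?I u v = ?I 0 v"
      by (rule Henstock_Kurzweil_Integration.integral_combine) (use that cis_cosh_integrable in auto)
    then have "?I u v = ?I 0 v - ?I 0 u" by (simp add: algebra_simps)
    also have "norm \<dots> \<le> 9 / sqrt l + 9 / sqrt l"
      by (intro norm_triangle_le_diff add_mono cosh_oscillatory_bound0 l) (use that in auto)
    finally show ?thesis by simp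
  qed
  consider "0 \<le> a" | "b \<le> 0" | "a \<le> 0" "0 \<le> b" by linarith
  then show ?thesis
  proof cases
    case 1
    then show ?thesis using pos ab by simp
  next
    case 2
    then show ?thesis using pos[of "-b" "-a"] ab cosh_integral_reflect[of a b] by simp
  next
    case 3
    have "?I a 0 + ?I 0 b = ?I a b"
      by (rule Henstock_Kurzweil_Integration.integral_combine) (use 3 cis_cosh_integrable in auto)
    then have "?I a b = ?I 0 (-a) + ?I 0 b" using cosh_integral_reflect[of a 0 l] by simp
    also have "norm \<dots> \<le> 9 / sqrt l + 9 / sqrt l"
      by (intro norm_triangle_le add_mono cosh_oscillatory_bound0 l) (use 3 in auto)
    finally show ?thesis by simp
  qed
qed

lemma cosh_oscillatory_full:
  assumes "ln 2 \<le> - a" "ln 2 \<le> b" and l: "l > 0"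
  shows "norm (integral {a..b} (\<lambda>t. cis (l * cosh t)) - 2 * cosh_lim l) \<le> 26 / l"
proof -
  let ?I = "\<lambda>a b. integral {a..b} (\<lambda>t. cis (l * cosh t))"
  have "0 < ln (2::real)" by simp
  then have ab: "a \<le> 0" "0 \<le> b" using assms by linarith+
  have "?I a 0 + ?I 0 b = ?I a b"
    by (rule Henstock_Kurzweil_Integration.integral_combine) (use ab cis_cosh_integrable in auto)
  then have "?I a b - 2 * cosh_lim l = (?I 0 (-a) - cosh_lim l) + (?I 0 b - cosh_lim l)"
    using cosh_integral_reflect[of a 0 l] by simp
  also have "norm \<dots> \<le> 13 / l + 13 / l"
    by (intro norm_triangle_le add_mono cosh_oscillatory_lim assms)
  finally show ?thesis by simp
qed

lemma norm_cosh_lim: "l > 0 \<Longrightarrow> norm (cosh_lim l) \<le> 2 / sqrt l"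
proof -
  assume l: "l > 0"
  have "norm (1 + \<i>) = sqrt 2" by (simp add: cmod_def)
  then have "norm fresnel_lim = sqrt (pi / 8 * 2)"
    by (simp only: fresnel_lim_def norm_mult norm_of_real real_sqrt_mult) simp
  also have "\<dots> \<le> sqrt 1" using pi_less_4 by (intro real_sqrt_le_mono) simp
  finally have "norm fresnel_lim \<le> 1" by simp
  then have "2 / sqrt (2 * l) * norm fresnel_lim \<le> 2 / sqrt l * 1"
    using l by (intro mult_mono divide_left_mono) auto
  then show ?thesis using l by (simp add: cosh_lim_def norm_mult)
qed

section \<open>The contribution of a pair of Fourier frequencies\<close>

definition voronoi_osc :: "real \<Rightarrow> real" where
  "voronoi_osc z = 1 / (2 * sqrt 2) * z powr (- (1/4)) * sin (4 * pi * sqrt z - pi / 4)"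

text \<open>The phase shift pi / 4 comes from the argument of \<open>fresnel_lim\<close>. The minus
  sign matches that of the cosh integral in \<open>sin_conv_eq\<close>, where the two sides of the
  stationary point together cancel the division by 2.\<close>

lemma voronoi_osc_eq:
  assumes z: "z > 0"
  shows "voronoi_osc z = - Re (cosh_lim (4 * pi * sqrt z))"
proof -
  define l where "l = 4 * pi * sqrt z"
  have sz: "sqrt z > 0" using z by simp
  have "Re (cosh_lim l) = 2 / sqrt (2 * l) * (sqrt (pi / 8) * (cos l - sin l))"
    by (simp add: cosh_lim_def fresnel_lim_def algebra_simps)
  moreover have "sin (l - pi / 4) = (sin l - cos l) * (sqrt 2 / 2)"
    by (simp add: sin_diff cos_45 sin_45 algebra_simps)
  then have "cos l - sin l = - (sqrt 2 * sin (l - pi / 4))"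
  proof -
    assume "sin (l - pi / 4) = (sin l - cos l) * (sqrt 2 / 2)"
    then have "sqrt 2 * sin (l - pi / 4) = (sqrt 2 * sqrt 2) * (sin l - cos l) / 2" by (simp only: mult_ac) simp
    then show ?thesis by simp
  qed
  ultimately have R: "Re (cosh_lim l) = - (2 / sqrt (2 * l) * sqrt (pi / 8) * sqrt 2) * sin (l - pi / 4)"
    by simp
  have "z powr (- (1/4)) = 1 / sqrt (sqrt z)"
    using z by (simp add: powr_minus_divide powr_half_sqrt[symmetric] powr_powr)
  moreover have "2 / sqrt (2 * l) * sqrt (pi / 8) * sqrt 2 = 1 / (2 * sqrt 2) * (1 / sqrt (sqrt z))"
  proof -
    have "2 / sqrt (2 * l) * sqrt (pi / 8) * sqrt 2 = 2 * (sqrt (pi / 8 * 2) / sqrt (2 * l))"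
      by (simp only: real_sqrt_mult) simp
    also have "sqrt (pi / 8 * 2) / sqrt (2 * l) = sqrt ((pi / 8 * 2) / (2 * l))"
      by (rule real_sqrt_divide[symmetric])
    also have "(pi / 8 * 2) / (2 * l) = 1 / (32 * sqrt z)" using sz by (simp add: l_def)
    also have "2 * sqrt (1 / (32 * sqrt z)) = sqrt (4 * (1 / (32 * sqrt z)))"
      by (simp only: real_sqrt_mult[of 4]) simp
    also have "4 * (1 / (32 * sqrt z)) = (1 / 8) * (1 / sqrt z)" by simp
    also have "sqrt ((1 / 8) * (1 / sqrt z)) = sqrt (1 / 8) * (1 / sqrt (sqrt z))"
      by (simp only: real_sqrt_mult real_sqrt_divide real_sqrt_one)
    also have "sqrt (1 / 8) = 1 / (2 * sqrt 2)"
      using real_sqrt_mult[of 4 2] by (simp add: real_sqrt_divide)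
    finally show ?thesis .
  qed
  ultimately show ?thesis using R unfolding voronoi_osc_def l_def by simp
qed

text \<open>The range of integration is wider than that of \<open>psi_conv\<close> so that the stationary point
  \<open>ln (m * x / k) / 2\<close> can lie outside of it only if \<open>k * m \<ge> x ^ 3 / 4\<close>, when the trivial bound suffices.\<close>

definition sin_conv :: "nat \<Rightarrow> nat \<Rightarrow> real \<Rightarrow> real" where
  "sin_conv k m x = integral {- ln x..2 * ln x}
     (\<lambda>s. sin (2 * pi * real k * exp s) * sin (2 * pi * real m * (x * exp (- s))))"

text \<open>The shift by \<tau> balances the two phases: \<open>real k * exp \<tau>\<close> and
  \<open>real m * (x * exp (- \<tau>))\<close> both equal sqrt(k m x). The product of sines then
  becomes half a difference of cosines whose phases are l sinh t and l cosh t.\<close>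

lemma sin_conv_eq:
  assumes x: "x \<ge> 1" and k: "k \<ge> 1" and m: "m \<ge> 1"
  defines "\<tau> \<equiv> ln (real m * x / real k) / 2" and "l \<equiv> 4 * pi * sqrt (real k * real m * x)"
  shows "sin_conv k m x = (Re (integral {- ln x - \<tau>..2 * ln x - \<tau>} (\<lambda>t. cis (l * sinh t)))
     - Re (integral {- ln x - \<tau>..2 * ln x - \<tau>} (\<lambda>t. cis (l * cosh t)))) / 2"
proof -
  define f where "f s = sin (2 * pi * real k * exp s) * sin (2 * pi * real m * (x * exp (- s)))" for s
  have km: "real k > 0" "real m > 0" "x > 0" using k m x by auto
  define r where "r = sqrt (real k * real m * x)"
  have e1: "real k * exp \<tau> = r"
  proof (rule power2_eq_imp_eq)
    have "(exp \<tau>)\<^sup>2 = exp (2 * \<tau>)" by (simp add: exp_double)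
    also have "\<dots> = real m * x / real k" using km by (simp add: \<tau>_def)
    finally have "(real k * exp \<tau>)\<^sup>2 = (real k)\<^sup>2 * (real m * x / real k)" by (simp add: power_mult_distrib)
    also have "\<dots> = r\<^sup>2" using km by (simp add: r_def power2_eq_square)
    finally show "(real k * exp \<tau>)\<^sup>2 = r\<^sup>2" .
  qed (use km in \<open>auto simp: r_def\<close>)
  have e2: "real m * (x * exp (- \<tau>)) = r"
  proof -
    have "r * r = real k * (real m * x)" using km by (simp add: r_def)
    then have "real k * exp \<tau> * r = real k * (real m * x)" by (simp only: e1)
    then have "exp \<tau> * r = real m * x" using km by simp
    then show ?thesis by (simp add: exp_minus field_simps)
  qed
  have "integral {- ln x - \<tau>..2 * ln x - \<tau>} (f \<circ> (\<lambda>t. t + \<tau>)) = integral {- ln x - \<tau> + \<tau>..2 * ln x - \<tau> + \<tau>} f"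
    by (rule integral_shift) (auto simp: f_def intro!: continuous_intros)
  then have 1: "sin_conv k m x = integral {- ln x - \<tau>..2 * ln x - \<tau>} (\<lambda>t. f (t + \<tau>))"
    by (simp add: sin_conv_def f_def[abs_def] o_def)
  have "f (t + \<tau>) = (Re (cis (l * sinh t)) - Re (cis (l * cosh t))) * (1 / 2)" for t
  proof -
    have a: "2 * pi * real k * exp (t + \<tau>) = 2 * pi * (r * exp t)"
      by (simp add: exp_add flip: e1)
    have b: "2 * pi * real m * (x * exp (- (t + \<tau>))) = 2 * pi * (r * exp (- t))"
    proof -
      have "exp (- (t + \<tau>)) = exp (- t) * exp (- \<tau>)" by (simp flip: exp_add)
      then show ?thesis by (simp flip: e2)
    qed
    have c: "2 * pi * (r * exp t) - 2 * pi * (r * exp (- t)) = l * sinh t"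
      "2 * pi * (r * exp t) + 2 * pi * (r * exp (- t)) = l * cosh t"
      by (simp_all add: l_def r_def sinh_field_def cosh_field_def algebra_simps)
    show ?thesis unfolding f_def a b sin_times_sin c by simp
  qed
  then have "integral {- ln x - \<tau>..2 * ln x - \<tau>} (\<lambda>t. f (t + \<tau>)) =
     integral {- ln x - \<tau>..2 * ln x - \<tau>} (\<lambda>t. (Re (cis (l * sinh t)) - Re (cis (l * cosh t))) * (1 / 2))"
    by (simp only:)
  also have "\<dots> = (integral {- ln x - \<tau>..2 * ln x - \<tau>} (\<lambda>t. Re (cis (l * sinh t)))
      - integral {- ln x - \<tau>..2 * ln x - \<tau>} (\<lambda>t. Re (cis (l * cosh t)))) * (1 / 2)"
    by (subst integral_mult_left, subst Henstock_Kurzweil_Integration.integral_diff)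
       (auto intro!: integrable_continuous_real continuous_intros)
  also have "integral {a..b} (\<lambda>t. Re (cis (l * sinh t))) = Re (integral {a..b} (\<lambda>t. cis (l * sinh t)))" for a b
  proof -
    have "(\<lambda>t. cis (l * sinh t)) integrable_on {a..b}"
      by (intro integrable_continuous_real continuous_intros)
    from integral_linear[OF this bounded_linear_Re] show ?thesis by (simp add: o_def)
  qed
  also have "integral {a..b} (\<lambda>t. Re (cis (l * cosh t))) = Re (integral {a..b} (\<lambda>t. cis (l * cosh t)))" for a b
    using integral_linear[OF cis_cosh_integrable bounded_linear_Re, of a b l] by (simp add: o_def)
  finally show ?thesis using 1 by simp
qed

text \<open>Put n = k m. With the stationary point well inside the range, the error is O(1 / l),
  hence O((n x)^(-1/2)). Otherwise n >= x^3 / 4, and only 1 / sqrt l, of order (n x)^(-1/4), is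
  available: one factor n^(-1/8) is traded for the missing x^(-1/4), and the other survives to make
  the sum over frequencies converge.\<close>

lemma sin_conv_approx:
  assumes x: "x \<ge> 1" and k: "k \<ge> 1" and m: "m \<ge> 1"
  shows "\<bar>sin_conv k m x - voronoi_osc (real k * real m * x)\<bar> \<le>
    40 * (x powr (- (1/2)) * (real k * real m) powr (- (1/8)))"
proof -
  define \<tau> where "\<tau> = ln (real m * x / real k) / 2"
  define n where "n = real k * real m"
  define l where "l = 4 * pi * sqrt (n * x)"
  define a b where "a = - ln x - \<tau>" and "b = 2 * ln x - \<tau>"
  have km: "real k \<ge> 1" "real m \<ge> 1" "x > 0" using k m x by auto
  have n1: "n \<ge> 1" using mult_mono[OF km(1,2)] by (simp add: n_def)
  have nx: "n * x \<ge> 1" using mult_mono[OF n1 x] n1 by simp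
  have snx: "sqrt (n * x) \<ge> 1" using nx by simp
  have l4: "l \<ge> sqrt (n * x)" "l > 0" "l \<ge> 1"
  proof -
    have "4 * pi * sqrt (n * x) \<ge> 1 * sqrt (n * x)" using pi_gt3 snx by (intro mult_right_mono) auto
    then show *: "l \<ge> sqrt (n * x)" by (simp add: l_def)
    show "l > 0" "l \<ge> 1" using * snx by linarith+
  qed
  have ab: "a \<le> b" using x by (simp add: a_def b_def)
  have \<tau>2: "2 * \<tau> = ln (real m) + ln x - ln (real k)"
    using km by (simp add: \<tau>_def ln_div ln_mult)
  have W: "sin_conv k m x - voronoi_osc (n * x) = (Re (integral {a..b} (\<lambda>t. cis (l * sinh t)))
     - Re (integral {a..b} (\<lambda>t. cis (l * cosh t)) - 2 * cosh_lim l)) / 2"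
    using sin_conv_eq[OF x k m] voronoi_osc_eq[of "n * x"] nx
    by (simp add: a_def b_def \<tau>_def n_def l_def)
  have S: "\<bar>Re (integral {a..b} (\<lambda>t. cis (l * sinh t)))\<bar> \<le> 6 / l"
    using sinh_oscillatory[OF ab l4(2)] abs_Re_le_cmod order_trans by blast
  define P where "P = x powr (- (1/2)) * n powr (- (1/8))"
  have P0: "P \<ge> 0" by (simp add: P_def)
  have il: "1 / l \<le> P"
  proof -
    have "1 / l \<le> 1 / sqrt (n * x)" using l4 snx by (intro divide_left_mono mult_pos_pos) linarith+
    also have "\<dots> = x powr (- (1/2)) * n powr (- (1/2))"
      using km n1 by (simp add: powr_minus_divide powr_half_sqrt real_sqrt_mult)
    also have "\<dots> \<le> P" unfolding P_def using n1 by (intro mult_left_mono powr_mono) auto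
    finally show ?thesis .
  qed
  have "\<bar>Re (integral {a..b} (\<lambda>t. cis (l * cosh t)) - 2 * cosh_lim l)\<bar> \<le> 60 * P"
  \<comment> \<open>In logarithms the two conditions read ln 4 <= 2 b and ln 4 <= - 2 a: both
    endpoints are at distance at least ln 2 from the stationary point 0.\<close>
  proof (cases "4 * real m \<le> real k * x^3 \<and> 4 * real k \<le> real m * x^3")
    case True
    have b: "ln 2 \<le> b"
    proof -
      have "ln 4 \<le> ln (real k * x^3 / real m)" using True km by (subst ln_le_cancel_iff) (auto simp: field_simps)
      also have "\<dots> = ln (real k) + 3 * ln x - ln (real m)" using km by (simp add: ln_div ln_mult ln_realpow)
      also have "\<dots> = 2 * b" using \<tau>2 by (simp add: b_def)
      finally show ?thesis using ln_realpow[of 2 2] by simp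
    qed
    have a: "ln 2 \<le> - a"
    proof -
      have "ln 4 \<le> ln (real m * x^3 / real k)" using True km by (subst ln_le_cancel_iff) (auto simp: field_simps)
      also have "\<dots> = ln (real m) + 3 * ln x - ln (real k)" using km by (simp add: ln_div ln_mult ln_realpow)
      also have "\<dots> = 2 * (- a)" using \<tau>2 by (simp add: a_def)
      finally show ?thesis using ln_realpow[of 2 2] by simp
    qed
    have "\<bar>Re (integral {a..b} (\<lambda>t. cis (l * cosh t)) - 2 * cosh_lim l)\<bar> \<le> 26 / l"
      using cosh_oscillatory_full[OF a b l4(2)] abs_Re_le_cmod order_trans by blast
    also have "\<dots> = 26 * (1 / l)" by simp
    finally show ?thesis using il P0 by linarith
  next
    case False
    have big: "x^3 / 4 \<le> n"
    proof -
      have x3: "x^3 > 0" using km by simp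
      from False consider "real k * x^3 \<le> 4 * real m" | "real m * x^3 \<le> 4 * real k" by linarith
      then show ?thesis
      proof cases
        case 1
        have "1 * x^3 \<le> real k * x^3" using km x3 by (intro mult_right_mono) auto
        moreover have "1 * real m \<le> real k * real m" using km by (intro mult_right_mono) auto
        ultimately show ?thesis using 1 by (simp add: n_def)
      next
        case 2
        have "1 * x^3 \<le> real m * x^3" using km x3 by (intro mult_right_mono) auto
        moreover have "real k * 1 \<le> real k * real m" using km by (intro mult_left_mono) auto
        ultimately show ?thesis using 2 by (simp add: n_def)
      qed
    qed
    have isl: "1 / sqrt l \<le> 2 * P"
    proof -
      have "n powr (- (1/8)) \<le> (x^3 / 4) powr (- (1/8))"
        using big km by (intro powr_mono2') auto
      also have "\<dots> = x powr (- (3/8)) * 4 powr (1/8)"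
        using km by (simp add: powr_divide powr_minus_divide powr_powr flip: powr_numeral)
      also have "\<dots> \<le> x powr (- (1/4)) * 2"
      proof (intro mult_mono powr_mono)
        have "(4::real) powr (1/8) \<le> 4 powr (1/2)" by (intro powr_mono) auto
        then show "(4::real) powr (1/8) \<le> 2" by (simp add: powr_half_sqrt)
      qed (use x in auto)
      finally have A: "n powr (- (1/8)) \<le> x powr (- (1/4)) * 2" .
      have "sqrt (sqrt (n * x)) \<le> sqrt l" using l4(1) by (rule real_sqrt_le_mono)
      moreover have "0 < sqrt (sqrt (n * x))" using snx by simp
      moreover have "0 < sqrt l" using l4(2) by simp
      ultimately have "1 / sqrt l \<le> 1 / sqrt (sqrt (n * x))" by (intro divide_left_mono mult_pos_pos) auto
      also have "\<dots> = x powr (- (1/4)) * n powr (- (1/4))"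
        using km n1 by (simp add: powr_minus_divide powr_half_sqrt[symmetric] powr_powr powr_mult)
      also have "n powr (- (1/4)) = n powr (- (1/8)) * n powr (- (1/8))" by (simp flip: powr_add)
      also have "x powr (- (1/4)) * (n powr (- (1/8)) * n powr (- (1/8))) \<le>
          x powr (- (1/4)) * ((x powr (- (1/4)) * 2) * n powr (- (1/8)))"
        by (intro mult_left_mono mult_right_mono A) auto
      also have "\<dots> = 2 * ((x powr (- (1/4)) * x powr (- (1/4))) * n powr (- (1/8)))" by simp
      also have "x powr (- (1/4)) * x powr (- (1/4)) = x powr (- (1/2))" by (simp flip: powr_add)
      finally show ?thesis by (simp add: P_def)
    qed
    have "norm (integral {a..b} (\<lambda>t. cis (l * cosh t)) - 2 * cosh_lim l) \<le> 18 / sqrt l + 2 * (2 / sqrt l)"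
    proof (rule norm_triangle_le_diff[OF add_mono])
      show "norm (integral {a..b} (\<lambda>t. cis (l * cosh t))) \<le> 18 / sqrt l"
        by (rule cosh_oscillatory_bound[OF ab l4(3)])
      show "norm (2 * cosh_lim l) \<le> 2 * (2 / sqrt l)"
        using norm_cosh_lim[OF l4(2)] by (simp add: norm_mult)
    qed
    also have "\<dots> = 22 * (1 / sqrt l)" by simp
    also have "\<dots> \<le> 22 * (2 * P)" by (intro mult_left_mono isl) auto
    finally have "norm (integral {a..b} (\<lambda>t. cis (l * cosh t)) - 2 * cosh_lim l) \<le> 60 * P" using P0 by simp
    then show ?thesis using abs_Re_le_cmod order_trans by blast
  qed
  moreover have "6 / l \<le> 6 * P" using il by simp
  ultimately have "\<bar>sin_conv k m x - voronoi_osc (n * x)\<bar> * 2 \<le> 66 * P"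
    unfolding W using S by simp
  then show ?thesis using P0 by (simp add: P_def n_def)
qed

section \<open>The Fourier series of the sawtooth function in the mean\<close>

text \<open>These are the partial sums of the Fourier series of -psi. Only products of two of them
  are used, in which the sign disappears, and \<open>psi_err\<close> is accordingly a sum and not a
  difference.\<close>

definition psi_fourier :: "nat \<Rightarrow> real \<Rightarrow> real" where
  "psi_fourier K u = (\<Sum>k=1..K. sin (2 * pi * real k * u) / (pi * real k))"

definition psi_err :: "nat \<Rightarrow> real \<Rightarrow> real" where
  "psi_err K u = psi u + psi_fourier K u"

lemma psi_fourier_continuous: "continuous_on A (psi_fourier K)"
  unfolding psi_fourier_def by (intro continuous_intros) auto

lemma psi_fourier_measurable [measurable]: "psi_fourier K \<in> borel_measurable borel"
  by (intro borel_measurable_continuous_onI psi_fourier_continuous)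

lemma psi_err_measurable [measurable]: "psi_err K \<in> borel_measurable borel"
  unfolding psi_err_def[abs_def] by measurable

text \<open>A crude bound growing with K, sufficient for integrability; smallness of the error is
  measured in the mean square.\<close>

lemma psi_err_bound: "\<bar>psi_err K u\<bar> \<le> 1/2 + real K"
proof -
  have "\<bar>psi_fourier K u\<bar> \<le> (\<Sum>k=1..K. \<bar>sin (2 * pi * real k * u) / (pi * real k)\<bar>)"
    unfolding psi_fourier_def by (rule sum_abs)
  also have "\<dots> \<le> (\<Sum>k=1..K. 1)"
  proof (rule sum_mono)
    fix k assume k: "k \<in> {1..K}"
    have "\<bar>sin (2 * pi * real k * u) / (pi * real k)\<bar> = \<bar>sin (2 * pi * real k * u)\<bar> / (pi * real k)"
      using k by (simp add: abs_mult)
    also have "\<dots> \<le> 1 / 1"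
    proof (rule frac_le)
      have "1 * 1 \<le> pi * real k" using k pi_gt3 by (intro mult_mono) auto
      then show "1 \<le> pi * real k" by simp
    qed auto
    finally show "\<bar>sin (2 * pi * real k * u) / (pi * real k)\<bar> \<le> 1" by simp
  qed
  finally show ?thesis using psi_bound[of u] unfolding psi_err_def by simp
qed

lemma psi_err_sq_bound: "\<bar>(psi_err K u)\<^sup>2\<bar> \<le> (1/2 + real K)\<^sup>2"
  using power_mono[OF psi_err_bound[of K u], of 2] by simp

lemma sin_2pi_int: "sin (2 * pi * real_of_int n) = 0" "cos (2 * pi * real_of_int n) = 1"
  by (simp_all add: sin_integer_2pi cos_integer_2pi)

lemma integral_cos_period:
  assumes "n \<noteq> 0"
  shows "((\<lambda>u. cos (2 * pi * real_of_int n * u)) has_integral 0) {0..1}"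
proof -
  have "((\<lambda>u. cos (2 * pi * real_of_int n * u)) has_integral
     sin (2 * pi * real_of_int n * 1) / (2 * pi * real_of_int n) - sin (2 * pi * real_of_int n * 0) / (2 * pi * real_of_int n)) {0..1}"
    by (rule FTC_piecewise[where S="{}"])
       (use assms in \<open>auto intro!: derivative_eq_intros continuous_intros\<close>)
  then show ?thesis using sin_2pi_int(1)[of n] by (simp only: mult_1_right) simp
qed

lemma integral_sin_sin_period:
  assumes "j \<ge> 1" "k \<ge> (1::nat)"
  shows "((\<lambda>u. sin (2 * pi * real j * u) * sin (2 * pi * real k * u)) has_integral
     (if j = k then 1/2 else 0)) {0..1}"
proof -
  have *: "sin (2 * pi * real j * u) * sin (2 * pi * real k * u) =
     (cos (2 * pi * real_of_int (int j - int k) * u) - cos (2 * pi * real_of_int (int j + int k) * u)) / 2" for u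
    by (simp add: sin_times_sin algebra_simps)
  have 1: "((\<lambda>u. cos (2 * pi * real_of_int (int j + int k) * u)) has_integral 0) {0..1}"
    by (rule integral_cos_period) (use assms in auto)
  have 2: "((\<lambda>u. cos (2 * pi * real_of_int (int j - int k) * u)) has_integral (if j = k then 1 else 0)) {0..1}"
  proof (cases "j = k")
    case True
    then show ?thesis using has_integral_const_real[of "1::real" 0 1] by simp
  next
    case False
    then show ?thesis using integral_cos_period[of "int j - int k"] by simp
  qed
  have "((\<lambda>u. (cos (2 * pi * real_of_int (int j - int k) * u) - cos (2 * pi * real_of_int (int j + int k) * u)) / 2)
     has_integral ((if j = k then 1 else 0) - 0) / 2) {0..1}"
    by (intro has_integral_divide has_integral_diff 1 2)
  then show ?thesis unfolding * by (simp split: if_splits)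
qed

lemma psi_unit: "0 \<le> u \<Longrightarrow> u < 1 \<Longrightarrow> psi u = u - 1/2"
proof -
  assume "0 \<le> u" "u < 1"
  then have "\<lfloor>u\<rfloor> = 0" by linarith
  then show ?thesis by (simp add: psi_def)
qed

lemma integral_psi_sq: "((\<lambda>u. (psi u)\<^sup>2) has_integral 1/12) {0..1}"
proof -
  have "((\<lambda>u::real. (u - 1/2)\<^sup>2) has_integral (1 - 1/2)^3 / 3 - (0 - 1/2)^3 / 3) {0..1}"
    by (rule FTC_piecewise[where S="{}"]) (auto intro!: derivative_eq_intros continuous_intros)
  then have "((\<lambda>u::real. (u - 1/2)\<^sup>2) has_integral 1/12) {0..1}"
    by (simp add: power3_eq_cube)
  then show ?thesis
    by (rule has_integral_spike_finite[of "{1}", rotated 2]) (auto simp: psi_unit)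
qed

lemma integral_psi_sin:
  assumes "k \<ge> 1"
  shows "((\<lambda>u. psi u * sin (2 * pi * real k * u)) has_integral - 1 / (2 * pi * real k)) {0..1}"
proof -
  define a where "a = 2 * pi * real k"
  have a: "a > 0" using assms by (simp add: a_def)
  have sc: "sin a = 0" "cos a = 1" using sin_2pi_int[of "int k"] by (simp_all add: a_def)
  have "((\<lambda>u. (u - 1/2) * sin (a * u)) has_integral
     (- (1 - 1/2) * cos (a * 1) / a + sin (a * 1) / a\<^sup>2) - (- (0 - 1/2) * cos (a * 0) / a + sin (a * 0) / a\<^sup>2)) {0..1}"
    by (rule FTC_piecewise[where S="{}"])
       (use a in \<open>auto intro!: derivative_eq_intros continuous_intros simp: power2_eq_square field_simps\<close>)
  then have "((\<lambda>u. (u - 1/2) * sin (a * u)) has_integral - 1 / a) {0..1}"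
    using sc by simp
  then show ?thesis unfolding a_def[symmetric]
    by (rule has_integral_spike_finite[of "{1}", rotated 2]) (auto simp: psi_unit)
qed

text \<open>The coefficients of \<open>psi_fourier\<close> are those of -psi, so the cross term is
  minus twice the quadratic one, and Bessel's identity remains.\<close>

lemma integral_psi_err_sq:
  "((\<lambda>u. (psi_err K u)\<^sup>2) has_integral 1/12 - (\<Sum>k=1..K. 1 / (real k)\<^sup>2) / (2 * pi\<^sup>2)) {0..1}"
proof -
  define c where "c k = 1 / (pi * real k)" for k
  define S where "S k u = sin (2 * pi * real k * u)" for k u
  have A: "((\<lambda>u. \<Sum>k=1..K. c k * (psi u * S k u)) has_integral (\<Sum>k=1..K. c k * (- 1 / (2 * pi * real k)))) {0..1}"
    unfolding S_def by (intro has_integral_sum has_integral_mult_right integral_psi_sin) auto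
  have B: "((\<lambda>u. \<Sum>j=1..K. \<Sum>k=1..K. (c j * c k) * (S j u * S k u)) has_integral
     (\<Sum>j=1..K. \<Sum>k=1..K. (c j * c k) * (if j = k then 1/2 else 0))) {0..1}"
    unfolding S_def by (intro has_integral_sum has_integral_mult_right integral_sin_sin_period) auto
  have "((\<lambda>u. (psi u)\<^sup>2 + 2 * (\<Sum>k=1..K. c k * (psi u * S k u))
      + (\<Sum>j=1..K. \<Sum>k=1..K. (c j * c k) * (S j u * S k u))) has_integral
      1/12 + 2 * (\<Sum>k=1..K. c k * (- 1 / (2 * pi * real k)))
      + (\<Sum>j=1..K. \<Sum>k=1..K. (c j * c k) * (if j = k then 1/2 else 0))) {0..1}"
    by (intro has_integral_add has_integral_mult_right integral_psi_sq A B)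
  moreover have "(psi u)\<^sup>2 + 2 * (\<Sum>k=1..K. c k * (psi u * S k u))
      + (\<Sum>j=1..K. \<Sum>k=1..K. (c j * c k) * (S j u * S k u)) = (psi_err K u)\<^sup>2" for u
  proof -
    have f: "psi_fourier K u = (\<Sum>k=1..K. c k * S k u)"
      by (simp add: psi_fourier_def c_def S_def)
    have "(\<Sum>j=1..K. \<Sum>k=1..K. (c j * c k) * (S j u * S k u)) = psi_fourier K u * psi_fourier K u"
      unfolding f sum_product by (intro sum.cong refl) (simp add: mult_ac)
    moreover have "(\<Sum>k=1..K. c k * (psi u * S k u)) = psi u * psi_fourier K u"
      unfolding f sum_distrib_left by (intro sum.cong refl) (simp add: mult_ac)
    ultimately show ?thesis by (simp add: psi_err_def power2_eq_square algebra_simps)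
  qed
  moreover have "(\<Sum>j=1..K. \<Sum>k=1..K. (c j * c k) * (if j = k then 1/2 else 0)) = (\<Sum>k=1..K. 1 / (real k)\<^sup>2) / (2 * pi\<^sup>2)"
  proof -
    have "(\<Sum>j=1..K. \<Sum>k=1..K. (c j * c k) * (if j = k then 1/2 else 0)) = (\<Sum>j=1..K. c j * c j / 2)"
      by (intro sum.cong refl) (simp add: if_distrib[of "\<lambda>y. _ * y"] cong: if_cong)
    also have "\<dots> = (\<Sum>k=1..K. 1 / (real k)\<^sup>2 / (2 * pi\<^sup>2))"
      by (intro sum.cong refl) (simp add: c_def power2_eq_square)
    finally show ?thesis by (simp add: sum_divide_distrib)
  qed
  moreover have "2 * (\<Sum>k=1..K. c k * (- 1 / (2 * pi * real k))) = - 2 * ((\<Sum>k=1..K. 1 / (real k)\<^sup>2) / (2 * pi\<^sup>2))"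
    unfolding sum_divide_distrib sum_distrib_left
    by (intro sum.cong refl) (simp add: c_def power2_eq_square)
  ultimately show ?thesis by simp
qed

definition psi_l2 :: "nat \<Rightarrow> real" where
  "psi_l2 K = integral {0..1} (\<lambda>u. (psi_err K u)\<^sup>2)"

text \<open>Completeness of the trigonometric system enters only through the sum of the inverse
  squares: 1/12 = (pi^2 / 6) / (2 pi^2).\<close>

lemma psi_l2_tendsto: "psi_l2 \<longlonglongrightarrow> 0"
proof -
  have "(\<lambda>K. \<Sum>k<K. 1 / (real (Suc k))\<^sup>2) \<longlonglongrightarrow> pi\<^sup>2 / 6"
    using inverse_squares_sums by (simp add: sums_def add.commute)
  moreover have "(\<Sum>k<K. 1 / (real (Suc k))\<^sup>2) = (\<Sum>k=1..K. 1 / (real k)\<^sup>2)" for K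
    by (rule sum.reindex_bij_witness[where i="\<lambda>k. k - 1" and j=Suc]) auto
  ultimately have "(\<lambda>K. \<Sum>k=1..K. 1 / (real k)\<^sup>2) \<longlonglongrightarrow> pi\<^sup>2 / 6" by (simp only:)
  then have "(\<lambda>K. 1/12 - (\<Sum>k=1..K. 1 / (real k)\<^sup>2) / (2 * pi\<^sup>2)) \<longlonglongrightarrow> 1/12 - (pi\<^sup>2 / 6) / (2 * pi\<^sup>2)"
    by (intro tendsto_intros) auto
  then show ?thesis
    by (simp add: psi_l2_def[abs_def] integral_unique[OF integral_psi_err_sq])
qed

lemma psi_err_sq_integrable: "(\<lambda>u. (psi_err K u)\<^sup>2) integrable_on {a..b}"
  by (rule integrable_on_bounded_borel[OF _ psi_err_sq_bound]) measurable

lemma psi_l2_nonneg: "psi_l2 K \<ge> 0"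
  unfolding psi_l2_def by (rule integral_nonneg[OF psi_err_sq_integrable]) auto

lemma psi_err_periodic: "psi_err K (u + real n) = psi_err K u"
proof -
  have "sin (2 * pi * real k * (u + real n)) = sin (2 * pi * real k * u)" for k
  proof -
    have "2 * pi * real k * (u + real n) = 2 * pi * real k * u + 2 * pi * real_of_int (int (k * n))"
      by (simp add: algebra_simps)
    then show ?thesis by (simp only: sin_add sin_2pi_int)
  qed
  moreover have "psi (u + real n) = psi u"
    using floor_add_int[of u "int n"] by (simp add: psi_def)
  ultimately show ?thesis by (simp add: psi_err_def psi_fourier_def)
qed

lemma integral_psi_err_sq_nat:
  "integral {0..real N} (\<lambda>u. (psi_err K u)\<^sup>2) = real N * psi_l2 K"
proof (induction N)
  case (Suc N)
  have "integral {0..real N} (\<lambda>u. (psi_err K u)\<^sup>2) + integral {real N..real (Suc N)} (\<lambda>u. (psi_err K u)\<^sup>2) =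
     integral {0..real (Suc N)} (\<lambda>u. (psi_err K u)\<^sup>2)"
    by (rule Henstock_Kurzweil_Integration.integral_combine[OF _ _ psi_err_sq_integrable]) auto
  moreover have "integral {real N..real (Suc N)} (\<lambda>u. (psi_err K u)\<^sup>2) = psi_l2 K"
  proof -
    have "((\<lambda>u. (psi_err K u)\<^sup>2) has_integral psi_l2 K) (cbox 0 1)"
      unfolding psi_l2_def by (simp add: integrable_integral psi_err_sq_integrable)
    from has_integral_affinity[OF this, of 1 "- real N"]
    have "((\<lambda>u. (psi_err K (u - real N))\<^sup>2) has_integral psi_l2 K) ((\<lambda>u. u + real N) ` {0..1})" by simp
    moreover have "psi_err K (u - real N) = psi_err K u" for u
      using psi_err_periodic[of K "u - real N" N] by simp
    moreover have "(\<lambda>u. u + real N) ` {0..1} = {real N..real (Suc N)}"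
      by (simp add: add.commute)
    ultimately show ?thesis by (simp add: integral_unique)
  qed
  ultimately show ?case using Suc by (simp add: algebra_simps)
qed simp

lemma psi_err_isCont:
  assumes "u \<notin> \<int>"
  shows "isCont (psi_err K) u"
proof -
  have "isCont psi u" using psi_deriv[OF assms] DERIV_isCont by blast
  moreover have "isCont (psi_fourier K) u"
    using psi_fourier_continuous[of UNIV K] by (simp add: continuous_on_eq_continuous_at)
  ultimately show ?thesis unfolding psi_err_def[abs_def] by (rule continuous_add)
qed

lemma psi_err_exp_sq_integrable: "(\<lambda>s. (psi_err K (exp s))\<^sup>2) integrable_on {a..b}"
  by (rule integrable_on_bounded_borel[OF _ psi_err_sq_bound]) measurable

text \<open>The substitution u = exp s maps the range onto [1/x, x^2]. There du / u is at most x du,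
  and at most x^2 + 1 periods cover the interval. As x stays fixed while K grows, the polynomial
  factor is harmless.\<close>

lemma psi_err_exp_integral:
  assumes x: "x \<ge> 1"
  shows "integral {- ln x..2 * ln x} (\<lambda>s. (psi_err K (exp s))\<^sup>2) \<le> x * (x\<^sup>2 + 1) * psi_l2 K"
proof -
  define X where "X = ln x"
  define N where "N = nat \<lceil>x\<^sup>2\<rceil>"
  have X: "X \<ge> 0" "exp X = x" using x by (auto simp: X_def)
  have N: "x\<^sup>2 \<le> real N" "real N \<le> x\<^sup>2 + 1" unfolding N_def
    using zero_le_power2[of x] by linarith+
  have e2: "exp (2 * X) = x\<^sup>2" using X by (simp add: exp_double)
  define Q where "Q u = integral {0..u} (\<lambda>u. (psi_err K u)\<^sup>2)" for u
  have I: "((\<lambda>s. (psi_err K (exp s))\<^sup>2 * exp s) has_integral Q (exp (2 * X)) - Q (exp (- X))) {-X..2 * X}"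
  proof (rule FTC_piecewise[OF finite_exp_Ints[of "-X" "2 * X"]])
    have "continuous_on {0..exp (2 * X)} Q" unfolding Q_def
      by (rule indefinite_integral_continuous_1[OF psi_err_sq_integrable])
    then show "continuous_on {-X..2 * X} (\<lambda>s. Q (exp s))"
      by (rule continuous_on_compose2) (auto intro!: continuous_intros)
    fix s assume s: "- X < s" "s < 2 * X" "s \<notin> {s\<in>{-X..2 * X}. exp s \<in> \<int>}"
    then have nz: "exp s \<notin> \<int>" by auto
    have "(Q has_real_derivative (psi_err K (exp s))\<^sup>2) (at (exp s))" unfolding Q_def[abs_def]
      by (rule integral_deriv_at[OF psi_err_sq_integrable, where b="exp s + 1"])
         (auto intro!: continuous_power psi_err_isCont nz)
    from DERIV_chain2[where g=exp and x=s, OF this DERIV_exp]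
    show "((\<lambda>s. Q (exp s)) has_real_derivative (psi_err K (exp s))\<^sup>2 * exp s) (at s)" .
  qed (use X in simp)
  have "Q (exp (2 * X)) \<le> Q (real N)" unfolding Q_def
    by (rule integral_subset_le) (use N e2 psi_err_sq_integrable in auto)
  also have "\<dots> = real N * psi_l2 K" unfolding Q_def by (rule integral_psi_err_sq_nat)
  also have "\<dots> \<le> (x\<^sup>2 + 1) * psi_l2 K" using N psi_l2_nonneg by (intro mult_right_mono) auto
  finally have Q1: "Q (exp (2 * X)) \<le> (x\<^sup>2 + 1) * psi_l2 K" .
  have Q2: "Q (exp (- X)) \<ge> 0" unfolding Q_def by (rule integral_nonneg[OF psi_err_sq_integrable]) auto
  have "integral {-X..2 * X} (\<lambda>s. (psi_err K (exp s))\<^sup>2) \<le> x * (Q (exp (2 * X)) - Q (exp (- X)))"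
  proof (rule has_integral_le[OF integrable_integral[OF psi_err_exp_sq_integrable] has_integral_mult_right[OF I]])
    fix s assume s: "s \<in> {-X..2 * X}"
    have "1 = x * exp (- X)" using X x by (simp add: exp_minus)
    also have "\<dots> \<le> x * exp s" using s x by (intro mult_left_mono) auto
    finally have "(psi_err K (exp s))\<^sup>2 * 1 \<le> (psi_err K (exp s))\<^sup>2 * (x * exp s)"
      by (intro mult_left_mono) auto
    then show "(psi_err K (exp s))\<^sup>2 \<le> x * ((psi_err K (exp s))\<^sup>2 * exp s)" by (simp add: mult_ac)
  qed
  also have "\<dots> \<le> x * ((x\<^sup>2 + 1) * psi_l2 K)" using Q1 Q2 x by (intro mult_left_mono) auto
  finally show ?thesis by (simp add: X_def mult.assoc)
qed

section \<open>The convolution as a limit of double Fourier sums\<close>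

definition psi_conv_ext :: "real \<Rightarrow> real" where
  "psi_conv_ext x = integral {- ln x..2 * ln x} (\<lambda>s. psi (exp s) * psi (x * exp (- s)))"

text \<open>With R and R' the two truncation errors and p, p' the sawtooth values, the integrands
  differ by R R' - R p' - p R'. Since p and p' are bounded, mean square smallness of R and R'
  suffices.\<close>

lemma psi_conv_ext_limit:
  assumes x: "x \<ge> 1"
  shows "(\<lambda>K. \<Sum>k=1..K. \<Sum>m=1..K. sin_conv k m x / (pi\<^sup>2 * (real k * real m))) \<longlonglongrightarrow> psi_conv_ext x"
proof -
  define X where "X = ln x"
  have X: "X \<ge> 0" "exp X = x" using x by (auto simp: X_def)
  define P where "P K = integral {-X..2 * X} (\<lambda>s. psi_fourier K (exp s) * psi_fourier K (x * exp (- s)))" for K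
  have P_eq: "P K = (\<Sum>k=1..K. \<Sum>m=1..K. sin_conv k m x / (pi\<^sup>2 * (real k * real m)))" for K
  proof -
    have "((\<lambda>s. \<Sum>k=1..K. \<Sum>m=1..K. (sin (2 * pi * real k * exp s) * sin (2 * pi * real m * (x * exp (- s))))
        / (pi\<^sup>2 * (real k * real m))) has_integral
       (\<Sum>k=1..K. \<Sum>m=1..K. sin_conv k m x / (pi\<^sup>2 * (real k * real m)))) {-X..2 * X}"
      unfolding sin_conv_def X_def
      by (intro has_integral_sum has_integral_divide integrable_integral integrable_continuous_real continuous_intros) auto
    then have "((\<lambda>s. psi_fourier K (exp s) * psi_fourier K (x * exp (- s))) has_integral
       (\<Sum>k=1..K. \<Sum>m=1..K. sin_conv k m x / (pi\<^sup>2 * (real k * real m)))) {-X..2 * X}"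
      by (rule has_integral_eq[rotated])
         (simp add: psi_fourier_def sum_product power2_eq_square mult_ac)
    then show ?thesis unfolding P_def by (rule integral_unique)
  qed
  define E where "E K = x * (x\<^sup>2 + 1) * psi_l2 K" for K
  \<comment> \<open>This is the parameter in |r| <= e + r^2 / (4 e), which bounds the terms linear
    in R by the mean square. It must tend to 0 while its square dominates E; the summand 1 / (K + 1)
    keeps it positive even if E vanishes.\<close>
  define \<epsilon> where "\<epsilon> K = sqrt (E K + inverse (real (Suc K)))" for K
  have E0: "E K \<ge> 0" for K unfolding E_def using x psi_l2_nonneg by simp
  have arg: "E K + inverse (real (Suc K)) > 0" for K
    using E0[of K] by (intro add_nonneg_pos) auto
  have \<epsilon>0: "\<epsilon> K > 0" for K unfolding \<epsilon>_def using arg by simp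
  have E\<epsilon>: "E K \<le> (\<epsilon> K)\<^sup>2" for K
    unfolding \<epsilon>_def using arg[of K] by (subst real_sqrt_pow2) auto
  have "E \<longlonglongrightarrow> x * (x\<^sup>2 + 1) * 0" unfolding E_def[abs_def]
    by (intro tendsto_intros psi_l2_tendsto)
  then have Elim: "E \<longlonglongrightarrow> 0" by simp
  have "\<epsilon> \<longlonglongrightarrow> sqrt (0 + 0)" unfolding \<epsilon>_def[abs_def]
    by (intro tendsto_real_sqrt tendsto_add Elim LIMSEQ_inverse_real_of_nat)
  then have \<epsilon>lim: "\<epsilon> \<longlonglongrightarrow> 0" by simp
  have bound: "\<bar>P K - psi_conv_ext x\<bar> \<le> 3 * X * \<epsilon> K + \<epsilon> K / 4 + E K" for K
  proof -
    define e where "e = \<epsilon> K"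
    have e: "e > 0" using \<epsilon>0 by (simp add: e_def)
    define R R' where "R s = psi_err K (exp s)" and "R' s = psi_err K (x * exp (- s))" for s
    have R': "R' s = R (X - s)" for s
      using X by (simp add: R_def R'_def exp_diff exp_minus divide_inverse)
    define A where "A = integral {-X..2 * X} (\<lambda>s. (R s)\<^sup>2)"
    have AE: "A \<le> E K" unfolding A_def R_def E_def X_def by (rule psi_err_exp_integral[OF x])
    have iR: "((\<lambda>s. (R s)\<^sup>2) has_integral A) {-X..2 * X}" unfolding A_def R_def
      by (rule integrable_integral[OF psi_err_exp_sq_integrable])
    \<comment> \<open>The range is symmetric about X / 2, so the reflection gives both errors the
      same mean square.\<close>
    have iR': "((\<lambda>s. (R' s)\<^sup>2) has_integral A) {-X..2 * X}"
      unfolding R' by (rule has_integral_reflect_sym[OF iR]) simp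
    have iP: "(\<lambda>s. psi_fourier K (exp s) * psi_fourier K (x * exp (- s))) integrable_on {-X..2 * X}"
      by (intro integrable_continuous_real continuous_intros
            continuous_on_compose2[OF psi_fourier_continuous[of UNIV]]) auto
    have iJ: "(\<lambda>s. psi (exp s) * psi (x * exp (- s))) integrable_on {-X..2 * X}"
      by (rule psi_conv_integrable)
    have D: "P K - psi_conv_ext x = integral {-X..2 * X} (\<lambda>s. psi_fourier K (exp s) * psi_fourier K (x * exp (- s))
        - psi (exp s) * psi (x * exp (- s)))"
      unfolding P_def psi_conv_ext_def X_def[symmetric]
      by (rule Henstock_Kurzweil_Integration.integral_diff[OF iP iJ, symmetric])
    have amgm: "\<bar>r\<bar> \<le> e + r\<^sup>2 / (4 * e)" for r :: real
    proof -
      have "0 \<le> (2 * e - \<bar>r\<bar>)\<^sup>2" by simp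
      also have "\<dots> = 4 * e * (e + r\<^sup>2 / (4 * e) - \<bar>r\<bar>)"
        using e by (simp add: power2_eq_square algebra_simps)
      finally show ?thesis using e by (simp add: zero_le_mult_iff)
    qed
    define g where "g s = e + ((R s)\<^sup>2 + (R' s)\<^sup>2) * (1 / (8 * e) + 1/2)" for s
    have ig: "(g has_integral e * (3 * X) + (A + A) * (1 / (8 * e) + 1/2)) {-X..2 * X}"
    proof -
      have "((\<lambda>s. e) has_integral e * (3 * X)) {-X..2 * X}"
        using has_integral_const_real[of e "-X" "2 * X"] X by (simp add: algebra_simps)
      then show ?thesis unfolding g_def[abs_def]
        by (intro has_integral_add has_integral_mult_left iR iR')
    qed
    have "\<bar>P K - psi_conv_ext x\<bar> \<le> e * (3 * X) + (A + A) * (1 / (8 * e) + 1/2)"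
      unfolding D
    proof (rule abs_integral_le_integral[OF Henstock_Kurzweil_Integration.integrable_diff[OF iP iJ] ig])
      fix s
      define p p' where "p = psi (exp s)" and "p' = psi (x * exp (- s))"
      have f: "psi_fourier K (exp s) = R s - p" "psi_fourier K (x * exp (- s)) = R' s - p'"
        by (auto simp: R_def R'_def p_def p'_def psi_err_def)
      have "(R s - p) * (R' s - p') - p * p' = R s * R' s - R s * p' - p * R' s"
        by (simp add: algebra_simps)
      also have "\<bar>\<dots>\<bar> \<le> \<bar>R s * R' s\<bar> + \<bar>R s * p'\<bar> + \<bar>p * R' s\<bar>" by linarith
      also have "\<bar>R s * p'\<bar> \<le> \<bar>R s\<bar> * (1/2)" unfolding abs_mult p'_def
        by (intro mult_left_mono psi_bound) auto
      also have "\<bar>p * R' s\<bar> \<le> (1/2) * \<bar>R' s\<bar>" unfolding abs_mult p_def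
        by (intro mult_right_mono psi_bound) auto
      also have "\<bar>R s * R' s\<bar> \<le> ((R s)\<^sup>2 + (R' s)\<^sup>2) * (1/2)"
      proof -
        have "0 \<le> (\<bar>R s\<bar> - \<bar>R' s\<bar>)\<^sup>2" by simp
        then show ?thesis by (simp add: abs_mult power2_eq_square algebra_simps)
      qed
      also have "((R s)\<^sup>2 + (R' s)\<^sup>2) * (1/2) + \<bar>R s\<bar> * (1/2) + (1/2) * \<bar>R' s\<bar> \<le> g s"
      proof -
        have "g s = ((R s)\<^sup>2 + (R' s)\<^sup>2) * (1/2) + (1/2) * (e + (R s)\<^sup>2 / (4 * e)) + (1/2) * (e + (R' s)\<^sup>2 / (4 * e))"
          using e by (simp add: g_def field_simps)
        moreover have "a + p * (1/2) + (1/2) * q \<le> G"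
          if "G = a + (1/2) * P + (1/2) * Q" "p \<le> P" "q \<le> Q" for a p q P Q G :: real
          using that by linarith
        ultimately show ?thesis using amgm[of "R s"] amgm[of "R' s"] by blast
      qed
      finally show "\<bar>psi_fourier K (exp s) * psi_fourier K (x * exp (- s)) - psi (exp s) * psi (x * exp (- s))\<bar> \<le> g s"
        unfolding f p_def[symmetric] p'_def[symmetric] by simp
    qed
    also have "\<dots> \<le> e * (3 * X) + (E K + E K) * (1 / (8 * e) + 1/2)"
      using AE e by (intro add_left_mono mult_right_mono) auto
    also have "\<dots> = e * (3 * X) + E K / (4 * e) + E K" using e by (simp add: field_simps)
    also have "E K / (4 * e) \<le> e\<^sup>2 / (4 * e)" using e E\<epsilon>[of K] by (intro divide_right_mono) (auto simp: e_def)
    also have "e\<^sup>2 / (4 * e) = e / 4" using e by (simp add: power2_eq_square)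
    finally show ?thesis by (simp add: e_def mult_ac)
  qed
  have "(\<lambda>K. P K - psi_conv_ext x) \<longlonglongrightarrow> 0"
  proof (rule Lim_null_comparison)
    show "\<forall>\<^sub>F K in sequentially. norm (P K - psi_conv_ext x) \<le> 3 * X * \<epsilon> K + \<epsilon> K / 4 + E K"
      using bound by simp
    have "(\<lambda>K. 3 * X * \<epsilon> K + \<epsilon> K / 4 + E K) \<longlonglongrightarrow> 3 * X * 0 + 0 / 4 + 0"
      by (intro tendsto_intros Elim \<epsilon>lim) auto
    then show "(\<lambda>K. 3 * X * \<epsilon> K + \<epsilon> K / 4 + E K) \<longlonglongrightarrow> 0" by simp
  qed
  then have "P \<longlonglongrightarrow> psi_conv_ext x" by (rule LIM_zero_cancel)
  then show ?thesis by (simp only: P_eq[abs_def])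
qed

text \<open>For s > ln x the argument \<open>x * exp (- s)\<close> lies in (0, 1), where the second
  sawtooth is linear. The first one alone is integrated by parts, which gains a factor exp(-s),
  hence O(1 / x).\<close>

lemma psi_conv_ext_tail:
  assumes x: "x \<ge> 1"
  shows "\<bar>integral {ln x..2 * ln x} (\<lambda>s. psi (exp s) * psi (x * exp (- s)))\<bar> \<le> 1 / x"
proof -
  define X where "X = ln x"
  have X: "X \<ge> 0" "exp X = x" using x by (auto simp: X_def)
  define h where "h s = psi (exp s) * psi (x * exp (- s))" for s
  define F where "F s = psi2 (exp s) * (x * exp (- (2 * s)) - exp (- s) / 2)" for s
  define k where "k s = psi2 (exp s) * (- (2 * x * exp (- (2 * s))) + exp (- s) / 2)" for s
  have es: "exp (- s) \<le> 1 / x" "x * exp (- s) \<le> 1" "x * exp (- (2 * s)) \<le> exp (- s)" if "X \<le> s" for s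
  proof -
    have "exp (- s) \<le> exp (- X)" using that by simp
    also have "\<dots> = 1 / x" using X by (simp add: exp_minus inverse_eq_divide)
    finally show *: "exp (- s) \<le> 1 / x" .
    then show **: "x * exp (- s) \<le> 1" using x by (simp add: field_simps)
    have "exp (- (2 * s)) = exp (- s) * exp (- s)" by (simp flip: exp_add)
    then have "x * exp (- (2 * s)) = (x * exp (- s)) * exp (- s)" by simp
    also have "\<dots> \<le> 1 * exp (- s)" using ** by (intro mult_right_mono) auto
    finally show "x * exp (- (2 * s)) \<le> exp (- s)" by simp
  qed
  have kc: "k integrable_on {a..b}" for a b unfolding k_def
    by (intro integrable_continuous_real continuous_intros
        continuous_on_compose2[OF psi2_continuous_on[of UNIV]]) auto
  have hi: "h integrable_on {a..b}" for a b unfolding h_def by (rule psi_conv_integrable)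
  have "((\<lambda>s. h s + k s) has_integral F (2 * X) - F X) {X..2 * X}"
  proof (rule FTC_piecewise[OF finite_exp_Ints[of X "2 * X"]])
    show "continuous_on {X..2 * X} F" unfolding F_def
      by (intro continuous_intros continuous_on_compose2[OF psi2_continuous_on[of UNIV]]) auto
    fix s assume s: "X < s" "s < 2 * X" "s \<notin> {s \<in> {X..2 * X}. exp s \<in> \<int>}"
    then have nz: "exp s \<notin> \<int>" by auto
    have "exp X < exp s" using s by simp
    then have "x * exp (- s) < 1" using X by (simp add: exp_minus field_simps)
    then have p: "psi (x * exp (- s)) = x * exp (- s) - 1/2" using x by (intro psi_unit) auto
    have "((\<lambda>s. x * exp (- (2 * s)) - exp (- s) / 2) has_real_derivative
       - (2 * x * exp (- (2 * s))) + exp (- s) / 2) (at s)"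
      by (auto intro!: derivative_eq_intros)
    from DERIV_mult[OF psi2_exp_deriv[OF nz] this]
    have d: "(F has_real_derivative psi (exp s) * exp s * (x * exp (- (2 * s)) - exp (- s) / 2)
      + (- (2 * x * exp (- (2 * s))) + exp (- s) / 2) * psi2 (exp s)) (at s)"
      unfolding F_def .
    have "exp s * exp (- (2 * s)) = exp (- s)" "exp s * exp (- s) = 1" by (simp_all flip: exp_add)
    then have "exp s * (x * exp (- (2 * s)) - exp (- s) / 2) = x * exp (- s) - 1/2"
      by (simp add: right_diff_distrib mult.left_commute[of "exp s" x])
    then have "psi (exp s) * exp s * (x * exp (- (2 * s)) - exp (- s) / 2) = h s"
      by (simp add: h_def p mult.assoc)
    then show "(F has_real_derivative h s + k s) (at s)"
      by (intro DERIV_cong[OF d]) (simp add: k_def mult.commute)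
  qed (use X in auto)
  then have "integral {X..2 * X} h = F (2 * X) - F X - integral {X..2 * X} k"
    using Henstock_Kurzweil_Integration.integral_add[OF hi kc, of X "2 * X"] by (simp add: has_integral_iff)
  moreover have "\<bar>F s\<bar> \<le> 1/8 * (1 / x)" if "X \<le> s" for s
  proof -
    have "0 \<le> x * exp (- (2 * s))" using x by simp
    then have "\<bar>x * exp (- (2 * s)) - exp (- s) / 2\<bar> \<le> exp (- s)"
      using es(3)[OF that] by (simp add: abs_le_iff)
    then show ?thesis unfolding F_def abs_mult using es(1)[OF that] psi2_bound[of "exp s"]
      by (intro mult_mono) auto
  qed
  then have "\<bar>F X\<bar> \<le> 1/8 * (1 / x)" "\<bar>F (2 * X)\<bar> \<le> 1/8 * (1 / x)" using X by auto
  moreover have "\<bar>integral {X..2 * X} k\<bar> \<le> - (1/2) * exp (- (2 * X)) - - (1/2) * exp (- X)"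
  proof (rule abs_integral_le_integral[OF kc])
    show "((\<lambda>s. 1/2 * exp (- s)) has_integral - (1/2) * exp (- (2 * X)) - - (1/2) * exp (- X)) {X..2 * X}"
      by (rule FTC_piecewise[where S="{}"]) (use X in \<open>auto intro!: derivative_eq_intros continuous_intros\<close>)
    fix s assume s: "X \<le> s"
    have "0 \<le> x * exp (- (2 * s))" using x by simp
    then have "\<bar>- (2 * x * exp (- (2 * s))) + exp (- s) / 2\<bar> \<le> 4 * exp (- s)"
      using es(3)[OF s] by (simp add: abs_le_iff)
    then have "\<bar>k s\<bar> \<le> 1/8 * (4 * exp (- s))" unfolding k_def abs_mult using psi2_bound[of "exp s"]
      by (intro mult_mono) auto
    then show "\<bar>k s\<bar> \<le> 1/2 * exp (- s)" by simp
  qed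
  moreover have "exp (- X) \<le> 1 / x" "0 < exp (- (2 * X))" using es(1)[of X] by auto
  ultimately have "\<bar>integral {X..2 * X} h\<bar> \<le> 1 / x" by linarith
  then show ?thesis by (simp add: h_def[abs_def] X_def)
qed

text \<open>The two added ranges are mirror images under s to ln x - s, which leaves the integrand
  unchanged.\<close>

lemma psi_conv_ext_diff:
  assumes x: "x \<ge> 1"
  shows "\<bar>psi_conv_ext x - psi_conv x\<bar> \<le> 2 / x"
proof -
  define X where "X = ln x"
  have X: "X \<ge> 0" "exp X = x" using x by (auto simp: X_def)
  define h where "h s = psi (exp s) * psi (x * exp (- s))" for s
  have hi: "h integrable_on {a..b}" for a b unfolding h_def by (rule psi_conv_integrable)
  have hX: "h (X - s) = h s" for s
  proof -
    have "exp (X - s) = x * exp (- s)" using X by (simp add: exp_diff exp_minus divide_inverse)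
    moreover have "x * exp (- (X - s)) = exp s"
    proof -
      have "exp X * exp (- (X - s)) = exp s" by (simp flip: exp_add)
      then show ?thesis using X by simp
    qed
    ultimately show ?thesis by (simp add: h_def mult.commute)
  qed
  have "integral {-X..0} h = integral {X..2 * X} h"
  proof -
    have "((\<lambda>s. h ((-1) *\<^sub>R s + X)) has_integral (1 / \<bar>-1\<bar> ^ DIM(real)) *\<^sub>R integral {X..2 * X} h)
     ((\<lambda>s. (1 / (-1)) *\<^sub>R s + - ((1 / (-1)) *\<^sub>R X)) ` cbox X (2 * X))"
      by (rule has_integral_affinity) (use hi in auto)
    moreover have "(\<lambda>s. X - s) ` {X..2 * X} = {-X..0}" by simp
    ultimately have "((\<lambda>s. h (X - s)) has_integral integral {X..2 * X} h) {-X..0}" by simp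
    then show ?thesis by (simp add: hX integral_unique)
  qed
  moreover have "integral {-X..0} h + integral {0..2 * X} h = integral {-X..2 * X} h"
    by (rule Henstock_Kurzweil_Integration.integral_combine[OF _ _ hi]) (use X in auto)
  moreover have "integral {0..X} h + integral {X..2 * X} h = integral {0..2 * X} h"
    by (rule Henstock_Kurzweil_Integration.integral_combine[OF _ _ hi]) (use X in auto)
  moreover have "\<bar>integral {X..2 * X} h\<bar> \<le> 1 / x"
    using psi_conv_ext_tail[OF x] by (simp add: h_def[abs_def] X_def)
  moreover have "psi_conv_ext x = integral {-X..2 * X} h" "psi_conv x = integral {0..X} h"
    by (simp_all add: psi_conv_ext_def psi_conv_def h_def[abs_def] X_def)
  moreover have "2 / x = 1 / x + 1 / x" by simp
  ultimately show ?thesis by linarith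
qed

section \<open>Summation over the Fourier frequencies\<close>

text \<open>The value zeta(9/8); the term n = 0 vanishes because \<open>0 powr a\<close> is 0. The
  exponent is 1 + 1/8, with 1 from the Fourier coefficients and 1/8 from
  \<open>sin_conv_approx\<close>.\<close>

definition zeta98 :: real where
  "zeta98 = (\<Sum>n. real n powr (- (9/8)))"

lemma sum_le_zeta98: "(\<Sum>k=1..K. real k powr (- (9/8))) \<le> zeta98"
  unfolding zeta98_def by (rule sum_le_suminf) (auto simp: summable_real_powr_iff)

lemma zeta98_nonneg: "zeta98 \<ge> 0"
  using sum_le_zeta98[of 0] by simp

lemma double_sum_le_zeta98:
  "(\<Sum>k=1..K. \<Sum>m=1..K. (real k * real m) powr (- (9/8))) \<le> zeta98\<^sup>2"
proof -
  have "(\<Sum>k=1..K. \<Sum>m=1..K. (real k * real m) powr (- (9/8))) =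
     (\<Sum>k=1..K. real k powr (- (9/8))) * (\<Sum>k=1..K. real k powr (- (9/8)))"
    by (simp add: powr_mult sum_product)
  also have "\<dots> \<le> zeta98 * zeta98"
    by (intro mult_mono sum_le_zeta98 zeta98_nonneg sum_nonneg) auto
  finally show ?thesis by (simp add: power2_eq_square)
qed

definition voronoi_term :: "real \<Rightarrow> nat \<Rightarrow> real" where
  "voronoi_term x n = voronoi_osc (real n * x) / (pi\<^sup>2 * real n)"

lemma voronoi_term_eq:
  assumes "x > 0" "n \<ge> 1"
  shows "voronoi_term x n = 1 / (2 * sqrt 2 * pi\<^sup>2) * x powr (- (1/4)) *
    (1 / real n powr (5/4) * sin (4 * pi * sqrt (real n * x) - pi / 4))"
proof -
  have "real n powr (5/4) = real n powr (1 + 1/4)" by simp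
  also have "\<dots> = real n * real n powr (1/4)" using assms by (simp only: powr_add) simp
  finally have "real n powr (- (1/4)) / real n = 1 / real n powr (5/4)"
    using assms by (simp add: powr_minus_divide)
  then have "voronoi_osc (real n * x) / real n = 1 / (2 * sqrt 2) * x powr (- (1/4)) *
    (1 / real n powr (5/4) * sin (4 * pi * sqrt (real n * x) - pi / 4))"
    using assms unfolding voronoi_osc_def by (simp add: powr_mult field_simps)
  moreover have "voronoi_term x n = voronoi_osc (real n * x) / real n / pi\<^sup>2"
    by (simp add: voronoi_term_def)
  ultimately show ?thesis by simp
qed

text \<open>The true decay n^(-5/4) is relaxed to n^(-9/8) so that the majorant in
  \<open>double_sum_le_zeta98\<close> serves here as well.\<close>

lemma voronoi_term_bound:
  assumes "x \<ge> 1" "n \<ge> 1"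
  shows "\<bar>voronoi_term x n\<bar> \<le> real n powr (- (9/8))"
proof -
  have "1 * 1 \<le> (2 * sqrt 2) * pi\<^sup>2"
    by (intro mult_mono) (use pi_gt3 in \<open>auto simp: one_le_power intro: order_trans[of 1 "sqrt 2"]\<close>)
  then have c: "1 / (2 * sqrt 2 * pi\<^sup>2) \<le> 1" by simp
  have "x powr (- (1/4)) \<le> x powr 0" using assms by (intro powr_mono) auto
  then have xp: "x powr (- (1/4)) \<le> 1" using assms by simp
  have "\<bar>voronoi_term x n\<bar> = 1 / (2 * sqrt 2 * pi\<^sup>2) * x powr (- (1/4)) *
    (1 / real n powr (5/4) * \<bar>sin (4 * pi * sqrt (real n * x) - pi / 4)\<bar>)"
    using assms voronoi_term_eq[of x n] by (simp add: abs_mult)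
  also have "\<dots> \<le> 1 * 1 * (1 / real n powr (5/4) * 1)"
    using c xp by (intro mult_mono) auto
  also have "\<dots> = real n powr (- (5/4))" by (simp add: powr_minus_divide)
  also have "\<dots> \<le> real n powr (- (9/8))" using assms by (intro powr_mono) auto
  finally show ?thesis .
qed

lemma voronoi_double_sum_summable:
  assumes x: "x \<ge> 1"
  shows "(\<lambda>(k, m). voronoi_term x (k * m)) summable_on ({1..} \<times> {1..})"
proof (rule abs_summable_summable, rule nonneg_bdd_above_summable_on)
  show "bdd_above (sum (\<lambda>p. norm (case p of (k, m) \<Rightarrow> voronoi_term x (k * m))) `
     {F. F \<subseteq> {1..} \<times> {1..} \<and> finite F})"
  proof (rule bdd_aboveI2)
    fix F :: "(nat \<times> nat) set" assume "F \<in> {F. F \<subseteq> {1..} \<times> {1..} \<and> finite F}"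
    then have F: "F \<subseteq> {1..} \<times> {1..}" "finite F" by auto
    \<comment> \<open>Inserting 0 makes the maximum meaningful for empty F.\<close>
    define K where "K = Max (insert 0 (fst ` F \<union> snd ` F))"
    have "F \<subseteq> {1..K} \<times> {1..K}"
    proof
      fix p assume p: "p \<in> F"
      then have "fst p \<le> K" "snd p \<le> K" unfolding K_def using F(2) by (auto intro!: Max_ge)
      then show "p \<in> {1..K} \<times> {1..K}" using F(1) p by (cases p) auto
    qed
    then have "(\<Sum>p\<in>F. norm (case p of (k, m) \<Rightarrow> voronoi_term x (k * m))) \<le>
      (\<Sum>p\<in>{1..K} \<times> {1..K}. norm (case p of (k, m) \<Rightarrow> voronoi_term x (k * m)))"
      by (intro sum_mono2) auto
    also have "\<dots> = (\<Sum>k=1..K. \<Sum>m=1..K. \<bar>voronoi_term x (k * m)\<bar>)"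
      by (simp add: sum.cartesian_product case_prod_unfold)
    also have "\<dots> \<le> (\<Sum>k=1..K. \<Sum>m=1..K. (real k * real m) powr (- (9/8)))"
    proof (intro sum_mono)
      fix k m assume "k \<in> {1..K}" "m \<in> {1..K}"
      then have "1 \<le> k * m" by simp
      from voronoi_term_bound[OF x this]
      show "\<bar>voronoi_term x (k * m)\<bar> \<le> (real k * real m) powr (- (9/8))" by simp
    qed
    also have "\<dots> \<le> zeta98\<^sup>2" by (rule double_sum_le_zeta98)
    finally show "(\<Sum>p\<in>F. norm (case p of (k, m) \<Rightarrow> voronoi_term x (k * m))) \<le> zeta98\<^sup>2" .
  qed
qed auto

text \<open>Unconditional convergence allows any finite exhaustion; it is applied to squares and to
  regions under hyperbolas.\<close>

lemma exhausting_tendsto_infsum: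
  fixes f :: "'a \<Rightarrow> real"
  assumes "f summable_on A" "\<And>K. finite (B K)" "\<And>K. B K \<subseteq> A"
    and "\<And>p. p \<in> A \<Longrightarrow> \<forall>\<^sub>F K in sequentially. p \<in> B K"
  shows "(\<lambda>K. sum f (B K)) \<longlonglongrightarrow> infsum f A"
proof -
  have "filterlim B (finite_subsets_at_top A) sequentially"
    unfolding filterlim_finite_subsets_at_top
  proof (intro allI impI)
    fix F assume F: "finite F \<and> F \<subseteq> A"
    then have "\<forall>\<^sub>F K in sequentially. \<forall>p\<in>F. p \<in> B K"
      using assms(4) by (intro eventually_ball_finite) auto
    then show "\<forall>\<^sub>F K in sequentially. finite (B K) \<and> F \<subseteq> B K \<and> B K \<subseteq> A"
      by eventually_elim (use assms in auto)
  qed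
  from filterlim_compose[OF infsum_tendsto[OF assms(1)] this] show ?thesis .
qed

text \<open>Truncated Fourier series lead to squares, whereas grouping the pairs with k m = n, which
  produces the divisor function, leads to hyperbolas. Absolute convergence gives both the same
  limit.\<close>

lemma voronoi_sum_limits:
  assumes x: "x \<ge> 1"
  defines "s \<equiv> infsum (\<lambda>(k, m). voronoi_term x (k * m)) ({1..} \<times> {1..})"
  shows "(\<lambda>K. \<Sum>k=1..K. \<Sum>m=1..K. voronoi_term x (k * m)) \<longlonglongrightarrow> s"
    and "(\<lambda>K. \<Sum>n=1..K. real (num_divisors n) * voronoi_term x n) \<longlonglongrightarrow> s"
proof -
  have ev: "\<forall>\<^sub>F K in sequentially. n \<le> K" for n :: nat by (rule eventually_ge_at_top)
  have "(\<lambda>K. \<Sum>(k, m)\<in>{1..K} \<times> {1..K}. voronoi_term x (k * m)) \<longlonglongrightarrow> s" unfolding s_def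
  proof (rule exhausting_tendsto_infsum[OF voronoi_double_sum_summable[OF x]])
    fix p :: "nat \<times> nat" assume "p \<in> {1..} \<times> {1..}"
    then show "\<forall>\<^sub>F K in sequentially. p \<in> {1..K} \<times> {1..K}"
      using ev[of "max (fst p) (snd p)"] by (cases p) (auto elim!: eventually_mono)
  qed auto
  then show "(\<lambda>K. \<Sum>k=1..K. \<Sum>m=1..K. voronoi_term x (k * m)) \<longlonglongrightarrow> s"
    by (simp add: sum.cartesian_product)
  have "(\<lambda>K. \<Sum>(k, m)\<in>hyp K. voronoi_term x (k * m)) \<longlonglongrightarrow> s" unfolding s_def
  proof (rule exhausting_tendsto_infsum[OF voronoi_double_sum_summable[OF x] finite_hyp])
    show "hyp K \<subseteq> {1..} \<times> {1..}" for K by (auto simp: hyp_def)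
    fix p :: "nat \<times> nat" assume "p \<in> {1..} \<times> {1..}"
    then show "\<forall>\<^sub>F K in sequentially. p \<in> hyp K"
      using ev[of "fst p * snd p"] by (cases p) (auto simp: hyp_def elim!: eventually_mono)
  qed
  moreover have "(\<Sum>(k, m)\<in>hyp K. voronoi_term x (k * m)) =
     (\<Sum>n=1..K. real (num_divisors n) * voronoi_term x n)" for K
  proof -
    have "(\<Sum>(k, m)\<in>hyp K. voronoi_term x (k * m)) =
      (\<Sum>n=1..K. \<Sum>p\<in>{p \<in> hyp K. fst p * snd p = n}. voronoi_term x (fst p * snd p))"
      unfolding case_prod_unfold
    proof (rule sum.group[symmetric, OF finite_hyp])
      show "(\<lambda>p. fst p * snd p) ` hyp K \<subseteq> {1..K}" by (auto simp: hyp_def)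
    qed simp
    also have "\<dots> = (\<Sum>n=1..K. real (num_divisors n) * voronoi_term x n)"
    proof (intro sum.cong refl)
      fix n assume n: "n \<in> {1..K}"
      then have "{p \<in> hyp K. fst p * snd p = n} = {(k, m). k * m = n}"
        by (auto simp: hyp_def intro: Suc_leI)
      moreover have "(\<Sum>p\<in>{p \<in> hyp K. fst p * snd p = n}. voronoi_term x (fst p * snd p)) =
         (\<Sum>p\<in>{p \<in> hyp K. fst p * snd p = n}. voronoi_term x n)"
        by (intro sum.cong) auto
      ultimately show "(\<Sum>p\<in>{p \<in> hyp K. fst p * snd p = n}. voronoi_term x (fst p * snd p)) =
         real (num_divisors n) * voronoi_term x n"
        using num_divisors_conv_pairs[of n] n by simp
    qed
    finally show ?thesis .
  qed
  ultimately show "(\<lambda>K. \<Sum>n=1..K. real (num_divisors n) * voronoi_term x n) \<longlonglongrightarrow> s"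
    by (simp only:)
qed

lemma voronoi_sum_eq_G11:
  assumes x: "x \<ge> 1"
  shows "infsum (\<lambda>(k, m). voronoi_term x (k * m)) ({1..} \<times> {1..}) = G11 x / x"
proof -
  define s where "s = infsum (\<lambda>(k, m). voronoi_term x (k * m)) ({1..} \<times> {1..})"
  define c where "c = 1 / (2 * sqrt 2 * pi\<^sup>2) * x powr (- (1/4))"
  define a where "a n = real (num_divisors (Suc n)) / real (Suc n) powr (5 / 4) *
        sin (4 * pi * sqrt (real (Suc n) * x) - pi / 4)" for n
  have c0: "c \<noteq> 0" using x by (simp add: c_def)
  have "(\<Sum>n<K. c * a n) = (\<Sum>n=1..K. real (num_divisors n) * voronoi_term x n)" for K
  proof (rule sum.reindex_bij_witness[where i="\<lambda>k. k - 1" and j=Suc])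
    fix n
    show "real (num_divisors (Suc n)) * voronoi_term x (Suc n) = c * a n"
      using x voronoi_term_eq[of x "Suc n"] by (simp add: a_def c_def del: of_nat_Suc)
  qed auto
  then have "(\<lambda>n. c * a n) sums s"
    using voronoi_sum_limits(2)[OF x] unfolding sums_def s_def by simp
  then have "a sums (s / c)" using c0 sums_mult_D by (metis nonzero_mult_div_cancel_left sums_divide sums_cong)
  then have "(\<Sum>n. a n) = s / c" by (simp add: sums_iff)
  then have "G11 x = 1 / (2 * sqrt 2 * pi\<^sup>2) * x powr (3/4) * (s / c)"
    by (simp add: G11_def a_def)
  moreover have "x powr (3/4) = x * x powr (- (1/4))"
  proof -
    have "x powr (3/4) = x powr (1 + - (1/4))" by simp
    also have "\<dots> = x * x powr (- (1/4))" using x by (simp only: powr_add) simp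
    finally show ?thesis .
  qed
  then have "1 / (2 * sqrt 2 * pi\<^sup>2) * x powr (3/4) = x * c" by (simp add: c_def)
  ultimately have "G11 x = x * c * (s / c)" by (simp only:)
  then have "G11 x = x * s" using c0 by simp
  then show ?thesis using x by (simp add: s_def)
qed

text \<open>The termwise errors sum to a bound independent of K, which therefore survives the
  passage to the limit. The summand 2 accounts for the widened range of integration.\<close>

lemma psi_conv_voronoi:
  assumes x: "x \<ge> 1"
  shows "\<bar>psi_conv x - G11 x / x\<bar> \<le> (2 + 40 * zeta98\<^sup>2) / sqrt x"
proof -
  define e where "e = x powr (- (1/2))"
  have e: "e = 1 / sqrt x" using x by (simp add: e_def powr_minus_divide powr_half_sqrt)
  have "(\<lambda>K. \<bar>(\<Sum>k=1..K. \<Sum>m=1..K. sin_conv k m x / (pi\<^sup>2 * (real k * real m)))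
      - (\<Sum>k=1..K. \<Sum>m=1..K. voronoi_term x (k * m))\<bar>) \<longlonglongrightarrow> \<bar>psi_conv_ext x - G11 x / x\<bar>"
    using voronoi_sum_limits(1)[OF x] unfolding voronoi_sum_eq_G11[OF x]
    by (intro tendsto_rabs tendsto_diff psi_conv_ext_limit[OF x])
  moreover have "\<bar>(\<Sum>k=1..K. \<Sum>m=1..K. sin_conv k m x / (pi\<^sup>2 * (real k * real m)))
      - (\<Sum>k=1..K. \<Sum>m=1..K. voronoi_term x (k * m))\<bar> \<le> 40 * e * zeta98\<^sup>2" for K
  proof -
    have "\<bar>(\<Sum>k=1..K. \<Sum>m=1..K. sin_conv k m x / (pi\<^sup>2 * (real k * real m)))
      - (\<Sum>k=1..K. \<Sum>m=1..K. voronoi_term x (k * m))\<bar> =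
      \<bar>\<Sum>k=1..K. \<Sum>m=1..K. sin_conv k m x / (pi\<^sup>2 * (real k * real m)) - voronoi_term x (k * m)\<bar>"
      by (simp add: sum_subtractf)
    also have "\<dots> \<le> (\<Sum>k=1..K. \<Sum>m=1..K. \<bar>sin_conv k m x / (pi\<^sup>2 * (real k * real m)) - voronoi_term x (k * m)\<bar>)"
      by (intro order_trans[OF sum_abs] sum_mono sum_abs)
    also have "\<dots> \<le> (\<Sum>k=1..K. \<Sum>m=1..K. 40 * e * (real k * real m) powr (- (9/8)))"
    proof (intro sum_mono)
      fix k m assume "k \<in> {1..K}" "m \<in> {1..K}"
      then have km: "k \<ge> 1" "m \<ge> 1" by auto
      define n where "n = real k * real m"
      have n: "n \<ge> 1" using mult_mono[of 1 "real k" 1 "real m"] km by (simp add: n_def)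
      have "1 * n \<le> pi\<^sup>2 * n" using pi_gt3 n by (intro mult_right_mono) (auto simp: one_le_power)
      then have pn: "n \<le> pi\<^sup>2 * n" by simp
      have "sin_conv k m x / (pi\<^sup>2 * (real k * real m)) - voronoi_term x (k * m) =
         (sin_conv k m x - voronoi_osc (n * x)) / (pi\<^sup>2 * n)"
        by (simp add: voronoi_term_def n_def diff_divide_distrib)
      also have "\<bar>\<dots>\<bar> = \<bar>sin_conv k m x - voronoi_osc (n * x)\<bar> / (pi\<^sup>2 * n)"
        using n by (simp add: abs_mult)
      also have "\<dots> \<le> (40 * (e * n powr (- (1/8)))) / n"
        using sin_conv_approx[OF x km] n pn by (intro frac_le) (auto simp: e_def n_def)
      also have "\<dots> = 40 * e * (n powr (- (1/8)) / n)" by simp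
      also have "n powr (- (1/8)) / n = n powr (- (9/8))"
      proof -
        have "n powr (- (9/8)) = n powr (- (1/8) + - 1)" by simp
        also have "\<dots> = n powr (- (1/8)) * n powr (- 1)" by (rule powr_add)
        also have "n powr (- 1) = 1 / n" using n by (simp add: powr_minus_divide)
        finally show ?thesis by simp
      qed
      finally show "\<bar>sin_conv k m x / (pi\<^sup>2 * (real k * real m)) - voronoi_term x (k * m)\<bar>
        \<le> 40 * e * (real k * real m) powr (- (9/8))" by (simp add: n_def)
    qed
    also have "\<dots> = 40 * e * (\<Sum>k=1..K. \<Sum>m=1..K. (real k * real m) powr (- (9/8)))"
      by (simp add: sum_distrib_left)
    also have "\<dots> \<le> 40 * e * zeta98\<^sup>2"
      by (intro mult_left_mono double_sum_le_zeta98) (simp add: e_def)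
    finally show ?thesis .
  qed
  then have "\<forall>\<^sub>F K in sequentially. \<bar>(\<Sum>k=1..K. \<Sum>m=1..K. sin_conv k m x / (pi\<^sup>2 * (real k * real m)))
      - (\<Sum>k=1..K. \<Sum>m=1..K. voronoi_term x (k * m))\<bar> \<le> 40 * e * zeta98\<^sup>2"
    by (intro always_eventually allI)
  ultimately have A: "\<bar>psi_conv_ext x - G11 x / x\<bar> \<le> 40 * e * zeta98\<^sup>2"
    by (rule tendsto_upperbound) simp
  have "sqrt x \<le> x" using x by (simp add: real_le_lsqrt power2_eq_square)
  then have "2 / x \<le> 2 * e" using x by (simp add: e divide_left_mono)
  then have "\<bar>psi_conv x - G11 x / x\<bar> \<le> 2 * e + 40 * e * zeta98\<^sup>2"
    using A psi_conv_ext_diff[OF x] by linarith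
  also have "\<dots> = (2 + 40 * zeta98\<^sup>2) / sqrt x" by (simp add: e add_divide_distrib)
  finally show ?thesis .
qed

lemma divmain'_psi_conv_voronoi:
  assumes x: "x \<ge> 1"
  shows "\<bar>x * divmain' x * psi_conv x - divmain' x * G11 x\<bar> \<le> (2 + 40 * zeta98\<^sup>2) * (sqrt x * divmain' x)"
proof -
  define m where "m = divmain' x"
  have m: "m \<ge> 0" using divmain'_nonneg[OF x] by (simp add: m_def)
  have "x * m * psi_conv x - m * G11 x = (x * m) * (psi_conv x - G11 x / x)"
    using x by (simp add: field_simps)
  then have "\<bar>x * m * psi_conv x - m * G11 x\<bar> = (x * m) * \<bar>psi_conv x - G11 x / x\<bar>"
    using x m by (simp add: abs_mult)
  also have "\<dots> \<le> (x * m) * ((2 + 40 * zeta98\<^sup>2) / sqrt x)"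
    using psi_conv_voronoi[OF x] x m by (intro mult_left_mono) auto
  also have "\<dots> = (2 + 40 * zeta98\<^sup>2) * ((x / sqrt x) * m)" by simp
  also have "x / sqrt x = sqrt x" using x by (simp add: real_div_sqrt)
  finally show ?thesis by (simp add: m_def)
qed

text \<open>From x >= 2 follows ln x >= 2/3, which lets sqrt x, the constant 2 and M' = ln x + 2
  gamma be absorbed into multiples of sqrt x ln x.\<close>

lemma sum_Delta11_squares:
  fixes x :: real
  assumes x2: "x \<ge> 2"
  shows "\<bar>(\<Sum>n | 1 \<le> n \<and> real n \<le> x. (Delta11 (real n))\<^sup>2)
      - ((1 / 2 - psi x) * (Delta11 x)\<^sup>2
         + integral {1..x} (\<lambda>t. (Delta11 t)\<^sup>2)
         + 1 / 6 * x * (ln x)\<^sup>2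
         + (8 * euler_mascheroni - 1) / 12 * x * ln x
         + (8 * euler_mascheroni\<^sup>2 - 2 * euler_mascheroni + 1) / 12 * x
         + (ln x + 2 * euler_mascheroni) * G11 x)\<bar>
    \<le> (147 + 4 * (2 + 40 * zeta98\<^sup>2)) * (sqrt x * ln x)"
proof -
  from x2 have x: "x \<ge> 1" by simp
  define Z where "Z = 2 + 40 * zeta98\<^sup>2"
  define m where "m = divmain' x"
  define r where "r = sqrt x"
  define L where "L = ln x"
  define E where "E = r * L"
  have r: "r \<ge> 1" "r * r = x" using x by (auto simp: r_def)
  have Z: "Z \<ge> 2" by (simp add: Z_def)
  have L: "L \<ge> 2/3"
  proof -
    have "ln 2 \<le> ln x" using x2 by simp
    then show ?thesis using ln2_ge_two_thirds by (simp add: L_def)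
  qed
  have Lr: "L \<le> 2 * r" using ln_le_minus_one[of r] r x by (simp add: L_def r_def ln_sqrt)
  have m: "m = L + 2 * euler_mascheroni" by (simp add: m_def divmain'_def L_def)
  have m4: "0 \<le> m" "m \<le> 4 * L"
    using m L euler_mascheroni_pos euler_mascheroni_less_13_over_22 by linarith+
  have E: "E \<ge> 2/3" "r \<le> 2 * E" "r * m \<le> 4 * E" "m\<^sup>2 \<le> 32 * E"
  proof -
    have "1 * (2/3) \<le> r * L" using r L by (intro mult_mono) auto
    then show "E \<ge> 2/3" by (simp add: E_def)
    have "r * (2/3) \<le> r * L" using r L by (intro mult_left_mono) auto
    then show "r \<le> 2 * E" using r by (simp add: E_def)
    have "r * m \<le> r * (4 * L)" using r m4 by (intro mult_left_mono) auto
    then show "r * m \<le> 4 * E" by (simp add: E_def)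
    have "m * m \<le> (4 * L) * (4 * L)" using m4 by (intro mult_mono) auto
    also have "\<dots> = 16 * (L * L)" by simp
    also have "L * L \<le> L * (2 * r)" using Lr L by (intro mult_left_mono) auto
    finally show "m\<^sup>2 \<le> 32 * E" by (simp add: E_def power2_eq_square mult_ac)
  qed
  \<comment> \<open>By the bounds in \<open>E\<close> this is at most 20 (4 + 2) + 2 (4 + 4 + 4) + 3
    = 147 times \<open>E\<close>.\<close>
  have b: "20 * (r * (m + 1)) + 2 * (r * (m + 2) + m\<^sup>2 / 8) + 2 \<le> 147 * E"
    using E by (simp add: algebra_simps)
  have "Z * (r * m) \<le> Z * (4 * E)" using E Z by (intro mult_left_mono) auto
  then have z: "Z * (r * m) \<le> 4 * Z * E" by simp
  have "\<bar>S - (a + m * G11 x)\<bar> \<le> (147 + 4 * Z) * E"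
    if "\<bar>S - (a + x * m * psi_conv x)\<bar> \<le> 20 * (r * (m + 1)) + 2 * (r * (m + 2) + m\<^sup>2 / 8) + 2" for S a
  proof -
    have "\<bar>S - (a + m * G11 x)\<bar> \<le> \<bar>S - (a + x * m * psi_conv x)\<bar> + \<bar>x * m * psi_conv x - m * G11 x\<bar>"
      by linarith
    also have "\<dots> \<le> 147 * E + 4 * Z * E"
      using divmain'_psi_conv_voronoi[OF x] z
      by (intro add_mono order_trans[OF that b]) (simp add: Z_def m_def r_def)
    finally show ?thesis by (simp add: algebra_simps)
  qed
  from this[OF sum_Delta11_squares_psi_conv[OF x, folded m_def r_def]] show ?thesis
    by (simp add: m L_def E_def r_def Z_def)
qed

theorem theorem2:
  shows "\<exists>C::real. \<forall>x::real. x \<ge> 2 \<longrightarrow>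
    \<bar>(\<Sum>n | 1 \<le> n \<and> real n \<le> x. (Delta11 (real n))\<^sup>2)
      - ((1 / 2 - psi x) * (Delta11 x)\<^sup>2
         + integral {1..x} (\<lambda>t. (Delta11 t)\<^sup>2)
         + 1 / 6 * x * (ln x)\<^sup>2
         + (8 * euler_mascheroni - 1) / 12 * x * ln x
         + (8 * euler_mascheroni\<^sup>2 - 2 * euler_mascheroni + 1) / 12 * x
         + (ln x + 2 * euler_mascheroni) * G11 x)\<bar>
    \<le> C * (sqrt x * ln x)"
  using sum_Delta11_squares by blast

end
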